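(* Let $G\le\mathrm{O}(d)$ be a semialgebraic subgroup. If the orbits of $G$ are the concentric spheres $\{x:\|x\|=r\}$, $r\ge0$, then the max filtering map of $G$ is $d$-strongly separating. Otherwise, the max filtering map of $G$ is $1$-strongly separating but not $2$-strongly separating.
   Context: A basic semialgebraic subset of $\mathbb{R}^N$ is a set $\{x:p(x)\ge0\}$ with $p$ a real polynomial; a semialgebraic set is one obtained from basic semialgebraic sets by finitely many unions, intersections and complements. A subgroup of $\mathrm{O}(d)$ is semialgebraic if it is a semialgebraic subset of $\mathbb{R}^{d\times d}$. Every semialgebraic set is a finite disjoint union of semialgebraic sets each homeomorphic to an open hypercube $(0,1)^k$ (with $k\ge0$, $k=0$ meaning a point); its dimension is the maximum such $k$ (independent of the decomposition). For $x\in\mathbb{R}^d$, $[x]:=\{gx:g\in G\}$, and the max filtering map is $\mathbb{R}^d\times\mathbb{R}^d\to\mathbb{R}$, $(x,y)\mapsto\langle\!\langle[x],[y]\rangle\!\rangle:=\sup_{p\in[x],q\in[y]}\langle p,q\rangle$. For $k\in\mathbb{N}$, the max filtering map is $k$-strongly separating if for all $x,y\in\mathbb{R}^d$ with $[x]\ne[y]$, the set $\{z\in\mathbb{R}^d:\langle\!\langle[z],[x]\rangle\!\rangle=\langle\!\langle[z],[y]\rangle\!\rangle\}$ has dimension at most $d-k$. *)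

theory Defs
  imports "HOL-Analysis.Analysis"
begin

inductive_set poly_fun :: "('a::euclidean_space \<Rightarrow> real) set" where
  pf_const: "(\<lambda>x. c) \<in> poly_fun"
| pf_coord: "b \<in> Basis \<Longrightarrow> (\<lambda>x. x \<bullet> b) \<in> poly_fun"
| pf_add: "p \<in> poly_fun \<Longrightarrow> q \<in> poly_fun \<Longrightarrow> (\<lambda>x. p x + q x) \<in> poly_fun"
| pf_mult: "p \<in> poly_fun \<Longrightarrow> q \<in> poly_fun \<Longrightarrow> (\<lambda>x. p x * q x) \<in> poly_fun"

inductive_set semialgebraic :: "'a::euclidean_space set set" where
  sa_basic: "p \<in> poly_fun \<Longrightarrow> {x. p x \<ge> 0} \<in> semialgebraic"
| sa_union: "S \<in> semialgebraic \<Longrightarrow> T \<in> semialgebraic \<Longrightarrow> S \<union> T \<in> semialgebraic"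
| sa_inter: "S \<in> semialgebraic \<Longrightarrow> T \<in> semialgebraic \<Longrightarrow> S \<inter> T \<in> semialgebraic"
| sa_compl: "S \<in> semialgebraic \<Longrightarrow> - S \<in> semialgebraic"

definition open_cube :: "'n::finite set \<Rightarrow> (real^'n) set" where
  "open_cube J = {x. \<forall>i. (i \<in> J \<longrightarrow> 0 < x$i \<and> x$i < 1) \<and> (i \<notin> J \<longrightarrow> x$i = 0)}"

text \<open>A semialgebraic set S has dimension at most m: it is a finite disjoint union of
  semialgebraic sets each homeomorphic to some (0,1)^k with k \<le> m.  (Since the dimension
  is independent of the decomposition, this is equivalent to dim S \<le> m.)\<close>
definition sa_dim_le :: "(real^'n::finite) set \<Rightarrow> int \<Rightarrow> bool" where
  "sa_dim_le S m \<longleftrightarrow> (\<exists>P. finite P \<and> \<Union>P = S \<and> pairwise disjnt P \<and>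
     (\<forall>C\<in>P. C \<in> semialgebraic \<and> (\<exists>J::'n set. C homeomorphic open_cube J \<and> int (card J) \<le> m)))"

definition semialg_orth_subgroup :: "(real^'d^'d::finite) set \<Rightarrow> bool" where
  "semialg_orth_subgroup G \<longleftrightarrow> G \<subseteq> {A. orthogonal_matrix A} \<and> mat 1 \<in> G \<and>
     (\<forall>g\<in>G. \<forall>h\<in>G. g ** h \<in> G) \<and> (\<forall>g\<in>G. matrix_inv g \<in> G) \<and> G \<in> semialgebraic"

definition orbit :: "(real^'d^'d::finite) set \<Rightarrow> real^'d \<Rightarrow> (real^'d) set" where
  "orbit G x = (\<lambda>g. g *v x) ` G"

definition max_filter :: "(real^'d^'d::finite) set \<Rightarrow> real^'d \<Rightarrow> real^'d \<Rightarrow> real" where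
  "max_filter G x y = (SUP pq \<in> orbit G x \<times> orbit G y. fst pq \<bullet> snd pq)"

definition strongly_separating :: "(real^'d^'d::finite) set \<Rightarrow> nat \<Rightarrow> bool" where
  "strongly_separating G k \<longleftrightarrow> (\<forall>x y. orbit G x \<noteq> orbit G y \<longrightarrow>
     sa_dim_le {z. max_filter G z x = max_filter G z y} (int CARD('d) - int k))"

end

theory Submission
  imports Defs
begin

text \<open>
  Semialgebraic sets are handled through a cylindrical decomposition. For finitely many polynomials
  in a last variable, whose coefficients are polynomials in the parameters, the parameter space is
  split into finitely many semialgebraic pieces over whose connected subsets the real roots are
  ordered continuous semialgebraic functions. This goes by induction on the degree: between
  consecutive roots of \<open>f'\<close> and of the lower polynomials \<open>q\<close>, a polynomial \<open>f\<close> is strictly monotone,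
  and its sign at a root of \<open>q\<close> is the sign of a combination of \<open>f\<close> and \<open>q\<close> of smaller degree.
  Graphs and bands over the cells of the parameter space then give a decomposition into cells
  homeomorphic to cubes, and also the projection theorem of Tarski and Seidenberg.

  A semialgebraic subgroup \<open>G\<close> of the orthogonal group contains a nonempty open subset of its
  closure and is therefore compact, so that \<open>\<langle>\<langle>[z], [x]\<rangle>\<rangle>\<close> is the maximum of \<open>\<langle>z, p\<rangle>\<close> over \<open>p \<in> [x]\<close>
  and the set \<open>Z\<close> where two max filters agree is semialgebraic. If \<open>p\<close> is a maximiser at \<open>z\<close>, then at
  \<open>w = z + t p\<close> the point \<open>p\<close> maximises with quadratic growth; if two max filters agree near \<open>w\<close>,
  then \<open>p\<close> lies in both orbits. So \<open>Z\<close> has empty interior when the orbits differ, and its cells have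
  dimension at most \<open>d - 1\<close> by invariance of domain.

  If the orbits are not the spheres, there are unit vectors \<open>x\<close>, \<open>y\<close> with \<open>\<langle>x, y\<rangle> > 0\<close> in different
  orbits. At a suitable \<open>w\<close> both max filters have almost unique maximisers \<open>p\<close> and \<open>q\<close>; rescaling \<open>y\<close>
  by a factor \<open>s\<close> makes the two max filters equal at \<open>w\<close>, and near \<open>w\<close> their difference is strictly
  increasing in the direction \<open>p - s q\<close>. Hence \<open>Z\<close> contains the graph of a continuous function of
  \<open>d - 1\<close> variables, which is not covered by finitely many cells of dimension at most \<open>d - 2\<close>.
\<close>

section \<open>Polynomial functions and semialgebraic sets\<close>

lemma poly_fun_uminus: "p \<in> poly_fun \<Longrightarrow> (\<lambda>x. - p x) \<in> poly_fun"
  using pf_mult[OF pf_const[of "-1"], of p] by simp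

lemma poly_fun_diff: "p \<in> poly_fun \<Longrightarrow> q \<in> poly_fun \<Longrightarrow> (\<lambda>x. p x - q x) \<in> poly_fun"
  using pf_add[OF _ poly_fun_uminus, of p q] by simp

lemma poly_fun_sum: "(\<And>i. i \<in> I \<Longrightarrow> f i \<in> poly_fun) \<Longrightarrow> (\<lambda>x. \<Sum>i\<in>I. f i x) \<in> poly_fun"
  by (induction I rule: infinite_finite_induct) (auto intro: poly_fun.intros)

lemma poly_fun_power: "f \<in> poly_fun \<Longrightarrow> (\<lambda>x. f x ^ n) \<in> poly_fun"
  by (induction n) (auto intro: poly_fun.intros)

lemma poly_fun_inner:
  assumes "\<And>b. b \<in> Basis \<Longrightarrow> (\<lambda>x. f x \<bullet> b) \<in> poly_fun" "\<And>b. b \<in> Basis \<Longrightarrow> (\<lambda>x. g x \<bullet> b) \<in> poly_fun"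
  shows "(\<lambda>x. f x \<bullet> g x) \<in> poly_fun"
  by (subst euclidean_inner) (intro poly_fun_sum pf_mult assms)

lemma poly_fun_inner_const: "(\<lambda>x. x \<bullet> c) \<in> poly_fun"
  by (rule poly_fun_inner) (auto intro: poly_fun.intros)

lemma poly_fun_compose:
  assumes "p \<in> poly_fun" "\<And>b. b \<in> Basis \<Longrightarrow> (\<lambda>x. f x \<bullet> b) \<in> poly_fun"
  shows "(\<lambda>x. p (f x)) \<in> poly_fun"
  using assms(1) by (induction) (auto intro: poly_fun.intros assms(2))

lemma continuous_on_poly_fun:
  assumes "p \<in> poly_fun" "continuous_on S f"
  shows "continuous_on S (\<lambda>x. p (f x))"
  using assms(1) by (induction) (auto intro!: continuous_intros assms(2))

lemma semialgebraic_UNIV: "UNIV \<in> semialgebraic"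
  using sa_basic[OF pf_const[of 0]] by simp

lemma semialgebraic_empty: "{} \<in> semialgebraic"
  using sa_compl[OF semialgebraic_UNIV] by simp

lemma semialgebraic_le:
  assumes "p \<in> poly_fun" "q \<in> poly_fun"
  shows "{x. p x \<le> q x} \<in> semialgebraic"
  using sa_basic[OF poly_fun_diff[OF assms(2,1)]] by simp

lemma semialgebraic_less:
  assumes "p \<in> poly_fun" "q \<in> poly_fun"
  shows "{x. p x < q x} \<in> semialgebraic"
proof -
  have "{x. p x < q x} = - {x. q x \<le> p x}" by auto
  then show ?thesis using sa_compl[OF semialgebraic_le[OF assms(2,1)]] by simp
qed

lemma semialgebraic_eq:
  assumes "p \<in> poly_fun" "q \<in> poly_fun"
  shows "{x. p x = q x} \<in> semialgebraic"
proof -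
  have "{x. p x = q x} = {x. p x \<le> q x} \<inter> {x. q x \<le> p x}" by auto
  then show ?thesis using sa_inter[OF semialgebraic_le semialgebraic_le] assms by metis
qed

lemma semialgebraic_Un_family:
  assumes "finite I" "\<And>i. i \<in> I \<Longrightarrow> S i \<in> semialgebraic"
  shows "(\<Union>i\<in>I. S i) \<in> semialgebraic"
  using assms by (induction I) (auto intro: semialgebraic_empty sa_union)

lemma semialgebraic_Int_family:
  assumes "finite I" "\<And>i. i \<in> I \<Longrightarrow> S i \<in> semialgebraic"
  shows "(\<Inter>i\<in>I. S i) \<in> semialgebraic"
  using assms by (induction I) (auto intro: semialgebraic_UNIV sa_inter)

lemma semialgebraic_Diff: "S \<in> semialgebraic \<Longrightarrow> T \<in> semialgebraic \<Longrightarrow> S - T \<in> semialgebraic"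
  unfolding Diff_eq by (intro sa_inter sa_compl)

lemma semialgebraic_vimage:
  assumes "S \<in> semialgebraic" "\<And>b. b \<in> Basis \<Longrightarrow> (\<lambda>x. f x \<bullet> b) \<in> poly_fun"
  shows "f -` S \<in> semialgebraic"
  using assms(1)
proof (induction)
  case (sa_basic p)
  have "f -` {x. p x \<ge> 0} = {x. p (f x) \<ge> 0}" by auto
  then show ?case using semialgebraic.sa_basic[OF poly_fun_compose[OF sa_basic assms(2)]] by simp
qed (simp_all add: semialgebraic.intros vimage_Compl)

text \<open>By induction on the construction, collecting the polynomials that occur. Hence a set on
  which all their signs are constant lies in \<open>S\<close> or misses it, which is how cells are
  compared with \<open>S\<close> later.\<close>

lemma semialgebraic_sign_determined:
  assumes "S \<in> semialgebraic"
  obtains P where "finite P" "P \<subseteq> poly_fun"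
    "\<And>x y. (\<And>p. p \<in> P \<Longrightarrow> sgn (p x) = sgn (p y)) \<Longrightarrow> x \<in> S \<longleftrightarrow> y \<in> S"
proof -
  have "\<exists>P. finite P \<and> P \<subseteq> poly_fun \<and>
    (\<forall>x y. (\<forall>p\<in>P. sgn (p x) = sgn (p y)) \<longrightarrow> (x \<in> S \<longleftrightarrow> y \<in> S))"
    using assms
  proof induction
    case (sa_basic p)
    then show ?case
      by (intro exI[of _ "{p}"]) (auto simp: sgn_if split: if_splits)
  next
    case (sa_union S T)
    then obtain P Q where "finite P \<and> P \<subseteq> poly_fun \<and>
      (\<forall>x y. (\<forall>p\<in>P. sgn (p x) = sgn (p y)) \<longrightarrow> (x \<in> S \<longleftrightarrow> y \<in> S))"
      "finite Q \<and> Q \<subseteq> poly_fun \<and>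
      (\<forall>x y. (\<forall>p\<in>Q. sgn (p x) = sgn (p y)) \<longrightarrow> (x \<in> T \<longleftrightarrow> y \<in> T))" by auto
    then show ?case by (intro exI[of _ "P \<union> Q"]) blast
  next
    case (sa_inter S T)
    then obtain P Q where "finite P \<and> P \<subseteq> poly_fun \<and>
      (\<forall>x y. (\<forall>p\<in>P. sgn (p x) = sgn (p y)) \<longrightarrow> (x \<in> S \<longleftrightarrow> y \<in> S))"
      "finite Q \<and> Q \<subseteq> poly_fun \<and>
      (\<forall>x y. (\<forall>p\<in>Q. sgn (p x) = sgn (p y)) \<longrightarrow> (x \<in> T \<longleftrightarrow> y \<in> T))" by auto
    then show ?case by (intro exI[of _ "P \<union> Q"]) blast
  next
    case (sa_compl S)
    then show ?case by simp
  qed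
  then obtain P where "finite P" "P \<subseteq> poly_fun"
    "\<forall>x y. (\<forall>p\<in>P. sgn (p x) = sgn (p y)) \<longrightarrow> (x \<in> S \<longleftrightarrow> y \<in> S)" by (elim exE conjE)
  then show ?thesis by (intro that[of P]) auto
qed

text \<open>The pieces may overlap; disjointness is obtained only later, from the cells. What
  matters is that the pieces are semialgebraic and can be refined again and again.\<close>

definition piecewise :: "'a::euclidean_space set \<Rightarrow> ('a set \<Rightarrow> bool) \<Rightarrow> bool" where
  "piecewise A \<Phi> \<longleftrightarrow> (\<exists>\<A>. finite \<A> \<and> \<A> \<subseteq> semialgebraic \<and> \<Union>\<A> = A \<and> (\<forall>B\<in>\<A>. \<Phi> B))"

lemma piecewise_return: "A \<in> semialgebraic \<Longrightarrow> \<Phi> A \<Longrightarrow> piecewise A \<Phi>"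
  unfolding piecewise_def by (rule exI[of _ "{A}"]) auto

text \<open>Each piece is split further and all new pieces are collected. The case distinctions of
  the degree induction are chained in this way.\<close>

lemma piecewise_bind:
  assumes "piecewise A \<Phi>" "\<And>B. B \<in> semialgebraic \<Longrightarrow> B \<subseteq> A \<Longrightarrow> \<Phi> B \<Longrightarrow> piecewise B \<Psi>"
  shows "piecewise A \<Psi>"
proof -
  obtain \<A> where A: "finite \<A>" "\<A> \<subseteq> semialgebraic" "\<Union>\<A> = A" "\<forall>B\<in>\<A>. \<Phi> B"
    using assms(1) unfolding piecewise_def by blast
  have "\<forall>B\<in>\<A>. \<exists>\<B>. finite \<B> \<and> \<B> \<subseteq> semialgebraic \<and> \<Union>\<B> = B \<and> (\<forall>B\<in>\<B>. \<Psi> B)"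
    using assms(2) A unfolding piecewise_def by (metis Union_upper subset_iff)
  then obtain \<B> where B: "\<And>B. B \<in> \<A> \<Longrightarrow> finite (\<B> B) \<and> \<B> B \<subseteq> semialgebraic \<and> \<Union>(\<B> B) = B \<and> (\<forall>B\<in>\<B> B. \<Psi> B)"
    by metis
  show ?thesis unfolding piecewise_def
    by (rule exI[of _ "\<Union>B\<in>\<A>. \<B> B"]) (use A B in \<open>fastforce\<close>)
qed

lemma piecewise_mono:
  assumes "piecewise A \<Phi>" "\<And>B. B \<in> semialgebraic \<Longrightarrow> B \<subseteq> A \<Longrightarrow> \<Phi> B \<Longrightarrow> \<Psi> B"
  shows "piecewise A \<Psi>"
  using assms(1) by (rule piecewise_bind) (auto intro: piecewise_return assms(2))

lemma piecewise_zero_constant: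
  assumes "A \<in> semialgebraic" "finite P" "P \<subseteq> poly_fun"
  shows "piecewise A (\<lambda>B. \<forall>p\<in>P. (\<forall>x\<in>B. p x = 0) \<or> (\<forall>x\<in>B. p x \<noteq> 0))"
  using assms(2,3)
proof (induction P)
  case empty
  then show ?case using assms(1) by (auto intro: piecewise_return)
next
  case (insert p P)
  have "piecewise A (\<lambda>B. \<forall>p\<in>P. (\<forall>x\<in>B. p x = 0) \<or> (\<forall>x\<in>B. p x \<noteq> 0))"
    using insert by auto
  then show ?case
  proof (rule piecewise_bind)
    fix B assume B: "B \<in> semialgebraic" "B \<subseteq> A" "\<forall>p\<in>P. (\<forall>x\<in>B. p x = 0) \<or> (\<forall>x\<in>B. p x \<noteq> 0)"
    let ?Z = "{x. p x = 0}"
    have Z: "?Z \<in> semialgebraic" using insert by (auto intro: semialgebraic_eq pf_const)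
    show "piecewise B (\<lambda>B. \<forall>p\<in>insert p P. (\<forall>x\<in>B. p x = 0) \<or> (\<forall>x\<in>B. p x \<noteq> 0))"
      unfolding piecewise_def
      by (rule exI[of _ "{B \<inter> ?Z, B \<inter> - ?Z}"]) (use B Z in \<open>auto intro: sa_inter sa_compl\<close>)
  qed
qed

text \<open>Polynomials in one further variable whose coefficients depend polynomially on a
  parameter. The uniform degree bound turns evaluation into a sum of fixed length, hence into a
  polynomial in parameter and variable together; the actual degree may still drop at some
  parameters.\<close>

definition poly_family :: "('a::euclidean_space \<Rightarrow> real poly) set" where
  "poly_family = {f. (\<forall>i. (\<lambda>x. coeff (f x) i) \<in> poly_fun) \<and> (\<exists>N. \<forall>x. degree (f x) \<le> N)}"

lemma poly_familyI:
  assumes "\<And>i. (\<lambda>x. coeff (f x) i) \<in> poly_fun" "\<And>x. degree (f x) \<le> N"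
  shows "f \<in> poly_family"
  using assms unfolding poly_family_def by blast

lemma poly_family_coeff: "f \<in> poly_family \<Longrightarrow> (\<lambda>x. coeff (f x) i) \<in> poly_fun"
  unfolding poly_family_def by blast

lemma poly_family_degree:
  assumes "f \<in> poly_family" obtains N where "\<And>x. degree (f x) \<le> N"
  using assms unfolding poly_family_def by blast

lemma poly_family_pderiv:
  assumes "f \<in> poly_family" shows "(\<lambda>x. pderiv (f x)) \<in> poly_family"
proof -
  obtain N where N: "\<And>x. degree (f x) \<le> N" by (rule poly_family_degree[OF assms]) blast
  show ?thesis
    by (rule poly_familyI[of _ N])
      (auto simp: coeff_pderiv degree_pderiv le_diff_conv intro!: pf_mult pf_const poly_family_coeff assms le_SucI N)
qed

lemma poly_family_add:
  assumes "f \<in> poly_family" "g \<in> poly_family" shows "(\<lambda>x. f x + g x) \<in> poly_family"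
proof -
  obtain N where N: "\<And>x. degree (f x) \<le> N" by (rule poly_family_degree[OF assms(1)]) blast
  obtain M where M: "\<And>x. degree (g x) \<le> M" by (rule poly_family_degree[OF assms(2)]) blast
  show ?thesis
    by (rule poly_familyI[of _ "max N M"])
      (auto intro!: pf_add poly_family_coeff assms degree_add_le max.coboundedI1[OF N] max.coboundedI2[OF M])
qed

lemma poly_family_mult:
  assumes "f \<in> poly_family" "g \<in> poly_family" shows "(\<lambda>x. f x * g x) \<in> poly_family"
proof -
  obtain N where N: "\<And>x. degree (f x) \<le> N" by (rule poly_family_degree[OF assms(1)]) blast
  obtain M where M: "\<And>x. degree (g x) \<le> M" by (rule poly_family_degree[OF assms(2)]) blast
  show ?thesis
    by (rule poly_familyI[of _ "N + M"])
      (auto simp: coeff_mult intro!: poly_fun_sum pf_mult poly_family_coeff assms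
        order.trans[OF degree_mult_le] add_mono N M)
qed

lemma poly_family_const: "(\<lambda>x. c) \<in> poly_family"
  by (rule poly_familyI[of _ "degree c"]) (auto intro: pf_const)

lemma poly_family_coeff_const: "p \<in> poly_fun \<Longrightarrow> (\<lambda>x. [:p x:]) \<in> poly_family"
  by (rule poly_familyI[of _ 0], rename_tac i, case_tac i) (auto intro: pf_const)

lemma poly_eq_sum_coeff:
  fixes p :: "'b::comm_semiring_1 poly"
  shows "degree p \<le> N \<Longrightarrow> poly p y = (\<Sum>i\<le>N. coeff p i * y ^ i)"
  by (subst poly_altdef, rule sum.mono_neutral_left) (auto simp: coeff_eq_0)

lemma poly_fun_poly_family:
  assumes "f \<in> poly_family" "\<And>b. b \<in> Basis \<Longrightarrow> (\<lambda>x. h x \<bullet> b) \<in> poly_fun" "g \<in> poly_fun"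
  shows "(\<lambda>x. poly (f (h x)) (g x)) \<in> poly_fun"
proof -
  obtain N where N: "\<And>x. degree (f x) \<le> N" by (rule poly_family_degree[OF assms(1)]) blast
  have "(\<lambda>x. poly (f (h x)) (g x)) = (\<lambda>x. \<Sum>i\<le>N. coeff (f (h x)) i * g x ^ i)"
    by (rule ext) (rule poly_eq_sum_coeff, rule N)
  then show ?thesis
    using assms by (auto intro!: poly_fun_sum pf_mult poly_fun_power poly_fun_compose[OF poly_family_coeff])
qed

lemma continuous_on_poly_family:
  assumes "f \<in> poly_family" "continuous_on S h" "continuous_on S g"
  shows "continuous_on S (\<lambda>x. poly (f (h x)) (g x))"
proof -
  obtain N where N: "\<And>x. degree (f x) \<le> N" by (rule poly_family_degree[OF assms(1)]) blast
  have "continuous_on S (\<lambda>x. \<Sum>i\<le>N. coeff (f (h x)) i * g x ^ i)"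
    by (intro continuous_intros continuous_on_poly_fun[OF poly_family_coeff[OF assms(1)]] assms)
  then show ?thesis by (simp only: poly_eq_sum_coeff[OF N])
qed

text \<open>Restricting \<open>p\<close> to the lines in direction \<open>b\<close> singles out the
  coordinate that is to be eliminated.\<close>

lemma poly_fun_along_basis:
  assumes "p \<in> poly_fun" "b \<in> Basis"
  obtains f where "f \<in> poly_family" "\<And>x t. poly (f x) t = p (x + t *\<^sub>R b)"
proof -
  have "\<exists>f\<in>poly_family. \<forall>x t. poly (f x) t = p (x + t *\<^sub>R b)"
    using assms(1)
  proof induction
    case (pf_const c)
    show ?case by (rule bexI[OF _ poly_family_const[of "[:c:]"]]) auto
  next
    case (pf_coord c)
    show ?case
      by (rule bexI[OF _ poly_family_add[OF poly_family_coeff_const[OF poly_fun.pf_coord[OF pf_coord]]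
              poly_family_const[of "[:0, b \<bullet> c:]"]]])
        (auto simp: algebra_simps)
  next
    case (pf_add p q)
    then obtain f g where "f \<in> poly_family" "g \<in> poly_family"
      "\<And>x t. poly (f x) t = p (x + t *\<^sub>R b)" "\<And>x t. poly (g x) t = q (x + t *\<^sub>R b)" by blast
    then show ?case by (intro bexI[OF _ poly_family_add[of f g]]) auto
  next
    case (pf_mult p q)
    then obtain f g where "f \<in> poly_family" "g \<in> poly_family"
      "\<And>x t. poly (f x) t = p (x + t *\<^sub>R b)" "\<And>x t. poly (g x) t = q (x + t *\<^sub>R b)" by blast
    then show ?case by (intro bexI[OF _ poly_family_mult[of f g]]) auto
  qed
  then show ?thesis using that by blast
qed

text \<open>Vanishing and degree can be read off from the set of nonzero coefficients, and only
  those up to \<open>N f\<close> can be nonzero. Splitting by their zero sets therefore fixes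
  both.\<close>

lemma piecewise_degree_constant:
  assumes "A \<in> semialgebraic" "finite F" "F \<subseteq> poly_family"
  shows "piecewise A (\<lambda>B. \<forall>f\<in>F. ((\<forall>x\<in>B. f x = 0) \<or> (\<forall>x\<in>B. f x \<noteq> 0)) \<and> (\<exists>k. \<forall>x\<in>B. degree (f x) = k))"
proof -
  have "\<forall>f\<in>F. \<exists>N. \<forall>x. degree (f x) \<le> N" using assms(3) poly_family_degree by blast
  then obtain N where N: "\<And>f x. f \<in> F \<Longrightarrow> degree (f x) \<le> N f" by metis
  define P where "P = (\<Union>f\<in>F. (\<lambda>i x. coeff (f x) i) ` {..N f})"
  have "piecewise A (\<lambda>B. \<forall>p\<in>P. (\<forall>x\<in>B. p x = 0) \<or> (\<forall>x\<in>B. p x \<noteq> 0))"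
    using assms by (intro piecewise_zero_constant) (auto simp: P_def intro: poly_family_coeff)
  then show ?thesis
  proof (rule piecewise_mono, intro ballI)
    fix B f assume B: "\<forall>p\<in>P. (\<forall>x\<in>B. p x = 0) \<or> (\<forall>x\<in>B. p x \<noteq> 0)" and f: "f \<in> F"
    have *: "coeff (f x) i = 0 \<longleftrightarrow> coeff (f y) i = 0" if "x \<in> B" "y \<in> B" for x y i
    proof (cases "i \<le> N f")
      case True
      then have "(\<lambda>x. coeff (f x) i) \<in> P" using f by (auto simp: P_def)
      from bspec[OF B this] show ?thesis using that by auto
    next
      case False
      then show ?thesis using N[OF f] by (metis coeff_eq_0 le_less_trans not_le)
    qed
    then have zero: "f x = 0 \<longleftrightarrow> f y = 0" and deg: "degree (f x) = degree (f y)" if "x \<in> B" "y \<in> B" for x y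
      using *[OF that] by (simp_all only: poly_eq_iff degree_def coeff_0)
    show "((\<forall>x\<in>B. f x = 0) \<or> (\<forall>x\<in>B. f x \<noteq> 0)) \<and> (\<exists>k. \<forall>x\<in>B. degree (f x) = k)"
    proof (cases "B = {}")
      case False
      then obtain y where y: "y \<in> B" by auto
      show ?thesis using zero[OF _ y] deg[OF _ y] by auto
    qed auto
  qed
qed

section \<open>Real roots of polynomials with parameters\<close>

lemma real_between_finite_sets:
  fixes A B :: "real set"
  assumes "finite A" "finite B" "\<And>a b. a \<in> A \<Longrightarrow> b \<in> B \<Longrightarrow> a < b"
  obtains y where "\<And>a. a \<in> A \<Longrightarrow> a < y" "\<And>b. b \<in> B \<Longrightarrow> y < b"
proof (cases "A = {} \<or> B = {}")
  case True
  obtain l where l: "\<And>b. b \<in> B \<Longrightarrow> l < b"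
    using assms(2) by (meson bdd_below_finite bdd_below_def lt_ex less_le_trans)
  obtain u where u: "\<And>a. a \<in> A \<Longrightarrow> a < u"
    using assms(1) by (meson bdd_above_finite bdd_above_def gt_ex le_less_trans)
  show ?thesis using True that[of l] that[of u] l u by auto
next
  case False
  then have "Max A < Min B" using assms by auto
  then obtain y where "Max A < y" "y < Min B" using dense by blast
  then show ?thesis using that[of y] False assms by auto
qed

text \<open>After the reflection \<open>q y = p (-y)\<close> the leading coefficient decides: a
  positive one would make \<open>q'\<close> eventually positive, against the sign of
  \<open>p'\<close>, and a negative one makes \<open>q\<close> eventually negative.\<close>

lemma poly_increasing_unbounded_below:
  fixes p :: "real poly"
  assumes "degree p \<ge> 1" "\<And>y. y < c \<Longrightarrow> poly (pderiv p) y > 0"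
  obtains y where "y < c" "poly p y < 0"
proof (rule ccontr)
  assume *: "\<not> thesis"
  define q where "q = pcompose p [:0, -1:]"
  have poly_q: "poly q y = poly p (-y)" for y by (simp add: q_def poly_pcompose)
  have q': "poly (pderiv q) y = - poly (pderiv p) (-y)" for y
    by (simp add: q_def pderiv_pcompose pderiv_pCons poly_pcompose)
  have deg: "degree q \<ge> 1" using assms(1) by (simp add: q_def degree_pcompose)
  then have q0: "q \<noteq> 0" "pderiv q \<noteq> 0" by (auto simp: pderiv_eq_0_iff)
  have lc: "lead_coeff (pderiv q) = of_nat (degree q) * lead_coeff q"
    using deg by (simp add: degree_pderiv coeff_pderiv)
  show False
  proof (cases "lead_coeff q > 0")
    case True
    then have "lead_coeff (pderiv q) > 0" using lc deg by simp
    then obtain n where n: "\<forall>y\<ge>n. lead_coeff (pderiv q) \<le> poly (pderiv q) y"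
      using poly_pinfty_gt_lc by blast
    \<comment> \<open>The bound \<open>1 - c\<close> ensures \<open>-y < c\<close>, where the
      hypothesis on the derivative applies.\<close>
    define y where "y = max n (1 - c)"
    have "poly (pderiv q) y > 0" "-y < c" using n \<open>lead_coeff (pderiv q) > 0\<close>
      by (auto simp: y_def max_def intro: less_le_trans)
    with assms(2)[of "-y"] q'[of y] show False by simp
  next
    case False
    then have "lead_coeff (-q) > 0" using q0 by (simp add: not_less less_le)
    then obtain n where n: "\<forall>y\<ge>n. lead_coeff (-q) \<le> poly (-q) y"
      using poly_pinfty_gt_lc by blast
    define y where "y = max n (1 - c)"
    have "poly (-q) y > 0" "-y < c" using n \<open>lead_coeff (-q) > 0\<close>
      by (auto simp: y_def max_def intro: less_le_trans)
    with poly_q[of y] show False using that[of "-y"] * by simp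
  qed
qed

lemma poly_strict_increasing:
  fixes p :: "real poly"
  assumes "a < b" "\<And>y. a < y \<Longrightarrow> y < b \<Longrightarrow> poly (pderiv p) y > 0"
  shows "poly p a < poly p b"
  using assms(1)
proof (rule DERIV_pos_imp_increasing_open)
  show "\<exists>z. DERIV (poly p) x :> z \<and> z > 0" if "a < x" "x < b" for x
    using assms(2)[OF that] poly_DERIV by blast
qed (intro continuous_intros)

text \<open>An increasing \<open>p\<close> is negative somewhere on the interval exactly when it
  becomes negative towards the left end. For \<open>U = {}\<close> the right-hand side is vacuous,
  and the interval is unbounded below, where \<open>p\<close> does become negative. The criterion
  uses only the order on \<open>U\<close> and \<open>V\<close> with signs of \<open>p\<close> at the
  end points, and such data can be carried along a connected set of parameters.\<close>

lemma poly_negative_on_interval_iff: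
  fixes p :: "real poly"
  assumes "finite U" "finite V" "degree p \<ge> 1"
    and I: "I = {y. (\<forall>u\<in>U. u < y) \<and> (\<forall>v\<in>V. y < v)}" "I \<noteq> {}"
    and pos: "\<And>y. y \<in> I \<Longrightarrow> poly (pderiv p) y > 0"
  shows "(\<exists>y\<in>I. poly p y < 0) \<longleftrightarrow> (\<forall>u\<in>U. (\<forall>u'\<in>U. u' \<le> u) \<longrightarrow> poly p u < 0)"
proof
  assume "\<exists>y\<in>I. poly p y < 0"
  then obtain y where y: "y \<in> I" "poly p y < 0" by auto
  show "\<forall>u\<in>U. (\<forall>u'\<in>U. u' \<le> u) \<longrightarrow> poly p u < 0"
  proof (intro ballI impI)
    fix u assume u: "u \<in> U" "\<forall>u'\<in>U. u' \<le> u"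
    have "poly p u < poly p y"
      using u y by (intro poly_strict_increasing pos) (fastforce simp: I)+
    then show "poly p u < 0" using y by simp
  qed
next
  assume *: "\<forall>u\<in>U. (\<forall>u'\<in>U. u' \<le> u) \<longrightarrow> poly p u < 0"
  obtain y0 where y0: "y0 \<in> I" using I by auto
  show "\<exists>y\<in>I. poly p y < 0"
  proof (cases "U = {}")
    case True
    obtain y where "y < y0" "poly p y < 0"
    proof (rule poly_increasing_unbounded_below[OF assms(3), of y0])
      show "poly (pderiv p) y > 0" if "y < y0" for y using True y0 that by (intro pos) (fastforce simp: I)
    qed
    then show ?thesis using True y0 by (auto simp: I intro: less_trans)
  next
    case False
    define u where "u = Max U"
    have u: "u \<in> U" "\<And>u'. u' \<in> U \<Longrightarrow> u' \<le> u" using False assms(1) by (auto simp: u_def)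
    have "poly p u < 0" using * u by auto
    moreover have "(poly p \<longlongrightarrow> poly p u) (at_right u)"
      by (intro tendsto_intros)
    ultimately have "\<forall>\<^sub>F y in at_right u. poly p y < 0" by (rule order_tendstoD(2)[rotated])
    moreover have "\<forall>\<^sub>F y in at_right u. y \<in> {u<..<y0}"
      using u y0 by (intro eventually_at_right_real) (auto simp: I)
    ultimately have "\<forall>\<^sub>F y in at_right u. poly p y < 0 \<and> y \<in> {u<..<y0}" by eventually_elim auto
    then obtain y where "poly p y < 0" "u < y" "y < y0"
      using eventually_happens'[OF trivial_limit_at_right_real] by fastforce
    then show ?thesis using y0 u by (intro bexI[of _ y]) (force simp: I)+
  qed
qed

text \<open>Reflection: \<open>- p (-y)\<close> is increasing on the reflected interval, and the
  roles of \<open>U\<close> and \<open>V\<close> are exchanged.\<close>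

lemma poly_positive_on_interval_iff:
  fixes p :: "real poly"
  assumes "finite U" "finite V" "degree p \<ge> 1"
    and I: "I = {y. (\<forall>u\<in>U. u < y) \<and> (\<forall>v\<in>V. y < v)}" "I \<noteq> {}"
    and pos: "\<And>y. y \<in> I \<Longrightarrow> poly (pderiv p) y > 0"
  shows "(\<exists>y\<in>I. poly p y > 0) \<longleftrightarrow> (\<forall>v\<in>V. (\<forall>v'\<in>V. v \<le> v') \<longrightarrow> poly p v > 0)"
proof -
  define q where "q = - pcompose p [:0, -1:]"
  have poly_q: "poly q y = - poly p (-y)" for y by (simp add: q_def poly_pcompose)
  have q': "poly (pderiv q) y = poly (pderiv p) (-y)" for y
    by (simp add: q_def pderiv_minus pderiv_pcompose pderiv_pCons poly_pcompose)
  have deg: "degree q \<ge> 1" using assms(3) by (simp add: q_def degree_pcompose)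
  have "(\<exists>y\<in>uminus ` I. poly q y < 0) \<longleftrightarrow> (\<forall>u\<in>uminus ` V. (\<forall>u'\<in>uminus ` V. u' \<le> u) \<longrightarrow> poly q u < 0)"
  proof (rule poly_negative_on_interval_iff[where V="uminus ` U"])
    show "uminus ` I = {y. (\<forall>u\<in>uminus ` V. u < y) \<and> (\<forall>v\<in>uminus ` U. y < v)}"
    proof (intro set_eqI iffI)
      fix y assume "y \<in> {y. (\<forall>u\<in>uminus ` V. u < y) \<and> (\<forall>v\<in>uminus ` U. y < v)}"
      then have "-y \<in> I" unfolding I by force
      then show "y \<in> uminus ` I" by (metis imageI minus_minus)
    qed (auto simp: I)
  qed (use assms deg q' in auto)
  then show ?thesis by (simp add: poly_q)
qed

lemma connected_nonzero_sign:
  fixes g :: "'a::topological_space \<Rightarrow> real"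
  assumes "connected C" "continuous_on C g" "\<And>x. x \<in> C \<Longrightarrow> g x \<noteq> 0" "x \<in> C" "y \<in> C"
  shows "sgn (g x) = sgn (g y)"
proof (rule ccontr)
  assume "sgn (g x) \<noteq> sgn (g y)"
  then have "(g x < 0 \<and> g y > 0) \<or> (g x > 0 \<and> g y < 0)"
    using assms(3)[OF assms(4)] assms(3)[OF assms(5)] by (auto simp: sgn_if split: if_splits)
  moreover have "connected (g ` C)" using assms by (intro connected_continuous_image)
  ultimately have "0 \<in> g ` C"
    using assms(4,5) connectedD_interval[of "g ` C" "g x" "g y" 0] connectedD_interval[of "g ` C" "g y" "g x" 0] by auto
  then show False using assms(3) by auto
qed

section \<open>Root functions over a set of parameters\<close>

definition drop_coord :: "'a::euclidean_space \<Rightarrow> 'a \<Rightarrow> 'a" where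
  "drop_coord b z = z - (z \<bullet> b) *\<^sub>R b"

text \<open>Points over a parameter \<open>x\<close> with extra coordinate \<open>y\<close> are encoded as \<open>x + y b\<close>, so that
  \<open>x = drop_coord b z\<close> and \<open>y = z \<bullet> b\<close>.\<close>

definition semialgebraic_function :: "'a::euclidean_space \<Rightarrow> 'a set \<Rightarrow> ('a \<Rightarrow> real) \<Rightarrow> bool" where
  "semialgebraic_function b C \<xi> \<longleftrightarrow> continuous_on C \<xi> \<and>
     {z. drop_coord b z \<in> C \<and> z \<bullet> b = \<xi> (drop_coord b z)} \<in> semialgebraic \<and>
     {z. drop_coord b z \<in> C \<and> z \<bullet> b < \<xi> (drop_coord b z)} \<in> semialgebraic"

definition ordered_functions :: "'a set \<Rightarrow> ('a \<Rightarrow> real) set \<Rightarrow> bool" where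
  "ordered_functions C \<Xi> \<longleftrightarrow> (\<forall>\<xi>\<in>\<Xi>. \<forall>\<eta>\<in>\<Xi>. \<xi> \<noteq> \<eta> \<longrightarrow> (\<forall>x\<in>C. \<xi> x < \<eta> x) \<or> (\<forall>x\<in>C. \<eta> x < \<xi> x))"

lemma ordered_functionsD:
  assumes "ordered_functions C \<Xi>" "\<xi> \<in> \<Xi>" "\<eta> \<in> \<Xi>" "\<xi> \<noteq> \<eta>"
  shows "(\<forall>x\<in>C. \<xi> x < \<eta> x) \<or> (\<forall>x\<in>C. \<eta> x < \<xi> x)"
  by (rule mp[OF bspec[OF bspec[OF assms(1)[unfolded ordered_functions_def] assms(2)] assms(3)] assms(4)])

text \<open>This is delineability as in cylindrical algebraic decomposition: over \<open>C\<close>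
  the roots of the nonzero members are exactly the values of finitely many ordered continuous
  functions. The last clause excludes that a member vanishes on a root function of another one at
  some points of \<open>C\<close> only.\<close>

definition delineates ::
  "'a::euclidean_space \<Rightarrow> ('a \<Rightarrow> real poly) set \<Rightarrow> 'a set \<Rightarrow> ('a \<Rightarrow> real) set \<Rightarrow> bool" where
  "delineates b F C \<Xi> \<longleftrightarrow> finite \<Xi> \<and> (\<forall>\<xi>\<in>\<Xi>. semialgebraic_function b C \<xi>) \<and> ordered_functions C \<Xi> \<and>
     (\<forall>f\<in>F. (\<forall>x\<in>C. f x = 0) \<or> (\<forall>x\<in>C. f x \<noteq> 0)) \<and>
     (\<forall>x\<in>C. \<forall>y. (\<exists>f\<in>F. f x \<noteq> 0 \<and> poly (f x) y = 0) \<longleftrightarrow> (\<exists>\<xi>\<in>\<Xi>. y = \<xi> x)) \<and>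
     (\<forall>f\<in>F. \<forall>\<xi>\<in>\<Xi>. (\<forall>x\<in>C. poly (f x) (\<xi> x) = 0) \<or> (\<forall>x\<in>C. poly (f x) (\<xi> x) \<noteq> 0))"

lemma delineatesI:
  assumes "finite \<Xi>" "\<And>\<xi>. \<xi> \<in> \<Xi> \<Longrightarrow> semialgebraic_function b C \<xi>" "ordered_functions C \<Xi>"
    "\<And>f. f \<in> F \<Longrightarrow> (\<forall>x\<in>C. f x = 0) \<or> (\<forall>x\<in>C. f x \<noteq> 0)"
    "\<And>x f y. x \<in> C \<Longrightarrow> f \<in> F \<Longrightarrow> f x \<noteq> 0 \<Longrightarrow> poly (f x) y = 0 \<Longrightarrow> \<exists>\<xi>\<in>\<Xi>. y = \<xi> x"
    "\<And>x \<xi>. x \<in> C \<Longrightarrow> \<xi> \<in> \<Xi> \<Longrightarrow> \<exists>f\<in>F. f x \<noteq> 0 \<and> poly (f x) (\<xi> x) = 0"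
    "\<And>f \<xi>. f \<in> F \<Longrightarrow> \<xi> \<in> \<Xi> \<Longrightarrow> (\<forall>x\<in>C. poly (f x) (\<xi> x) = 0) \<or> (\<forall>x\<in>C. poly (f x) (\<xi> x) \<noteq> 0)"
  shows "delineates b F C \<Xi>"
  unfolding delineates_def
  by (intro conjI ballI allI iffI assms(1-4,7); (elim bexE conjE)?)
    (auto intro: assms(5) dest: assms(6))

lemma delineatesD:
  assumes "delineates b F C \<Xi>"
  shows "finite \<Xi>" "\<And>\<xi>. \<xi> \<in> \<Xi> \<Longrightarrow> semialgebraic_function b C \<xi>" "ordered_functions C \<Xi>"
    "\<And>f. f \<in> F \<Longrightarrow> (\<forall>x\<in>C. f x = 0) \<or> (\<forall>x\<in>C. f x \<noteq> 0)"
    "\<And>x f y. x \<in> C \<Longrightarrow> f \<in> F \<Longrightarrow> f x \<noteq> 0 \<Longrightarrow> poly (f x) y = 0 \<Longrightarrow> \<exists>\<xi>\<in>\<Xi>. y = \<xi> x"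
    "\<And>x \<xi>. x \<in> C \<Longrightarrow> \<xi> \<in> \<Xi> \<Longrightarrow> \<exists>f\<in>F. f x \<noteq> 0 \<and> poly (f x) (\<xi> x) = 0"
    "\<And>f \<xi>. f \<in> F \<Longrightarrow> \<xi> \<in> \<Xi> \<Longrightarrow> (\<forall>x\<in>C. poly (f x) (\<xi> x) = 0) \<or> (\<forall>x\<in>C. poly (f x) (\<xi> x) \<noteq> 0)"
proof -
  note D = assms[unfolded delineates_def]
  from D show "finite \<Xi>" by (elim conjE)
  from D show "ordered_functions C \<Xi>" by (elim conjE)
  from D have 2: "\<forall>\<xi>\<in>\<Xi>. semialgebraic_function b C \<xi>"
    and 4: "\<forall>f\<in>F. (\<forall>x\<in>C. f x = 0) \<or> (\<forall>x\<in>C. f x \<noteq> 0)"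
    and 5: "\<forall>x\<in>C. \<forall>y. (\<exists>f\<in>F. f x \<noteq> 0 \<and> poly (f x) y = 0) \<longleftrightarrow> (\<exists>\<xi>\<in>\<Xi>. y = \<xi> x)"
    and 7: "\<forall>f\<in>F. \<forall>\<xi>\<in>\<Xi>. (\<forall>x\<in>C. poly (f x) (\<xi> x) = 0) \<or> (\<forall>x\<in>C. poly (f x) (\<xi> x) \<noteq> 0)"
    by -(elim conjE, assumption)+
  show "\<And>\<xi>. \<xi> \<in> \<Xi> \<Longrightarrow> semialgebraic_function b C \<xi>" by (rule bspec[OF 2])
  show "\<And>f. f \<in> F \<Longrightarrow> (\<forall>x\<in>C. f x = 0) \<or> (\<forall>x\<in>C. f x \<noteq> 0)" by (rule bspec[OF 4])
  show "\<And>f \<xi>. f \<in> F \<Longrightarrow> \<xi> \<in> \<Xi> \<Longrightarrow> (\<forall>x\<in>C. poly (f x) (\<xi> x) = 0) \<or> (\<forall>x\<in>C. poly (f x) (\<xi> x) \<noteq> 0)"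
    by (rule bspec[OF bspec[OF 7]])
  show "\<exists>\<xi>\<in>\<Xi>. y = \<xi> x" if "x \<in> C" "f \<in> F" "f x \<noteq> 0" "poly (f x) y = 0" for x f y
    by (rule iffD1[OF spec[OF bspec[OF 5 that(1)]]], rule bexI[OF _ that(2)]) (simp add: that)
  show "\<exists>f\<in>F. f x \<noteq> 0 \<and> poly (f x) (\<xi> x) = 0" if "x \<in> C" "\<xi> \<in> \<Xi>" for x \<xi>
    by (rule iffD2[OF spec[OF bspec[OF 5 that(1)]]], rule bexI[OF _ that(2)]) simp
qed

text \<open>The open fibre over \<open>x\<close> between neighbouring graphs, with \<open>U\<close>
  the functions below it. Indexing by \<open>U\<close> instead of by a pair of neighbours treats the
  unbounded fibres and the case without functions uniformly; a \<open>U\<close> that is not downward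
  closed in \<open>\<Xi>\<close> at \<open>x\<close> gives the empty set.\<close>

definition band :: "('a \<Rightarrow> real) set \<Rightarrow> ('a \<Rightarrow> real) set \<Rightarrow> 'a \<Rightarrow> real set" where
  "band \<Xi> U x = {y. (\<forall>\<xi>\<in>U. \<xi> x < y) \<and> (\<forall>\<xi>\<in>\<Xi> - U. y < \<xi> x)}"

lemma bandI: "(\<And>\<xi>. \<xi> \<in> U \<Longrightarrow> \<xi> x < y) \<Longrightarrow> (\<And>\<xi>. \<xi> \<in> \<Xi> \<Longrightarrow> \<xi> \<notin> U \<Longrightarrow> y < \<xi> x) \<Longrightarrow> y \<in> band \<Xi> U x"
  by (simp add: band_def)

lemma bandD:
  assumes "y \<in> band \<Xi> U x"
  shows "\<And>\<xi>. \<xi> \<in> U \<Longrightarrow> \<xi> x < y" "\<And>\<xi>. \<xi> \<in> \<Xi> \<Longrightarrow> \<xi> \<notin> U \<Longrightarrow> y < \<xi> x"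
  using assms by (simp_all add: band_def)

text \<open>A function is kept if one fixed member of \<open>E\<close> vanishes on it over all of
  \<open>C\<close>. No root of a member of \<open>E\<close> is lost, since whether a member
  vanishes, identically or on a root function, does not change along \<open>C\<close>.\<close>

lemma delineates_subset:
  assumes "delineates b F C \<Xi>" "E \<subseteq> F"
  obtains \<Xi>' where "\<Xi>' \<subseteq> \<Xi>" "delineates b E C \<Xi>'"
    "\<And>\<xi>. \<xi> \<in> \<Xi>' \<Longrightarrow> \<exists>q\<in>E. \<forall>x\<in>C. q x \<noteq> 0 \<and> poly (q x) (\<xi> x) = 0"
proof -
  define \<Xi>' where "\<Xi>' = {\<xi>\<in>\<Xi>. \<exists>q\<in>E. \<forall>x\<in>C. q x \<noteq> 0 \<and> poly (q x) (\<xi> x) = 0}"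
  have sub: "\<xi> \<in> \<Xi>" if "\<xi> \<in> \<Xi>'" for \<xi> using that by (simp add: \<Xi>'_def)
  note D = delineatesD[OF assms(1)]
  have "delineates b E C \<Xi>'"
  proof (rule delineatesI)
    show "finite \<Xi>'" using D(1) by (simp add: \<Xi>'_def)
    show "ordered_functions C \<Xi>'" unfolding ordered_functions_def
      by (intro ballI impI ordered_functionsD[OF D(3)] sub)
    show "\<exists>\<xi>\<in>\<Xi>'. y = \<xi> x" if x: "x \<in> C" and f: "f \<in> E" "f x \<noteq> 0" "poly (f x) y = 0" for x f y
    proof -
      have fF: "f \<in> F" using assms(2) f by blast
      obtain \<xi> where xi: "\<xi> \<in> \<Xi>" "y = \<xi> x" using D(5)[OF x fF f(2,3)] by blast
      have "\<forall>x\<in>C. f x \<noteq> 0" "\<forall>x\<in>C. poly (f x) (\<xi> x) = 0"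
        using D(4)[OF fF] D(7)[OF fF xi(1)] x f xi by auto
      then show ?thesis using xi f unfolding \<Xi>'_def by blast
    qed
    show "\<exists>f\<in>E. f x \<noteq> 0 \<and> poly (f x) (\<xi> x) = 0" if "x \<in> C" "\<xi> \<in> \<Xi>'" for x \<xi>
      using that unfolding \<Xi>'_def by blast
  qed (rule D(2)[OF sub] D(4)[OF subsetD[OF assms(2)]] D(7)[OF subsetD[OF assms(2)] sub]; assumption)+
  then show ?thesis by (rule that[rotated]) (auto simp only: \<Xi>'_def mem_Collect_eq subset_iff)
qed

lemma continuous_on_Max_image:
  fixes f :: "'b \<Rightarrow> 'a::topological_space \<Rightarrow> real"
  assumes "finite U" "\<And>u. u \<in> U \<Longrightarrow> continuous_on C (f u)"
  shows "continuous_on C (\<lambda>x. Max (insert c ((\<lambda>u. f u x) ` U)))"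
  using assms
proof (induction U)
  case (insert u U)
  have "(\<lambda>x. Max (insert c ((\<lambda>u. f u x) ` insert u U))) = (\<lambda>x. max (f u x) (Max (insert c ((\<lambda>u. f u x) ` U))))"
    using insert(1) by (intro ext) (simp add: insert_commute[of c] del: Max_insert add: Max_insert[symmetric])
  then show ?case using insert by (simp only: image_insert) (auto intro!: continuous_intros)
qed auto

lemma continuous_on_Min_image:
  fixes f :: "'b \<Rightarrow> 'a::topological_space \<Rightarrow> real"
  assumes "finite U" "\<And>u. u \<in> U \<Longrightarrow> continuous_on C (f u)"
  shows "continuous_on C (\<lambda>x. Min (insert c ((\<lambda>u. f u x) ` U)))"
  using assms
proof (induction U)
  case (insert u U)
  have "(\<lambda>x. Min (insert c ((\<lambda>u. f u x) ` insert u U))) = (\<lambda>x. min (f u x) (Min (insert c ((\<lambda>u. f u x) ` U))))"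
    using insert(1) by (intro ext) (simp add: insert_commute[of c] del: Min_insert add: Min_insert[symmetric])
  then show ?case using insert by (simp only: image_insert) (auto intro!: continuous_intros)
qed auto

text \<open>The map \<open>arctan\<close> turns all fibres, bounded or not, into bounded intervals
  with continuous end points, which are then rescaled affinely to the unit interval.\<close>

lemma band_homeomorphic:
  fixes \<Xi> :: "('a::topological_space \<Rightarrow> real) set"
  assumes "finite \<Xi>" "U \<subseteq> \<Xi>" and cont: "\<And>\<xi>. \<xi> \<in> \<Xi> \<Longrightarrow> continuous_on C \<xi>"
    and ne: "\<And>x. x \<in> C \<Longrightarrow> band \<Xi> U x \<noteq> {}"
  shows "(SIGMA x:C. band \<Xi> U x) homeomorphic (C \<times> {0<..<1::real})"
proof -
  \<comment> \<open>The inserted values \<open>-(pi/2)\<close> and \<open>pi/2\<close> serve as end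
    points where no function bounds the band.\<close>
  define lo where "lo x = Max (insert (-(pi/2)) ((\<lambda>\<xi>. arctan (\<xi> x)) ` U))" for x
  define hi where "hi x = Min (insert (pi/2) ((\<lambda>\<xi>. arctan (\<xi> x)) ` (\<Xi> - U)))" for x
  have fin: "finite U" using assms finite_subset by blast
  have clo: "continuous_on C lo" unfolding lo_def
    by (rule continuous_on_Max_image[where f="\<lambda>\<xi> x. arctan (\<xi> x)"]) (use fin cont assms(2) in \<open>auto intro!: continuous_intros\<close>)
  have chi: "continuous_on C hi" unfolding hi_def
    by (rule continuous_on_Min_image[where f="\<lambda>\<xi> x. arctan (\<xi> x)"]) (use assms(1) cont in \<open>auto intro!: continuous_intros\<close>)
  have mem: "y \<in> band \<Xi> U x \<longleftrightarrow> lo x < arctan y \<and> arctan y < hi x" for x y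
    using fin assms(1) arctan_bounded[of y]
    by (auto simp: band_def lo_def hi_def arctan_less_iff)
  have lt: "lo x < hi x" if "x \<in> C" for x using ne[OF that] mem by (metis all_not_in_conv less_trans)
  have bounds: "- (pi/2) \<le> lo x" "hi x \<le> pi/2" for x
    unfolding lo_def hi_def by (rule Max_ge Min_le; use fin assms(1) in simp)+
  define \<phi> where "\<phi> = (\<lambda>(x, y). (x, (arctan y - lo x) / (hi x - lo x)))"
  define \<psi> where "\<psi> = (\<lambda>(x, t). (x, tan (lo x + t * (hi x - lo x))))"
  have range: "lo x < lo x + t * (hi x - lo x)" "lo x + t * (hi x - lo x) < hi x"
    "- (pi/2) < lo x + t * (hi x - lo x)" "lo x + t * (hi x - lo x) < pi/2"
    if "x \<in> C" "t \<in> {0<..<1}" for x t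
  proof -
    have "0 < t * (hi x - lo x)" "t * (hi x - lo x) < 1 * (hi x - lo x)"
      using lt[OF that(1)] that(2) by (auto intro!: mult_strict_right_mono)
    then have "0 < t * (hi x - lo x)" "t * (hi x - lo x) < hi x - lo x" by simp_all
    then show "lo x < lo x + t * (hi x - lo x)" "lo x + t * (hi x - lo x) < hi x"
      "- (pi/2) < lo x + t * (hi x - lo x)" "lo x + t * (hi x - lo x) < pi/2"
      using bounds[of x] by linarith+
  qed
  have "homeomorphism (SIGMA x:C. band \<Xi> U x) (C \<times> {0<..<1::real}) \<phi> \<psi>"
  proof (rule homeomorphismI)
    show "continuous_on (SIGMA x:C. band \<Xi> U x) \<phi>" unfolding \<phi>_def case_prod_beta
      by (intro continuous_intros continuous_on_compose2[OF clo] continuous_on_compose2[OF chi])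
        (use lt in force)+
    have cont_arg: "continuous_on (C \<times> {0<..<1}) (\<lambda>p. lo (fst p) + snd p * (hi (fst p) - lo (fst p)))"
      by (intro continuous_intros continuous_on_compose2[OF clo] continuous_on_compose2[OF chi]) auto
    have cos0: "cos (lo (fst p) + snd p * (hi (fst p) - lo (fst p))) \<noteq> 0" if "p \<in> C \<times> {0<..<1::real}" for p
      using that range[of "fst p" "snd p"] cos_gt_zero_pi[of "lo (fst p) + snd p * (hi (fst p) - lo (fst p))"] by auto
    have "continuous_on (C \<times> {0<..<1}) (\<lambda>p. tan (lo (fst p) + snd p * (hi (fst p) - lo (fst p))))"
      unfolding tan_def
      by (intro continuous_on_divide ballI cos0
          continuous_on_compose2[OF continuous_on_sin[OF continuous_on_id] cont_arg subset_UNIV]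
          continuous_on_compose2[OF continuous_on_cos[OF continuous_on_id] cont_arg subset_UNIV])
    then show "continuous_on (C \<times> {0<..<1}) \<psi>" unfolding \<psi>_def case_prod_beta
      by (intro continuous_on_Pair continuous_on_fst continuous_on_id)
    show "\<phi> ` (SIGMA x:C. band \<Xi> U x) \<subseteq> C \<times> {0<..<1}"
      using lt by (auto simp: \<phi>_def mem divide_simps)
    show "\<psi> ` (C \<times> {0<..<1}) \<subseteq> (SIGMA x:C. band \<Xi> U x)"
      using range by (auto simp: \<psi>_def mem arctan_tan)
    show "\<psi> (\<phi> p) = p" if p: "p \<in> (SIGMA x:C. band \<Xi> U x)" for p
    proof -
      have "hi (fst p) - lo (fst p) \<noteq> 0" using lt p by force
      then show ?thesis by (cases p) (simp add: \<phi>_def \<psi>_def tan_arctan)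
    qed
    show "\<phi> (\<psi> p) = p" if p: "p \<in> C \<times> {0<..<1}" for p
    proof -
      have "hi (fst p) - lo (fst p) \<noteq> 0" using lt p by force
      then show ?thesis using range[of "fst p" "snd p"] p by (cases p) (auto simp: \<phi>_def \<psi>_def arctan_tan)
    qed
  qed
  then show ?thesis unfolding homeomorphic_def by blast
qed

text \<open>A band is nonempty as soon as every function in \<open>U\<close> lies below every
  function outside it, and this order is the same over all of \<open>C\<close>.\<close>

lemma band_nonempty:
  assumes "finite \<Xi>" "U \<subseteq> \<Xi>" "ordered_functions C \<Xi>" "x0 \<in> C" "band \<Xi> U x0 \<noteq> {}" "x \<in> C"
  shows "band \<Xi> U x \<noteq> {}"
proof -
  have *: "\<xi> x < \<eta> x" if "\<xi> \<in> U" "\<eta> \<in> \<Xi> - U" for \<xi> \<eta>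
  proof -
    obtain y where "y \<in> band \<Xi> U x0" using assms(5) by blast
    then have "\<xi> x0 < \<eta> x0" using that by (auto intro: less_trans[OF bandD(1) bandD(2)])
    moreover have "(\<forall>x\<in>C. \<xi> x < \<eta> x) \<or> (\<forall>x\<in>C. \<eta> x < \<xi> x)"
      using assms(2) that by (intro ordered_functionsD[OF assms(3)]) auto
    ultimately show ?thesis using assms(4,6) by (auto dest: bspec less_asym)
  qed
  obtain y where "\<And>a. a \<in> (\<lambda>\<xi>. \<xi> x) ` U \<Longrightarrow> a < y" "\<And>a. a \<in> (\<lambda>\<xi>. \<xi> x) ` (\<Xi> - U) \<Longrightarrow> y < a"
    by (rule real_between_finite_sets[of "(\<lambda>\<xi>. \<xi> x) ` U" "(\<lambda>\<xi>. \<xi> x) ` (\<Xi> - U)"])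
      (use * assms(1) finite_subset[OF assms(2,1)] in auto)
  then have "y \<in> band \<Xi> U x" by (auto simp: band_def)
  then show ?thesis by auto
qed

lemma band_outside: "\<xi> \<in> \<Xi> \<Longrightarrow> \<xi> x \<notin> band \<Xi> U x"
  by (cases "\<xi> \<in> U") (auto simp: band_def)

lemma open_band: "finite \<Xi> \<Longrightarrow> U \<subseteq> \<Xi> \<Longrightarrow> open (band \<Xi> U x)"
proof -
  assume fin: "finite \<Xi>" "U \<subseteq> \<Xi>"
  have "band \<Xi> U x = (\<Inter>\<xi>\<in>U. {\<xi> x<..}) \<inter> (\<Inter>\<xi>\<in>\<Xi> - U. {..<\<xi> x})" by (auto simp: band_def)
  moreover have "finite U" "finite (\<Xi> - U)" using fin finite_subset by blast+
  ultimately show ?thesis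
    by (simp only:) (intro open_Int open_INT ballI open_greaterThan open_lessThan)
qed

lemma band_convex:
  assumes "y1 \<in> band \<Xi> U x" "y2 \<in> band \<Xi> U x" "y1 \<le> y" "y \<le> y2"
  shows "y \<in> band \<Xi> U x"
  by (rule bandI) (use bandD(1)[OF assms(1)] bandD(2)[OF assms(2)] assms(3,4) in \<open>auto intro: less_le_trans le_less_trans\<close>)

lemma band_neighbours:
  assumes "finite \<Xi>" "U \<subseteq> \<Xi>" "y \<in> band \<Xi> U x" "a < y" "y < c"
  obtains y1 y2 where "y1 \<in> band \<Xi> U x" "a < y1" "y1 < y" "y2 \<in> band \<Xi> U x" "y < y2" "y2 < c"
proof -
  obtain e where e: "e > 0" "ball y e \<subseteq> band \<Xi> U x"
    using open_band[OF assms(1,2)] assms(3) open_contains_ball by blast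
  define d where "d = min (e/2) (min ((y - a)/2) ((c - y)/2))"
  have "d > 0" "d < e" "y - d > a" "y + d < c" using e assms by (auto simp: d_def field_simps min_def)
  then show ?thesis using e by (intro that[of "y - d" "y + d"]) (auto simp: dist_real_def)
qed

lemma poly_fun_drop_coord: "(\<lambda>z. drop_coord b z \<bullet> c) \<in> poly_fun"
proof -
  have "(\<lambda>z. drop_coord b z \<bullet> c) = (\<lambda>z. z \<bullet> c - (z \<bullet> b) * (b \<bullet> c))"
    by (auto simp: drop_coord_def inner_diff_left)
  then show ?thesis by (auto intro!: poly_fun_diff pf_mult poly_fun_inner_const pf_const)
qed

lemma semialgebraic_vimage_drop_coord: "C \<in> semialgebraic \<Longrightarrow> {z. drop_coord b z \<in> C} \<in> semialgebraic"
  using semialgebraic_vimage[OF _ poly_fun_drop_coord] by (simp add: vimage_def)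

lemma semialgebraic_band:
  assumes "finite \<Xi>" "U \<subseteq> \<Xi>" "C \<in> semialgebraic" "\<And>\<xi>. \<xi> \<in> \<Xi> \<Longrightarrow> semialgebraic_function b C \<xi>"
  shows "{z. drop_coord b z \<in> C \<and> z \<bullet> b \<in> band \<Xi> U (drop_coord b z)} \<in> semialgebraic"
proof -
  let ?C = "{z. drop_coord b z \<in> C}"
  let ?G = "\<lambda>\<xi>. {z. drop_coord b z \<in> C \<and> z \<bullet> b = \<xi> (drop_coord b z)}"
  let ?L = "\<lambda>\<xi>. {z. drop_coord b z \<in> C \<and> z \<bullet> b < \<xi> (drop_coord b z)}"
  \<comment> \<open>Lying above a graph is expressed as lying neither on it nor below it, since
    \<open>semialgebraic_function\<close> provides just these two regions.\<close>
  have "{z. drop_coord b z \<in> C \<and> z \<bullet> b \<in> band \<Xi> U (drop_coord b z)} =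
    ?C \<inter> (\<Inter>\<xi>\<in>U. ?C - (?G \<xi> \<union> ?L \<xi>)) \<inter> (\<Inter>\<xi>\<in>\<Xi> - U. ?L \<xi>)"
    by (auto simp: band_def not_less)
  moreover have "?G \<xi> \<in> semialgebraic" "?L \<xi> \<in> semialgebraic" if "\<xi> \<in> \<Xi>" for \<xi>
    using assms(4)[OF that] by (auto simp: semialgebraic_function_def)
  then have "?C \<inter> (\<Inter>\<xi>\<in>U. ?C - (?G \<xi> \<union> ?L \<xi>)) \<inter> (\<Inter>\<xi>\<in>\<Xi> - U. ?L \<xi>) \<in> semialgebraic"
    using assms(1-3) finite_subset[OF assms(2,1)]
    by (intro sa_inter semialgebraic_Int_family semialgebraic_Diff sa_union semialgebraic_vimage_drop_coord) auto
  ultimately show ?thesis by simp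
qed

text \<open>With a positive derivative on the band, the signs of \<open>f\<close> at its ends decide
  whether it has a root there. These signs and the order of the functions do not vary over the
  connected \<open>C\<close>, so one root over \<open>x0\<close> yields exactly one over every
  parameter; the sign change at this root gives continuity.\<close>

lemma band_root_increasing:
  fixes f :: "'a::euclidean_space \<Rightarrow> real poly"
  assumes fin: "finite \<Xi>" "U \<subseteq> \<Xi>" and sa: "\<And>\<xi>. \<xi> \<in> \<Xi> \<Longrightarrow> semialgebraic_function b C \<xi>"
    and ord: "ordered_functions C \<Xi>" and C: "connected C" "C \<in> semialgebraic"
    and f: "f \<in> poly_family" "\<And>x. x \<in> C \<Longrightarrow> degree (f x) \<ge> 1"
    and const: "\<And>\<xi>. \<xi> \<in> \<Xi> \<Longrightarrow> (\<forall>x\<in>C. poly (f x) (\<xi> x) = 0) \<or> (\<forall>x\<in>C. poly (f x) (\<xi> x) \<noteq> 0)"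
    and root: "x0 \<in> C" "y0 \<in> band \<Xi> U x0" "poly (f x0) y0 = 0"
    and pos: "\<And>x y. x \<in> C \<Longrightarrow> y \<in> band \<Xi> U x \<Longrightarrow> poly (pderiv (f x)) y > 0"
  obtains \<eta> where "semialgebraic_function b C \<eta>" "\<And>x. x \<in> C \<Longrightarrow> \<eta> x \<in> band \<Xi> U x"
    "\<And>x y. x \<in> C \<Longrightarrow> y \<in> band \<Xi> U x \<Longrightarrow> poly (f x) y = 0 \<longleftrightarrow> y = \<eta> x"
proof -
  have finU: "finite U" using fin finite_subset by blast
  have cont: "continuous_on C \<xi>" if "\<xi> \<in> \<Xi>" for \<xi>
    using sa[OF that] by (simp add: semialgebraic_function_def)
  have sign: "sgn (poly (f x) (\<xi> x)) = sgn (poly (f x') (\<xi> x'))" if "\<xi> \<in> \<Xi>" "x \<in> C" "x' \<in> C" for \<xi> x x'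
    using const[OF that(1)]
  proof
    assume "\<forall>x\<in>C. poly (f x) (\<xi> x) \<noteq> 0"
    then show ?thesis
      using that by (intro connected_nonzero_sign[OF C(1), where g="\<lambda>x. poly (f x) (\<xi> x)"]
          continuous_on_poly_family[OF f(1)] continuous_intros cont) auto
  qed (use that in auto)
  \<comment> \<open>The largest function of \<open>U\<close> and the smallest one outside
    \<open>U\<close>, which mark the ends of the band, are thus the same over every
    parameter.\<close>
  have le: "\<xi> x \<le> \<eta> x \<longleftrightarrow> \<xi> x' \<le> \<eta> x'" if "\<xi> \<in> \<Xi>" "\<eta> \<in> \<Xi>" "x \<in> C" "x' \<in> C" for \<xi> \<eta> x x'
  proof (cases "\<xi> = \<eta>")
    case False
    then have "(\<forall>x\<in>C. \<xi> x < \<eta> x) \<or> (\<forall>x\<in>C. \<eta> x < \<xi> x)"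
      by (intro ordered_functionsD[OF ord] that)
    then show ?thesis using that(3,4) by (auto simp: less_imp_le not_le)
  qed auto
  have ne: "band \<Xi> U x \<noteq> {}" if "x \<in> C" for x
    using band_nonempty[OF fin ord root(1) _ that] root(2) by auto
  have mono: "poly (f x) y1 < poly (f x) y2" if "x \<in> C" "y1 \<in> band \<Xi> U x" "y2 \<in> band \<Xi> U x" "y1 < y2" for x y1 y2
    using that band_convex[OF that(2,3)] by (intro poly_strict_increasing pos) auto
  have neg_iff: "(\<exists>y\<in>band \<Xi> U x. poly (f x) y < 0) \<longleftrightarrow>
      (\<forall>u\<in>U. (\<forall>u'\<in>U. u' x \<le> u x) \<longrightarrow> poly (f x) (u x) < 0)" if "x \<in> C" for x
    using poly_negative_on_interval_iff[of "(\<lambda>\<xi>. \<xi> x) ` U" "(\<lambda>\<xi>. \<xi> x) ` (\<Xi> - U)" "f x" "band \<Xi> U x"]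
      fin finU f(2)[OF that] ne[OF that] pos[OF that] by (simp add: band_def ball_simps)
  have pos_iff: "(\<exists>y\<in>band \<Xi> U x. poly (f x) y > 0) \<longleftrightarrow>
      (\<forall>v\<in>\<Xi> - U. (\<forall>v'\<in>\<Xi> - U. v x \<le> v' x) \<longrightarrow> poly (f x) (v x) > 0)" if "x \<in> C" for x
    using poly_positive_on_interval_iff[of "(\<lambda>\<xi>. \<xi> x) ` U" "(\<lambda>\<xi>. \<xi> x) ` (\<Xi> - U)" "f x" "band \<Xi> U x"]
      fin finU f(2)[OF that] ne[OF that] pos[OF that] by (simp add: band_def ball_simps)
  obtain a c where ac: "a \<in> band \<Xi> U x0" "a < y0" "c \<in> band \<Xi> U x0" "y0 < c"
    by (rule band_neighbours[OF fin root(2), of "y0 - 1" "y0 + 1"]) auto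
  \<comment> \<open>The root \<open>y0\<close> has points of the band on both sides, and strict
    monotonicity gives the two signs there.\<close>
  have neg0: "\<exists>y\<in>band \<Xi> U x0. poly (f x0) y < 0" and pos0: "\<exists>y\<in>band \<Xi> U x0. poly (f x0) y > 0"
    using mono[OF root(1) ac(1) root(2) ac(2)] mono[OF root(1) root(2) ac(3) ac(4)] ac root(3) by auto
  have sgn_neg: "poly (f x) (\<xi> x) < 0 \<longleftrightarrow> poly (f x0) (\<xi> x0) < 0"
    and sgn_pos: "poly (f x) (\<xi> x) > 0 \<longleftrightarrow> poly (f x0) (\<xi> x0) > 0" if "\<xi> \<in> \<Xi>" "x \<in> C" for \<xi> x
    using sign[OF that root(1)] by (metis sgn_less, metis sgn_greater)
  have "\<exists>y\<in>band \<Xi> U x. poly (f x) y = 0" if x: "x \<in> C" for x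
  proof -
    have "\<forall>u\<in>U. (\<forall>u'\<in>U. u' x \<le> u x) \<longrightarrow> poly (f x) (u x) < 0"
    proof (intro ballI impI)
      fix u assume u: "u \<in> U" "\<forall>u'\<in>U. u' x \<le> u x"
      have "u' x0 \<le> u x0" if "u' \<in> U" for u'
        using le[OF subsetD[OF fin(2) that] subsetD[OF fin(2) u(1)] x root(1)] u that by auto
      then have "poly (f x0) (u x0) < 0" using neg0[unfolded neg_iff[OF root(1)]] u by auto
      then show "poly (f x) (u x) < 0" using sgn_neg u x fin(2) by auto
    qed
    then obtain y1 where y1: "y1 \<in> band \<Xi> U x" "poly (f x) y1 < 0" using neg_iff[OF x] by blast
    have "\<forall>u\<in>\<Xi> - U. (\<forall>u'\<in>\<Xi> - U. u x \<le> u' x) \<longrightarrow> poly (f x) (u x) > 0"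
    proof (intro ballI impI)
      fix u assume u: "u \<in> \<Xi> - U" "\<forall>u'\<in>\<Xi> - U. u x \<le> u' x"
      have "u x0 \<le> u' x0" if "u' \<in> \<Xi> - U" for u'
        using le[OF _ _ x root(1), of u u'] u that by auto
      then have "poly (f x0) (u x0) > 0" using pos0[unfolded pos_iff[OF root(1)]] u by auto
      then show "poly (f x) (u x) > 0" using sgn_pos u x by auto
    qed
    then obtain y2 where y2: "y2 \<in> band \<Xi> U x" "poly (f x) y2 > 0" using pos_iff[OF x] by blast
    have "y1 < y2" using mono[OF x y2(1) y1(1)] y1 y2 by (cases y1 y2 rule: linorder_cases) auto
    from poly_IVT_pos[OF this y1(2) y2(2)] obtain y where "y1 < y" "y < y2" "poly (f x) y = 0" by blast
    then show ?thesis using band_convex[OF y1(1) y2(1), of y] by auto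
  qed
  then obtain \<eta> where eta: "\<And>x. x \<in> C \<Longrightarrow> \<eta> x \<in> band \<Xi> U x" "\<And>x. x \<in> C \<Longrightarrow> poly (f x) (\<eta> x) = 0"
    by metis
  have neg: "poly (f x) y < 0 \<longleftrightarrow> y < \<eta> x" and pos: "poly (f x) y > 0 \<longleftrightarrow> y > \<eta> x"
    if "x \<in> C" "y \<in> band \<Xi> U x" for x y
    using mono[OF that eta(1)[OF that(1)]] mono[OF that(1) eta(1)[OF that(1)] that(2)] eta(2)[OF that(1)]
    by (cases y "\<eta> x" rule: linorder_cases; auto)+
  \<comment> \<open>A height inside the band over \<open>x\<close> stays inside the bands over
    nearby parameters, so the sign of \<open>f\<close> at this fixed height locates
    \<open>\<eta>\<close> there too.\<close>
  have ev_band: "\<forall>\<^sub>F x' in at x within C. y \<in> band \<Xi> U x'" if "x \<in> C" "y \<in> band \<Xi> U x" for x y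
  proof -
    have "\<forall>\<^sub>F x' in at x within C. \<forall>\<xi>\<in>U. \<xi> x' < y"
      using that cont fin(2) by (intro eventually_ball_finite[OF finU])
        (auto simp: band_def continuous_on_def intro!: order_tendstoD(2))
    moreover have "\<forall>\<^sub>F x' in at x within C. \<forall>\<xi>\<in>\<Xi> - U. y < \<xi> x'"
      using that cont fin(1) by (intro eventually_ball_finite)
        (auto simp: band_def continuous_on_def intro!: order_tendstoD(1))
    ultimately show ?thesis by eventually_elim (auto simp: band_def)
  qed
  have ev_C: "\<forall>\<^sub>F x' in at x within C. x' \<in> C" for x by (simp add: eventually_at_filter)
  have lim: "((\<lambda>x'. poly (f x') y) \<longlongrightarrow> poly (f x) y) (at x within C)" if "x \<in> C" for x y
    using continuous_on_poly_family[OF f(1) continuous_on_id continuous_on_const, of C y] that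
    by (auto simp: continuous_on_def)
  have "continuous_on C \<eta>"
    unfolding continuous_on_def
  proof (intro ballI order_tendstoI)
    fix x a assume x: "x \<in> C" and a: "a < \<eta> x"
    obtain y where y: "y \<in> band \<Xi> U x" "a < y" "y < \<eta> x"
      by (rule band_neighbours[OF fin eta(1)[OF x] a, of "\<eta> x + 1"]) auto
    have "poly (f x) y < 0" using neg x y by auto
    from order_tendstoD(2)[OF lim[OF x] this] ev_band[OF x y(1)] ev_C
    show "\<forall>\<^sub>F x' in at x within C. a < \<eta> x'" by eventually_elim (use neg y in force)
  next
    fix x a assume x: "x \<in> C" and a: "\<eta> x < a"
    obtain y where y: "y \<in> band \<Xi> U x" "y < a" "\<eta> x < y"
      by (rule band_neighbours[OF fin eta(1)[OF x] _ a, of "\<eta> x - 1"]) auto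
    have "poly (f x) y > 0" using pos x y by auto
    from order_tendstoD(1)[OF lim[OF x] this] ev_band[OF x y(1)] ev_C
    show "\<forall>\<^sub>F x' in at x within C. \<eta> x' < a" by eventually_elim (use pos y in force)
  qed
  moreover
  let ?B = "{z. drop_coord b z \<in> C \<and> z \<bullet> b \<in> band \<Xi> U (drop_coord b z)}"
  let ?f = "\<lambda>z. poly (f (drop_coord b z)) (z \<bullet> b)"
  have pf: "?f \<in> poly_fun"
    by (intro poly_fun_poly_family f(1) poly_fun_drop_coord poly_fun_inner_const)
  have B: "?B \<in> semialgebraic" by (intro semialgebraic_band fin C sa)
  have zero: "poly (f x) y = 0 \<longleftrightarrow> y = \<eta> x" if "x \<in> C" "y \<in> band \<Xi> U x" for x y
    using neg[OF that] pos[OF that] by linarith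
  have "{z. drop_coord b z \<in> C \<and> z \<bullet> b = \<eta> (drop_coord b z)} = ?B \<inter> {z. ?f z = 0}"
    using zero eta(1) by auto
  then have "{z. drop_coord b z \<in> C \<and> z \<bullet> b = \<eta> (drop_coord b z)} \<in> semialgebraic"
    using B pf by (simp only:) (intro sa_inter semialgebraic_eq pf_const)
  moreover
  let ?C = "{z. drop_coord b z \<in> C}"
  let ?G = "\<lambda>\<xi>. {z. drop_coord b z \<in> C \<and> z \<bullet> b = \<xi> (drop_coord b z)}"
  let ?L = "\<lambda>\<xi>. {z. drop_coord b z \<in> C \<and> z \<bullet> b < \<xi> (drop_coord b z)}"
  \<comment> \<open>A point below \<open>\<eta>\<close> is either at or below some function of
    \<open>U\<close>, or in the part of the band where \<open>f\<close> is negative. Both are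
    semialgebraic by what is already known.\<close>
  have below: "y < \<eta> x \<longleftrightarrow> (\<exists>\<xi>\<in>U. y \<le> \<xi> x) \<or> (y \<in> band \<Xi> U x \<and> poly (f x) y < 0)" if x: "x \<in> C" for x y
  proof (cases "\<exists>\<xi>\<in>U. y \<le> \<xi> x")
    case True
    then show ?thesis using eta(1)[OF x] by (force simp: band_def)
  next
    case False
    show ?thesis
    proof (cases "y \<in> band \<Xi> U x")
      case True
      then show ?thesis using False neg[OF x] by auto
    next
      case nb: False
      then obtain \<xi> where "\<xi> \<in> \<Xi> - U" "\<xi> x \<le> y" using False by (auto simp: band_def not_less)
      moreover have "\<eta> x < \<xi> x" using eta(1)[OF x] calculation by (auto simp: band_def)
      ultimately show ?thesis using False nb by auto
    qed
  qed
  have "{z. drop_coord b z \<in> C \<and> z \<bullet> b < \<eta> (drop_coord b z)} = (\<Union>\<xi>\<in>U. ?G \<xi> \<union> ?L \<xi>) \<union> (?B \<inter> {z. ?f z < 0})"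
    using below by (auto simp: le_less)
  moreover have "?G \<xi> \<in> semialgebraic" "?L \<xi> \<in> semialgebraic" if "\<xi> \<in> \<Xi>" for \<xi>
    using sa[OF that] by (auto simp: semialgebraic_function_def)
  then have "(\<Union>\<xi>\<in>U. ?G \<xi> \<union> ?L \<xi>) \<union> (?B \<inter> {z. ?f z < 0}) \<in> semialgebraic"
    using B pf fin(2) finU
    by (intro sa_union sa_inter semialgebraic_less pf_const semialgebraic_Un_family) auto
  ultimately have "semialgebraic_function b C \<eta>" unfolding semialgebraic_function_def by simp
  then show ?thesis using that eta(1) zero by blast
qed

text \<open>The roots of \<open>f'\<close> are among the values of \<open>\<Xi>\<close>, so
  \<open>f'\<close> has no zero on the band and keeps one sign there, the band being connected. A
  negative sign is reduced to a positive one by passing to \<open>- f\<close>.\<close>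

lemma band_root:
  fixes f :: "'a::euclidean_space \<Rightarrow> real poly"
  assumes D: "delineates b E C \<Xi>" and U: "U \<subseteq> \<Xi>" and C: "connected C" "C \<in> semialgebraic"
    and f: "f \<in> poly_family" "\<And>x. x \<in> C \<Longrightarrow> degree (f x) \<ge> 1" "(\<lambda>x. pderiv (f x)) \<in> E"
    and const: "\<And>\<xi>. \<xi> \<in> \<Xi> \<Longrightarrow> (\<forall>x\<in>C. poly (f x) (\<xi> x) = 0) \<or> (\<forall>x\<in>C. poly (f x) (\<xi> x) \<noteq> 0)"
    and root: "x0 \<in> C" "y0 \<in> band \<Xi> U x0" "poly (f x0) y0 = 0"
  obtains \<eta> where "semialgebraic_function b C \<eta>" "\<And>x. x \<in> C \<Longrightarrow> \<eta> x \<in> band \<Xi> U x"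
    "\<And>x. x \<in> C \<Longrightarrow> poly (f x) (\<eta> x) = 0"
    "\<And>x y. x \<in> C \<Longrightarrow> y \<in> band \<Xi> U x \<Longrightarrow> poly (f x) y = 0 \<Longrightarrow> y = \<eta> x"
proof -
  note D = delineatesD[OF D]
  have cont: "continuous_on C \<xi>" if "\<xi> \<in> \<Xi>" for \<xi>
    using D(2)[OF that] by (simp add: semialgebraic_function_def)
  have ne: "band \<Xi> U x \<noteq> {}" if "x \<in> C" for x
    using band_nonempty[OF D(1) U D(3) root(1) _ that] root(2) by auto
  have "(SIGMA x:C. band \<Xi> U x) homeomorphic (C \<times> {0<..<1::real})"
    by (intro band_homeomorphic D(1) U cont ne)
  moreover have "connected (C \<times> {0<..<1::real})" by (intro connected_Times C(1)) auto
  ultimately have conn: "connected (SIGMA x:C. band \<Xi> U x)" using homeomorphic_connectedness by blast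
  have f'0: "pderiv (f x) \<noteq> 0" if "x \<in> C" for x using f(2)[OF that] by (simp add: pderiv_eq_0_iff)
  have nz: "poly (pderiv (f x)) y \<noteq> 0" if x: "x \<in> C" and y: "y \<in> band \<Xi> U x" for x y
  proof
    assume "poly (pderiv (f x)) y = 0"
    then obtain \<xi> where "\<xi> \<in> \<Xi>" "y = \<xi> x" using D(5)[OF x f(3) f'0[OF x]] by blast
    then show False using y band_outside by metis
  qed
  have sign: "sgn (poly (pderiv (f x)) y) = sgn (poly (pderiv (f x0)) y0)" if "x \<in> C" "y \<in> band \<Xi> U x" for x y
  proof -
    have "continuous_on (SIGMA x:C. band \<Xi> U x) (\<lambda>p. poly (pderiv (f (fst p))) (snd p))"
      by (intro continuous_on_poly_family[OF poly_family_pderiv[OF f(1)]] continuous_intros)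
    from connected_nonzero_sign[OF conn this, of "(x, y)" "(x0, y0)"] nz root that
    show ?thesis by auto
  qed
  show ?thesis
  proof (cases "poly (pderiv (f x0)) y0 > 0")
    case True
    then have pos: "poly (pderiv (f x)) y > 0" if "x \<in> C" "y \<in> band \<Xi> U x" for x y
      using sign[OF that] by (metis sgn_greater)
    show ?thesis
    proof (rule band_root_increasing[OF D(1) U D(2) D(3) C f(1,2) const root pos])
      fix \<eta> assume "semialgebraic_function b C \<eta>" "\<And>x. x \<in> C \<Longrightarrow> \<eta> x \<in> band \<Xi> U x"
        "\<And>x y. x \<in> C \<Longrightarrow> y \<in> band \<Xi> U x \<Longrightarrow> poly (f x) y = 0 \<longleftrightarrow> y = \<eta> x"
      then show ?thesis by (intro that[of \<eta>]) simp_all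
    qed
  next
    case False
    then have "poly (pderiv (f x0)) y0 < 0" using nz[OF root(1,2)] by simp
    then have neg: "poly (pderiv (- f x)) y > 0" if "x \<in> C" "y \<in> band \<Xi> U x" for x y
      using sign[OF that] by (metis sgn_less pderiv_minus poly_minus neg_0_less_iff_less)
    have "(\<lambda>x. - f x) \<in> poly_family"
      using poly_family_mult[OF poly_family_const[of "-1"] f(1)] by simp
    note f' = this
    have deg': "degree (- f x) \<ge> 1" if "x \<in> C" for x using f(2)[OF that] by simp
    have const': "(\<forall>x\<in>C. poly (- f x) (\<xi> x) = 0) \<or> (\<forall>x\<in>C. poly (- f x) (\<xi> x) \<noteq> 0)" if "\<xi> \<in> \<Xi>" for \<xi>
      using const[OF that] by simp
    have root': "poly (- f x0) y0 = 0" using root(3) by simp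
    show ?thesis
    proof (rule band_root_increasing[OF D(1) U D(2) D(3) C f' deg' const' root(1,2) root' neg])
      fix \<eta> assume "semialgebraic_function b C \<eta>" "\<And>x. x \<in> C \<Longrightarrow> \<eta> x \<in> band \<Xi> U x"
        "\<And>x y. x \<in> C \<Longrightarrow> y \<in> band \<Xi> U x \<Longrightarrow> poly (- f x) y = 0 \<longleftrightarrow> y = \<eta> x"
      then show ?thesis by (intro that[of \<eta>]) simp_all
    qed
  qed
qed

text \<open>Each band contributes at most one new root function, because \<open>f\<close> is
  strictly monotone on its fibres. Roots of \<open>f\<close> outside all bands lie on graphs already
  present, where \<open>const\<close> controls them.\<close>

lemma delineates_insert:
  fixes f :: "'a::euclidean_space \<Rightarrow> real poly"
  assumes D: "delineates b E C \<Xi>" and C: "connected C" "C \<in> semialgebraic"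
    and f: "f \<in> poly_family" "\<And>x. x \<in> C \<Longrightarrow> degree (f x) \<ge> 1" "(\<lambda>x. pderiv (f x)) \<in> E"
    and const: "\<And>\<xi>. \<xi> \<in> \<Xi> \<Longrightarrow> (\<forall>x\<in>C. poly (f x) (\<xi> x) = 0) \<or> (\<forall>x\<in>C. poly (f x) (\<xi> x) \<noteq> 0)"
  obtains \<Xi>' where "delineates b (insert f E) C \<Xi>'"
proof -
  \<comment> \<open>The bands on which \<open>f\<close> has a root over some parameter, hence by
    \<open>band_root\<close> over every one.\<close>
  define \<U> where "\<U> = {U. U \<subseteq> \<Xi> \<and> (\<exists>x\<in>C. \<exists>y\<in>band \<Xi> U x. poly (f x) y = 0)}"
  let ?P = "\<lambda>U \<eta>. semialgebraic_function b C \<eta> \<and> (\<forall>x\<in>C. \<eta> x \<in> band \<Xi> U x) \<and> (\<forall>x\<in>C. poly (f x) (\<eta> x) = 0) \<and>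
    (\<forall>x\<in>C. \<forall>y\<in>band \<Xi> U x. poly (f x) y = 0 \<longrightarrow> y = \<eta> x)"
  have "\<exists>\<eta>. ?P U \<eta>" if U\<U>: "U \<in> \<U>" for U
  proof -
    obtain x0 y0 where U: "U \<subseteq> \<Xi>" and root: "x0 \<in> C" "y0 \<in> band \<Xi> U x0" "poly (f x0) y0 = 0"
      using U\<U> unfolding \<U>_def by blast
    show ?thesis
      by (rule band_root[OF D U C f const root]) auto
  qed
  then obtain \<eta> where "\<forall>U\<in>\<U>. ?P U (\<eta> U)" using bchoice[of \<U> ?P] by blast
  then have eta: "semialgebraic_function b C (\<eta> U)" "\<And>x. x \<in> C \<Longrightarrow> \<eta> U x \<in> band \<Xi> U x"
    "\<And>x. x \<in> C \<Longrightarrow> poly (f x) (\<eta> U x) = 0"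
    "\<And>x y. x \<in> C \<Longrightarrow> y \<in> band \<Xi> U x \<Longrightarrow> poly (f x) y = 0 \<Longrightarrow> y = \<eta> U x" if "U \<in> \<U>" for U
    using that by simp_all
  note D = delineatesD[OF D]
  have U\<Xi>: "U \<subseteq> \<Xi>" if "U \<in> \<U>" for U using that by (simp add: \<U>_def)
  have "finite \<U>" by (rule finite_subset[of _ "Pow \<Xi>"]) (auto simp: \<U>_def D(1))
  have f0: "f x \<noteq> 0" if "x \<in> C" for x using f(2)[OF that] by auto
  have ord1: "(\<forall>x\<in>C. \<xi> x < \<eta> U x) \<or> (\<forall>x\<in>C. \<eta> U x < \<xi> x)" if "\<xi> \<in> \<Xi>" "U \<in> \<U>" for \<xi> U
    using bandD[OF eta(2)[OF that(2)]] that(1) by (cases "\<xi> \<in> U") simp_all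
  \<comment> \<open>A function in \<open>U\<close> but not in \<open>V\<close> separates the two
    bands and with them the new roots.\<close>
  have ord2: "(\<forall>x\<in>C. \<eta> V x < \<eta> U x)" if "U \<in> \<U>" "V \<in> \<U>" "\<xi> \<in> U" "\<xi> \<notin> V" for U V \<xi>
  proof
    fix x assume x: "x \<in> C"
    have "\<xi> \<in> \<Xi>" using U\<Xi> that by blast
    then show "\<eta> V x < \<eta> U x"
      using bandD(1)[OF eta(2)[OF that(1) x] that(3)] bandD(2)[OF eta(2)[OF that(2) x] _ that(4)] by linarith
  qed
  have ord3: "(\<forall>x\<in>C. \<eta> U x < \<eta> V x) \<or> (\<forall>x\<in>C. \<eta> V x < \<eta> U x)" if "U \<in> \<U>" "V \<in> \<U>" "\<eta> U \<noteq> \<eta> V" for U V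
  proof -
    have "U \<noteq> V" using that by auto
    then obtain \<xi> where "(\<xi> \<in> U \<and> \<xi> \<notin> V) \<or> (\<xi> \<in> V \<and> \<xi> \<notin> U)" by blast
    then show ?thesis using ord2[OF that(1,2)] ord2[OF that(2,1)] by metis
  qed
  have "delineates b (insert f E) C (\<Xi> \<union> \<eta> ` \<U>)"
  proof (rule delineatesI)
    show "finite (\<Xi> \<union> \<eta> ` \<U>)" using D(1) \<open>finite \<U>\<close> by simp
    show "semialgebraic_function b C \<xi>" if "\<xi> \<in> \<Xi> \<union> \<eta> ` \<U>" for \<xi>
      using that D(2) eta(1) by auto
    show "ordered_functions C (\<Xi> \<union> \<eta> ` \<U>)"
      unfolding ordered_functions_def
    proof (intro ballI impI)
      fix \<xi> \<zeta> assume *: "\<xi> \<in> \<Xi> \<union> \<eta> ` \<U>" "\<zeta> \<in> \<Xi> \<union> \<eta> ` \<U>" "\<xi> \<noteq> \<zeta>"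
      show "(\<forall>x\<in>C. \<xi> x < \<zeta> x) \<or> (\<forall>x\<in>C. \<zeta> x < \<xi> x)"
      proof (cases "\<xi> \<in> \<Xi>")
        case 1: True
        show ?thesis
        proof (cases "\<zeta> \<in> \<Xi>")
          case True
          show ?thesis by (rule ordered_functionsD[OF D(3) 1 True *(3)])
        next
          case False
          then obtain U where "U \<in> \<U>" "\<zeta> = \<eta> U" using * by blast
          then show ?thesis using ord1[OF 1] by simp
        qed
      next
        case False
        then obtain U where U: "U \<in> \<U>" "\<xi> = \<eta> U" using * by blast
        show ?thesis
        proof (cases "\<zeta> \<in> \<Xi>")
          case True
          show ?thesis using ord1[OF True U(1)] U(2) by (simp add: disj_commute)
        next
          case False
          then obtain V where "V \<in> \<U>" "\<zeta> = \<eta> V" using * by blast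
          then show ?thesis using ord3[OF U(1)] U(2) *(3) by simp
        qed
      qed
    qed
    show "(\<forall>x\<in>C. g x = 0) \<or> (\<forall>x\<in>C. g x \<noteq> 0)" if "g \<in> insert f E" for g
      using that f0 D(4)[of g] by (cases "g = f") simp_all
    show "\<exists>\<xi>\<in>\<Xi> \<union> \<eta> ` \<U>. y = \<xi> x" if x: "x \<in> C" and g: "g \<in> insert f E" "g x \<noteq> 0" "poly (g x) y = 0" for x g y
    proof (cases "g = f")
      case False
      then have "g \<in> E" using g(1) by simp
      from D(5)[OF x this g(2,3)] show ?thesis by (simp add: bex_Un)
    next
      case True
      show ?thesis
      proof (cases "\<exists>\<xi>\<in>\<Xi>. y = \<xi> x")
        case True
        then show ?thesis by (simp add: bex_Un)
      next
        case False
        \<comment> \<open>As \<open>y\<close> is not a value of any function of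
          \<open>\<Xi>\<close>, it lies in the band over the functions below it.\<close>
        define U where "U = {\<xi>\<in>\<Xi>. \<xi> x < y}"
        have y: "y \<in> band \<Xi> U x"
        proof (rule bandI)
          fix \<xi> assume "\<xi> \<in> \<Xi>" "\<xi> \<notin> U"
          then have "\<not> \<xi> x < y" "y \<noteq> \<xi> x" using False by (simp_all add: U_def)
          then show "y < \<xi> x" by simp
        qed (simp add: U_def)
        have root: "poly (f x) y = 0" using g True by simp
        have U: "U \<in> \<U>" unfolding \<U>_def using x y root by (auto simp: U_def)
        show ?thesis by (rule bexI[of _ "\<eta> U"]) (use eta(4)[OF U x y root] U in auto)
      qed
    qed
    show "\<exists>g\<in>insert f E. g x \<noteq> 0 \<and> poly (g x) (\<xi> x) = 0" if x: "x \<in> C" and xi: "\<xi> \<in> \<Xi> \<union> \<eta> ` \<U>" for x \<xi>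
    proof (cases "\<xi> \<in> \<Xi>")
      case True
      then show ?thesis using D(6)[OF x True] by simp
    next
      case False
      then obtain U where "U \<in> \<U>" "\<xi> = \<eta> U" using xi by blast
      then show ?thesis using eta(3)[OF _ x] f0[OF x] by simp
    qed
    show "(\<forall>x\<in>C. poly (g x) (\<xi> x) = 0) \<or> (\<forall>x\<in>C. poly (g x) (\<xi> x) \<noteq> 0)"
      if g: "g \<in> insert f E" and xi: "\<xi> \<in> \<Xi> \<union> \<eta> ` \<U>" for g \<xi>
    proof (cases "\<xi> \<in> \<Xi>")
      case True
      show ?thesis
      proof (cases "g = f")
        case True': True
        then show ?thesis using const[OF True] by simp
      next
        case False
        then show ?thesis using D(7)[OF _ True] g by simp
      qed
    next
      case False
      then obtain U where U: "U \<in> \<U>" "\<xi> = \<eta> U" using xi by blast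
      show ?thesis
      proof (cases "g = f")
        case True
        then show ?thesis using eta(3)[OF U(1)] U(2) by simp
      next
        case False
        then have gE: "g \<in> E" using g by simp
        show ?thesis
          using D(4)[OF gE]
        proof
          assume g0: "\<forall>x\<in>C. g x \<noteq> 0"
          \<comment> \<open>A root of \<open>g\<close> would be a value of a function of
            \<open>\<Xi>\<close>, and bands avoid these values.\<close>
          have "poly (g x) (\<eta> U x) \<noteq> 0" if x: "x \<in> C" for x
          proof
            assume "poly (g x) (\<eta> U x) = 0"
            then obtain \<zeta> where "\<zeta> \<in> \<Xi>" "\<eta> U x = \<zeta> x" using D(5)[OF x gE bspec[OF g0 x]] by blast
            then show False using eta(2)[OF U(1) x] band_outside by metis
          qed
          then show ?thesis using U(2) by simp
        qed simp
      qed
    qed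
  qed
  then show ?thesis by (rule that)
qed

text \<open>A constant polynomial has a root only if it is zero, so no new root function
  arises.\<close>

lemma delineates_insert_degree0:
  assumes D: "delineates b E C \<Xi>" and "\<And>x. x \<in> C \<Longrightarrow> degree (f x) = 0"
    and "(\<forall>x\<in>C. f x = 0) \<or> (\<forall>x\<in>C. f x \<noteq> 0)"
  shows "delineates b (insert f E) C \<Xi>"
proof -
  note D = delineatesD[OF D]
  have 0: "poly (f x) y = 0 \<longleftrightarrow> f x = 0" if "x \<in> C" for x y
    using degree_eq_zeroE[OF assms(2)[OF that]] by (metis mult_zero_right add.right_neutral pCons_eq_0_iff poly_0 poly_pCons)
  show ?thesis
  proof (rule delineatesI)
    show "\<exists>\<xi>\<in>\<Xi>. y = \<xi> x" if "x \<in> C" "g \<in> insert f E" "g x \<noteq> 0" "poly (g x) y = 0" for x g y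
    proof (cases "g = f")
      case True
      then show ?thesis using that 0 by simp
    next
      case False
      then have "g \<in> E" using that by simp
      from D(5)[OF that(1) this that(3,4)] show ?thesis .
    qed
    show "\<exists>g\<in>insert f E. g x \<noteq> 0 \<and> poly (g x) (\<xi> x) = 0" if "x \<in> C" "\<xi> \<in> \<Xi>" for x \<xi>
      using D(6)[OF that] by simp
    show "(\<forall>x\<in>C. g x = 0) \<or> (\<forall>x\<in>C. g x \<noteq> 0)" if "g \<in> insert f E" for g
      using that assms(3) D(4)[of g] by (cases "g = f") simp_all
    show "(\<forall>x\<in>C. poly (g x) (\<xi> x) = 0) \<or> (\<forall>x\<in>C. poly (g x) (\<xi> x) \<noteq> 0)"
      if "g \<in> insert f E" "\<xi> \<in> \<Xi>" for g \<xi>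
      using that(1) assms(3) D(7)[OF _ that(2), of g] 0 by (cases "g = f") simp_all
  qed (fact D(1) | fact D(3) | erule D(2))+
qed

text \<open>One step of pseudo-division: a multiple of \<open>q\<close> cancels the leading term of
  \<open>f\<close> after scaling by the square of the leading coefficient of \<open>q\<close>. At a
  root of a nonzero \<open>q\<close> the result vanishes exactly when \<open>f\<close> does, while
  its degree is smaller.\<close>

lemma leading_term_reduction:
  assumes "f \<in> poly_family" "q \<in> poly_family" "1 \<le> m" "k \<le> m"
    and deg: "\<And>x. x \<in> A \<Longrightarrow> degree (f x) = m" "\<And>x. x \<in> A \<Longrightarrow> degree (q x) = k"
  obtains r where "r \<in> poly_family" "\<And>x. x \<in> A \<Longrightarrow> degree (r x) < m"
    "\<And>x y. x \<in> A \<Longrightarrow> poly (q x) y = 0 \<Longrightarrow> poly (r x) y = (lead_coeff (q x))\<^sup>2 * poly (f x) y"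
proof -
  define r where "r x = [:(coeff (q x) k)\<^sup>2:] * f x + [:- (coeff (f x) m * coeff (q x) k):] * (monom 1 (m - k) * q x)" for x
  have "r \<in> poly_family" unfolding r_def using assms(1,2)
    by (intro poly_family_add poly_family_mult poly_family_coeff_const poly_family_const
        poly_fun_power poly_fun_uminus pf_mult poly_family_coeff)
  moreover have "degree (r x) < m" if x: "x \<in> A" for x
  proof -
    have "coeff (r x) i = 0" if "i > m - 1" for i
    proof (cases "i = m")
      case True
      then show ?thesis using assms(3,4) by (simp add: r_def coeff_monom_mult power2_eq_square)
    next
      case False
      then have "i > m" using that by simp
      moreover then have "coeff (f x) i = 0" "coeff (q x) (i - (m - k)) = 0"
        using deg[OF x] assms(4) by (auto intro!: coeff_eq_0)
      ultimately show ?thesis using assms(3,4) by (simp add: r_def coeff_monom_mult)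
    qed
    then have "degree (r x) \<le> m - 1" by (intro degree_le) blast
    then show ?thesis using assms(3) by linarith
  qed
  moreover have "poly (r x) y = (lead_coeff (q x))\<^sup>2 * poly (f x) y" if "x \<in> A" "poly (q x) y = 0" for x y
    using that by (simp add: r_def deg)
  ultimately show ?thesis by (rule that)
qed

text \<open>Quantified over connected subsets, because the pieces cut out by vanishing conditions
  need not be connected; the connected sets appear only later, as cells.\<close>

definition delineable :: "'a::euclidean_space \<Rightarrow> ('a \<Rightarrow> real poly) set \<Rightarrow> 'a set \<Rightarrow> bool" where
  "delineable b F A \<longleftrightarrow> (\<forall>C. C \<subseteq> A \<longrightarrow> connected C \<longrightarrow> C \<in> semialgebraic \<longrightarrow> (\<exists>\<Xi>. delineates b F C \<Xi>))"

lemma delineableD: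
  assumes "delineable b F A" "C \<subseteq> A" "connected C" "C \<in> semialgebraic"
  obtains \<Xi> where "delineates b F C \<Xi>"
  using assms unfolding delineable_def by auto

text \<open>Each root function of \<open>E\<close> belongs to some \<open>q\<close> in
  \<open>E\<close>, and \<open>r q\<close> decides whether \<open>f\<close> vanishes on it.
  Delineating \<open>r q\<close> as well makes the answer independent of the parameter, as
  \<open>delineates_insert\<close> requires. Passing to a subset at the end gives back
  \<open>F\<close> with \<open>f\<close> added.\<close>

lemma delineable_insert:
  fixes f :: "'a::euclidean_space \<Rightarrow> real poly"
  assumes f: "f \<in> poly_family" "\<And>x. x \<in> A \<Longrightarrow> degree (f x) \<ge> 1"
    and E: "E = insert (\<lambda>x. pderiv (f x)) F"
    and r: "\<And>q x y. q \<in> E \<Longrightarrow> x \<in> A \<Longrightarrow> poly (q x) y = 0 \<Longrightarrow> poly (r q x) y = (lead_coeff (q x))\<^sup>2 * poly (f x) y"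
    and D: "delineable b (E \<union> r ` E) A"
  shows "delineable b (insert f F) A"
  unfolding delineable_def
proof (intro allI impI)
  fix C assume C: "C \<subseteq> A" "connected C" "C \<in> semialgebraic"
  obtain \<Xi>0 where D0: "delineates b (E \<union> r ` E) C \<Xi>0" using delineableD[OF D C] by auto
  obtain \<Xi> where xi: "\<Xi> \<subseteq> \<Xi>0" "delineates b E C \<Xi>"
    and roots: "\<And>\<xi>. \<xi> \<in> \<Xi> \<Longrightarrow> \<exists>q\<in>E. \<forall>x\<in>C. q x \<noteq> 0 \<and> poly (q x) (\<xi> x) = 0"
    by (rule delineates_subset[OF D0 Un_upper1]) auto
  have const: "(\<forall>x\<in>C. poly (f x) (\<xi> x) = 0) \<or> (\<forall>x\<in>C. poly (f x) (\<xi> x) \<noteq> 0)" if \<xi>: "\<xi> \<in> \<Xi>" for \<xi>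
  proof -
    obtain q where q: "q \<in> E" and q0: "\<forall>x\<in>C. q x \<noteq> 0 \<and> poly (q x) (\<xi> x) = 0"
      using roots[OF \<xi>] by auto
    have "poly (r q x) (\<xi> x) = 0 \<longleftrightarrow> poly (f x) (\<xi> x) = 0" if "x \<in> C" for x
      using r[OF q, of x "\<xi> x"] bspec[OF q0 that] C(1) that by auto
    then show ?thesis using delineatesD(7)[OF D0, of "r q" \<xi>] q \<xi> xi(1) by auto
  qed
  have deg: "degree (f x) \<ge> 1" if "x \<in> C" for x using f(2) C(1) that by auto
  have "(\<lambda>x. pderiv (f x)) \<in> E" by (simp add: E)
  then obtain \<Xi>' where "delineates b (insert f E) C \<Xi>'"
    using delineates_insert[OF xi(2) C(2,3) f(1) deg _ const] by auto
  moreover have "insert f F \<subseteq> insert f E" by (auto simp: E)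
  ultimately show "\<exists>\<Xi>. delineates b (insert f F) C \<Xi>" by (metis delineates_subset)
qed

text \<open>Treating a polynomial of top degree calls for its derivative and for one reduced
  polynomial per member of \<open>E\<close>. All of these have smaller degree, so a double induction
  works: on the degree bound and, inside it, on the set of polynomials that may attain the top
  degree.\<close>

lemma piecewise_delineable_bounded:
  fixes b :: "'a::euclidean_space"
  assumes "A \<in> semialgebraic" "finite F" "F \<subseteq> poly_family" "\<And>f x. f \<in> F \<Longrightarrow> x \<in> A \<Longrightarrow> degree (f x) < m"
  shows "piecewise A (delineable b F)"
  using assms
proof (induction m arbitrary: A F)
  case 0
  have "delineates b F C {}" if "C \<subseteq> A" for C
    using 0(4) that by (intro delineatesI) (auto simp: ordered_functions_def)
  then show ?case by (intro piecewise_return 0) (auto simp: delineable_def)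
next
  case (Suc m)
  \<comment> \<open>\<open>H\<close> holds polynomials of degree up to \<open>m\<close>,
    \<open>L\<close> those of degree below \<open>m\<close>. The induction empties \<open>H\<close>,
    while \<open>L\<close> is arbitrary and may grow.\<close>
  have inner: "piecewise A (delineable b (H \<union> L))"
    if "finite H" "H \<subseteq> poly_family" "A \<in> semialgebraic" "finite L" "L \<subseteq> poly_family"
      "\<And>h x. h \<in> H \<Longrightarrow> x \<in> A \<Longrightarrow> degree (h x) \<le> m" "\<And>h x. h \<in> L \<Longrightarrow> x \<in> A \<Longrightarrow> degree (h x) < m" for H L A
    using that
  proof (induction H arbitrary: A L)
    case empty
    then show ?case using Suc.IH[of A L] by simp
  next
    case (insert h H)
    have "piecewise A (\<lambda>B. \<forall>f\<in>{h}. ((\<forall>x\<in>B. f x = 0) \<or> (\<forall>x\<in>B. f x \<noteq> 0)) \<and> (\<exists>k. \<forall>x\<in>B. degree (f x) = k))"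
      using insert.prems by (intro piecewise_degree_constant) auto
    then show ?case
    proof (rule piecewise_bind)
      fix B assume B: "B \<in> semialgebraic" "B \<subseteq> A"
        "\<forall>f\<in>{h}. ((\<forall>x\<in>B. f x = 0) \<or> (\<forall>x\<in>B. f x \<noteq> 0)) \<and> (\<exists>k. \<forall>x\<in>B. degree (f x) = k)"
      then obtain k where k: "\<And>x. x \<in> B \<Longrightarrow> degree (h x) = k" by auto
      have h: "h \<in> poly_family" "H \<subseteq> poly_family" using insert.prems by auto
      have low: "degree (g x) < m" if "g \<in> L" "x \<in> B" for g x using insert.prems(6) B(2) that by auto
      have high: "degree (g x) \<le> m" if "g \<in> insert h H" "x \<in> B" for g x using insert.prems(5) B(2) that by auto
      show "piecewise B (delineable b (insert h H \<union> L))"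
      \<comment> \<open>A polynomial whose degree drops on this piece moves from \<open>H\<close> to
        \<open>L\<close>.\<close>
      proof (cases "k < m \<or> B = {}")
        case True
        have "piecewise B (delineable b (H \<union> insert h L))"
          by (rule insert.IH) (use h B(1) insert.prems(3,4) high low k True in auto)
        then show ?thesis by simp
      next
        case False
        then have km: "k = m" using high[of h] k by fastforce
        show ?thesis
        proof (cases "m = 0")
          case True
          have "piecewise B (delineable b (H \<union> L))"
            by (rule insert.IH) (use h B(1) insert.prems(3,4) high low in auto)
          then show ?thesis
          proof (rule piecewise_mono)
            fix B' assume B': "B' \<in> semialgebraic" "B' \<subseteq> B" "delineable b (H \<union> L) B'"
            show "delineable b (insert h H \<union> L) B'"
              unfolding delineable_def
            proof (intro allI impI)
              fix C assume C: "C \<subseteq> B'" "connected C" "C \<in> semialgebraic"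
              then obtain \<Xi> where "delineates b (H \<union> L) C \<Xi>" using delineableD[OF B'(3)] by auto
              then have "delineates b (insert h (H \<union> L)) C \<Xi>"
                by (rule delineates_insert_degree0) (use k km True B(3) B'(2) C(1) in auto)
              then show "\<exists>\<Xi>. delineates b (insert h H \<union> L) C \<Xi>" by auto
            qed
          qed
        next
          case m: False
          define E where "E = insert (\<lambda>x. pderiv (h x)) (H \<union> L)"
          have E: "finite E" "E \<subseteq> poly_family"
            using insert.prems insert.hyps by (auto simp: E_def poly_family_pderiv)
          have degE: "degree (q x) \<le> m" if "q \<in> E" "x \<in> B" for q x
            using that high low[of q x] k[OF that(2)] km by (auto simp: E_def degree_pderiv)
          have "piecewise B (\<lambda>B. \<forall>f\<in>E. ((\<forall>x\<in>B. f x = 0) \<or> (\<forall>x\<in>B. f x \<noteq> 0)) \<and> (\<exists>k. \<forall>x\<in>B. degree (f x) = k))"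
            by (intro piecewise_degree_constant B E)
          then show ?thesis
          proof (rule piecewise_bind)
            fix B' assume B': "B' \<in> semialgebraic" "B' \<subseteq> B"
              "\<forall>f\<in>E. ((\<forall>x\<in>B'. f x = 0) \<or> (\<forall>x\<in>B'. f x \<noteq> 0)) \<and> (\<exists>k. \<forall>x\<in>B'. degree (f x) = k)"
            let ?R = "\<lambda>q r. r \<in> poly_family \<and> (\<forall>x\<in>B'. degree (r x) < m) \<and>
              (\<forall>x\<in>B'. \<forall>y. poly (q x) y = 0 \<longrightarrow> poly (r x) y = (lead_coeff (q x))\<^sup>2 * poly (h x) y)"
            have "\<exists>r. ?R q r" if q: "q \<in> E" for q
            proof (cases "B' = {}")
              case True
              then show ?thesis using h(1) by auto
            next
              case False
              obtain j where j: "\<And>x. x \<in> B' \<Longrightarrow> degree (q x) = j" using B'(3) q by auto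
              then have "j \<le> m" using degE[OF q] False B'(2) by fastforce
              show ?thesis
                by (rule leading_term_reduction[OF h(1) subsetD[OF E(2) q] _ \<open>j \<le> m\<close> _ j])
                  (use m k km B'(2) in auto)
            qed
            then obtain r where "\<forall>q\<in>E. ?R q (r q)" using bchoice[of E ?R] by blast
            then have r: "r q \<in> poly_family" "\<And>x. x \<in> B' \<Longrightarrow> degree (r q x) < m"
              "\<And>x y. x \<in> B' \<Longrightarrow> poly (q x) y = 0 \<Longrightarrow> poly (r q x) y = (lead_coeff (q x))\<^sup>2 * poly (h x) y"
              if "q \<in> E" for q using that by simp_all
            have h': "degree (pderiv (h x)) < m" if "x \<in> B'" for x
              using m k km B'(2) that by (auto simp: degree_pderiv)
            \<comment> \<open>The derivative and the reduced polynomials have degree below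
              \<open>m\<close>, so they join \<open>L\<close> and the inner hypothesis for the
              smaller \<open>H\<close> applies.\<close>
            have "piecewise B' (delineable b (H \<union> (insert (\<lambda>x. pderiv (h x)) (L \<union> r ` E))))"
              by (rule insert.IH)
                (use h B'(1,2) insert.prems(3,4) E high low r h' in \<open>auto simp: poly_family_pderiv\<close>)
            also have "H \<union> (insert (\<lambda>x. pderiv (h x)) (L \<union> r ` E)) = E \<union> r ` E" by (auto simp: E_def)
            finally show "piecewise B' (delineable b (insert h H \<union> L))"
            proof (rule piecewise_mono)
              fix B'' assume B'': "B'' \<in> semialgebraic" "B'' \<subseteq> B'" "delineable b (E \<union> r ` E) B''"
              have "delineable b (insert h (H \<union> L)) B''"
                by (rule delineable_insert[OF h(1) _ E_def _ B''(3)])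
                  (use k km m B''(2) B'(2) r(3) in auto)
              then show "delineable b (insert h H \<union> L) B''" by simp
            qed
          qed
        qed
      qed
    qed
  qed
  have "piecewise A (delineable b (F \<union> {}))"
    by (rule inner) (use Suc.prems in \<open>auto simp: less_Suc_eq_le\<close>)
  then show ?case by simp
qed

lemma piecewise_delineable:
  fixes b :: "'a::euclidean_space"
  assumes "finite F" "F \<subseteq> poly_family"
  shows "piecewise UNIV (delineable b F)"
proof -
  have "\<forall>f\<in>F. \<exists>N. \<forall>x. degree (f x) \<le> N" using assms(2) poly_family_degree by blast
  then obtain N where N: "\<And>f x. f \<in> F \<Longrightarrow> degree (f x) \<le> N f" by metis
  show ?thesis
  proof (rule piecewise_delineable_bounded[OF semialgebraic_UNIV assms, of "Suc (sum N F)"])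
    fix f x assume "f \<in> F"
    then have "N f \<le> sum N F" using assms(1) by (simp add: member_le_sum)
    then show "degree (f x) < Suc (sum N F)" using N[OF \<open>f \<in> F\<close>, of x] by simp
  qed
qed

section \<open>Cell decomposition and projection\<close>

lemma homeomorphic_add_coord:
  fixes b :: "'a::euclidean_space"
  assumes b: "b \<in> Basis" and C: "\<And>x. x \<in> C \<Longrightarrow> x \<bullet> b = 0"
  shows "(SIGMA x:C. W x) homeomorphic {z. drop_coord b z \<in> C \<and> z \<bullet> b \<in> W (drop_coord b z)}"
proof -
  have drop: "drop_coord b (x + y *\<^sub>R b) = x" "(x + y *\<^sub>R b) \<bullet> b = y" if "x \<in> C" for x y
    using b C[OF that] by (auto simp: drop_coord_def inner_add_left)
  have "homeomorphism (SIGMA x:C. W x) {z. drop_coord b z \<in> C \<and> z \<bullet> b \<in> W (drop_coord b z)}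
    (\<lambda>p. fst p + snd p *\<^sub>R b) (\<lambda>z. (drop_coord b z, z \<bullet> b))"
    by (rule homeomorphismI)
      (auto simp: drop, auto simp: drop_coord_def intro!: continuous_intros)
  then show ?thesis unfolding homeomorphic_def by blast
qed

lemma homeomorphic_graph:
  fixes b :: "'a::euclidean_space"
  assumes b: "b \<in> Basis" and C: "\<And>x. x \<in> C \<Longrightarrow> x \<bullet> b = 0" and "continuous_on C \<xi>"
  shows "{z. drop_coord b z \<in> C \<and> z \<bullet> b = \<xi> (drop_coord b z)} homeomorphic C"
proof -
  have drop: "drop_coord b (x + y *\<^sub>R b) = x" "(x + y *\<^sub>R b) \<bullet> b = y" if "x \<in> C" for x y
    using b C[OF that] by (auto simp: drop_coord_def inner_add_left)
  have "homeomorphism {z. drop_coord b z \<in> C \<and> z \<bullet> b = \<xi> (drop_coord b z)} C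
    (drop_coord b) (\<lambda>x. x + \<xi> x *\<^sub>R b)"
  proof (rule homeomorphismI)
    show "continuous_on {z. drop_coord b z \<in> C \<and> z \<bullet> b = \<xi> (drop_coord b z)} (drop_coord b)"
      unfolding drop_coord_def by (intro continuous_intros)
    show "drop_coord b z + \<xi> (drop_coord b z) *\<^sub>R b = z"
      if "z \<in> {z. drop_coord b z \<in> C \<and> z \<bullet> b = \<xi> (drop_coord b z)}" for z
    proof -
      have "\<xi> (drop_coord b z) = z \<bullet> b" using that by simp
      then show ?thesis by (simp only:) (simp add: drop_coord_def)
    qed
  qed (use assms(3) in \<open>auto simp: drop intro!: continuous_intros\<close>)
  then show ?thesis unfolding homeomorphic_def by blast
qed

lemma homeomorphic_Times:
  assumes "S homeomorphic S'" "T homeomorphic T'"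
  shows "(S \<times> T) homeomorphic (S' \<times> T')"
proof -
  obtain f f' g g' where h: "homeomorphism S S' f f'" "homeomorphism T T' g g'"
    using assms unfolding homeomorphic_def by blast
  have "homeomorphism (S \<times> T) (S' \<times> T') (\<lambda>p. (f (fst p), g (snd p))) (\<lambda>p. (f' (fst p), g' (snd p)))"
    using h unfolding homeomorphism_def
    by (auto intro!: continuous_intros continuous_on_compose2[of S f] continuous_on_compose2[of T g]
        continuous_on_compose2[of S' f'] continuous_on_compose2[of T' g'] image_eqI)
  then show ?thesis unfolding homeomorphic_def by blast
qed

text \<open>The analogue of \<open>open_cube\<close> in any Euclidean space, indexed by basis
  vectors so that a coordinate is added by \<open>insert\<close>.\<close>

definition cube :: "'a::euclidean_space set \<Rightarrow> 'a set" where
  "cube D = {z. \<forall>b\<in>Basis. (b \<in> D \<longrightarrow> 0 < z \<bullet> b \<and> z \<bullet> b < 1) \<and> (b \<notin> D \<longrightarrow> z \<bullet> b = 0)}"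

text \<open>For \<open>B \<subseteq> Basis\<close> this is the coordinate subspace spanned by
  \<open>B\<close>; the induction on the number of coordinates runs through these subspaces.\<close>

definition flat :: "'a::euclidean_space set \<Rightarrow> 'a set" where
  "flat B = {z. \<forall>b\<in>Basis - B. z \<bullet> b = 0}"

lemma convex_cube: "convex (cube D)"
proof -
  have "cube D = (\<Inter>b\<in>Basis. {z. b \<bullet> z \<in> (if b \<in> D then {0<..<1} else {0})})"
    by (auto simp: cube_def inner_commute split: if_splits)
  moreover have "convex {z. b \<bullet> z \<in> S}" if "convex S" for b :: 'a and S :: "real set"
    using convex_linear_vimage[OF bounded_linear.linear[OF bounded_linear_inner_right] that, of b]
    by (simp add: vimage_def)
  ultimately show ?thesis by (auto intro!: convex_INT)
qed

lemma cube_nonempty: "cube D \<noteq> {}"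
proof -
  have "(\<Sum>b\<in>Basis. (if b \<in> D then 1/2 else 0) *\<^sub>R b) \<in> cube D"
    by (auto simp: cube_def)
  then show ?thesis by auto
qed

lemma cube_insert:
  fixes b :: "'a::euclidean_space"
  assumes "b \<in> Basis" "b \<notin> D"
  shows "cube (insert b D) = {z. drop_coord b z \<in> cube D \<and> z \<bullet> b \<in> {0<..<1}}"
proof -
  have "drop_coord b z \<bullet> c = (if c = b then 0 else z \<bullet> c)" if "c \<in> Basis" for z c
    using assms that by (auto simp: drop_coord_def inner_diff_left inner_Basis)
  then show ?thesis using assms by (auto simp: cube_def)
qed

lemma flat_insert:
  fixes b :: "'a::euclidean_space"
  assumes "b \<in> Basis" "b \<notin> B"
  shows "flat (insert b B) = {z. drop_coord b z \<in> flat B}"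
proof -
  have "drop_coord b z \<bullet> c = (if c = b then 0 else z \<bullet> c)" if "c \<in> Basis" for z c
    using assms that by (auto simp: drop_coord_def inner_diff_left inner_Basis)
  then show ?thesis using assms by (auto simp: flat_def)
qed

lemma homeomorphic_cube_insert:
  fixes b :: "'a::euclidean_space"
  assumes b: "b \<in> Basis" "b \<notin> D" and "C homeomorphic cube D"
  shows "(C \<times> {0<..<1::real}) homeomorphic cube (insert b D)"
proof -
  have "(C \<times> {0<..<1::real}) homeomorphic (cube D \<times> {0<..<1::real})"
    by (intro homeomorphic_Times assms homeomorphic_refl)
  also have "(cube D \<times> {0<..<1::real}) homeomorphic {z. drop_coord b z \<in> cube D \<and> z \<bullet> b \<in> {0<..<1}}"
    using homeomorphic_add_coord[OF b(1), of "cube D" "\<lambda>x. {0<..<1}"] b by (auto simp: cube_def)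
  finally show ?thesis by (simp only: cube_insert[OF b])
qed

text \<open>The cells are the graphs, homeomorphic to \<open>C\<close>, and the nonempty bands,
  homeomorphic to the product of \<open>C\<close> with an open interval. They are connected and each
  \<open>f\<close> vanishes on them everywhere or nowhere, so signs are constant. That every cell
  lies over all of \<open>C\<close> is recorded for the projection theorem.\<close>

lemma cylinder_decomposition:
  fixes b :: "'a::euclidean_space"
  assumes b: "b \<in> Basis" "b \<notin> B" and C: "\<And>x. x \<in> C \<Longrightarrow> x \<bullet> b = 0" "C \<in> semialgebraic"
    and D: "C homeomorphic cube D" "D \<subseteq> B"
    and del: "delineates b F C \<Xi>" "F \<subseteq> poly_family"
  obtains \<D> where "finite \<D>" "\<Union>\<D> = {z. drop_coord b z \<in> C}" "pairwise disjnt \<D>"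
    "\<And>E. E \<in> \<D> \<Longrightarrow> E \<in> semialgebraic" "\<And>E. E \<in> \<D> \<Longrightarrow> \<exists>D\<subseteq>insert b B. E homeomorphic cube D"
    "\<And>E x. E \<in> \<D> \<Longrightarrow> x \<in> C \<Longrightarrow> \<exists>y. x + y *\<^sub>R b \<in> E"
    "\<And>E f z w. E \<in> \<D> \<Longrightarrow> f \<in> F \<Longrightarrow> z \<in> E \<Longrightarrow> w \<in> E \<Longrightarrow>
      sgn (poly (f (drop_coord b z)) (z \<bullet> b)) = sgn (poly (f (drop_coord b w)) (w \<bullet> b))"
proof -
  note \<Xi> = delineatesD[OF del(1)]
  define G where "G \<xi> = {z. drop_coord b z \<in> C \<and> z \<bullet> b = \<xi> (drop_coord b z)}" for \<xi>
  define W where "W U = {z. drop_coord b z \<in> C \<and> z \<bullet> b \<in> band \<Xi> U (drop_coord b z)}" for U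
  \<comment> \<open>Empty bands are left out, since a cell is modelled on a cube and a cube is never
    empty.\<close>
  define \<W> where "\<W> = {U. U \<subseteq> \<Xi> \<and> W U \<noteq> {}}"
  have drop: "drop_coord b (x + y *\<^sub>R b) = x" "(x + y *\<^sub>R b) \<bullet> b = y" if "x \<in> C" for x y
    using b C(1)[OF that] by (auto simp: drop_coord_def inner_add_left)
  have cont: "continuous_on C \<xi>" if "\<xi> \<in> \<Xi>" for \<xi>
    using \<Xi>(2)[OF that] by (simp add: semialgebraic_function_def)
  have "b \<notin> D" using b D by auto
  have fin: "finite \<W>" by (rule finite_subset[of _ "Pow \<Xi>"]) (auto simp: \<W>_def \<Xi>(1))
  have band: "band \<Xi> U x \<noteq> {}" if U: "U \<in> \<W>" and x: "x \<in> C" for U x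
  proof -
    obtain z where "drop_coord b z \<in> C" "z \<bullet> b \<in> band \<Xi> U (drop_coord b z)" "U \<subseteq> \<Xi>"
      using U by (auto simp: \<W>_def W_def)
    then show ?thesis using band_nonempty[OF \<Xi>(1) _ \<Xi>(3) _ _ x, of U "drop_coord b z"] by auto
  qed
  have homG: "G \<xi> homeomorphic cube D" if "\<xi> \<in> \<Xi>" for \<xi>
    unfolding G_def using homeomorphic_graph[OF b(1) C(1) cont[OF that]] D(1) homeomorphic_trans by blast
  have homW: "W U homeomorphic cube (insert b D)" if "U \<in> \<W>" for U
  proof -
    have "W U homeomorphic (SIGMA x:C. band \<Xi> U x)"
      unfolding W_def by (subst homeomorphic_sym) (rule homeomorphic_add_coord[OF b(1) C(1)])
    also have "(SIGMA x:C. band \<Xi> U x) homeomorphic (C \<times> {0<..<1::real})"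
      by (intro band_homeomorphic \<Xi>(1) cont band that) (use that in \<open>simp add: \<W>_def\<close>)
    also have "(C \<times> {0<..<1::real}) homeomorphic cube (insert b D)"
      by (rule homeomorphic_cube_insert[OF b(1) \<open>b \<notin> D\<close> D(1)])
    finally show ?thesis .
  qed
  have contF: "continuous_on S (\<lambda>z. poly (f (drop_coord b z)) (z \<bullet> b))" if "f \<in> F" for f S
    using that del(2) unfolding drop_coord_def by (intro continuous_on_poly_family continuous_intros) auto
  have conn: "connected E" if "E homeomorphic cube D'" for E D'
    using that convex_cube homeomorphic_connectedness convex_connected by blast
  have sgnconst: "sgn (poly (f (drop_coord b z)) (z \<bullet> b)) = sgn (poly (f (drop_coord b w)) (w \<bullet> b))"
    if "connected E" "f \<in> F" "z \<in> E" "w \<in> E"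
      "(\<forall>z\<in>E. poly (f (drop_coord b z)) (z \<bullet> b) = 0) \<or> (\<forall>z\<in>E. poly (f (drop_coord b z)) (z \<bullet> b) \<noteq> 0)" for E f z w
    using that(5)
  proof
    assume "\<forall>z\<in>E. poly (f (drop_coord b z)) (z \<bullet> b) \<noteq> 0"
    then show ?thesis
      using connected_nonzero_sign[OF that(1) contF[OF that(2)] _ that(3,4)] by simp
  qed (use that(3,4) in simp)
  show ?thesis
  proof (rule that[of "G ` \<Xi> \<union> W ` \<W>"])
    show "finite (G ` \<Xi> \<union> W ` \<W>)" using \<Xi>(1) fin by simp
    show "\<Union>(G ` \<Xi> \<union> W ` \<W>) = {z. drop_coord b z \<in> C}"
    proof (intro set_eqI iffI)
      fix z assume "z \<in> {z. drop_coord b z \<in> C}"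
      then have z: "drop_coord b z \<in> C" by simp
      show "z \<in> \<Union>(G ` \<Xi> \<union> W ` \<W>)"
      proof (cases "\<exists>\<xi>\<in>\<Xi>. z \<bullet> b = \<xi> (drop_coord b z)")
        case True
        then obtain \<xi> where "\<xi> \<in> \<Xi>" "z \<bullet> b = \<xi> (drop_coord b z)" by blast
        then have "z \<in> G \<xi>" "\<xi> \<in> \<Xi>" using z by (simp_all add: G_def)
        then show ?thesis by blast
      next
        case False
        define U where "U = {\<xi>\<in>\<Xi>. \<xi> (drop_coord b z) < z \<bullet> b}"
        have "z \<bullet> b \<in> band \<Xi> U (drop_coord b z)"
        proof (rule bandI)
          fix \<xi> assume "\<xi> \<in> \<Xi>" "\<xi> \<notin> U"
          then have "\<not> \<xi> (drop_coord b z) < z \<bullet> b" "z \<bullet> b \<noteq> \<xi> (drop_coord b z)" using False by (simp_all add: U_def)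
          then show "z \<bullet> b < \<xi> (drop_coord b z)" by simp
        qed (simp add: U_def)
        then have "z \<in> W U" using z by (simp add: W_def)
        moreover then have "U \<in> \<W>" by (auto simp: \<W>_def U_def)
        ultimately show ?thesis by blast
      qed
    qed (auto simp: G_def W_def)
    show "pairwise disjnt (G ` \<Xi> \<union> W ` \<W>)"
    proof -
      have GG: "disjnt (G \<xi>) (G \<eta>)" if "\<xi> \<in> \<Xi>" "\<eta> \<in> \<Xi>" "G \<xi> \<noteq> G \<eta>" for \<xi> \<eta>
      proof -
        have "\<xi> \<noteq> \<eta>" using that by auto
        from ordered_functionsD[OF \<Xi>(3) that(1,2) this]
        show ?thesis unfolding disjnt_def G_def by (auto dest: bspec)
      qed
      have GW: "disjnt (G \<xi>) (W U)" if "\<xi> \<in> \<Xi>" for \<xi> U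
        using band_outside[OF that] unfolding disjnt_def G_def W_def by auto
      have WW: "disjnt (W U) (W V)" if "U \<in> \<W>" "V \<in> \<W>" "\<xi> \<in> U" "\<xi> \<notin> V" for U V \<xi>
      proof -
        have "\<xi> \<in> \<Xi>" using that by (auto simp: \<W>_def)
        then have "y \<notin> band \<Xi> V x" if "y \<in> band \<Xi> U x" for y x
          using bandD(1)[OF that \<open>\<xi> \<in> U\<close>] bandD(2)[of y \<Xi> V x, OF _ _ \<open>\<xi> \<notin> V\<close>] by force
        then show ?thesis unfolding disjnt_def W_def by blast
      qed
      have WW': "disjnt (W U) (W V)" if "U \<in> \<W>" "V \<in> \<W>" "W U \<noteq> W V" for U V
      proof -
        have "U \<noteq> V" using that by auto
        then obtain \<xi> where "(\<xi> \<in> U \<and> \<xi> \<notin> V) \<or> (\<xi> \<in> V \<and> \<xi> \<notin> U)" by blast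
        then show ?thesis using WW[OF that(1,2)] WW[OF that(2,1)] by (metis disjnt_sym)
      qed
      show ?thesis
        unfolding pairwise_def
      proof (intro ballI impI)
        fix E E' assume E: "E \<in> G ` \<Xi> \<union> W ` \<W>" "E' \<in> G ` \<Xi> \<union> W ` \<W>" "E \<noteq> E'"
        from E(1,2) show "disjnt E E'"
          by (elim UnE imageE; simp) (use E(3) GG GW WW' disjnt_sym in metis)+
      qed
    qed
    fix E assume E: "E \<in> G ` \<Xi> \<union> W ` \<W>"
    show "E \<in> semialgebraic"
      using E
    proof
      assume "E \<in> G ` \<Xi>"
      then show ?thesis using \<Xi>(2) by (auto simp: semialgebraic_function_def G_def)
    next
      assume "E \<in> W ` \<W>"
      then show ?thesis
        by (auto simp: W_def \<W>_def intro!: semialgebraic_band \<Xi>(1) C(2) \<Xi>(2))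
    qed
    show "\<exists>D\<subseteq>insert b B. E homeomorphic cube D"
      using E
    proof
      assume "E \<in> G ` \<Xi>"
      then show ?thesis using homG D(2) by (intro exI[of _ D]) auto
    next
      assume "E \<in> W ` \<W>"
      then show ?thesis using homW D(2) by (intro exI[of _ "insert b D"]) auto
    qed
    show "\<exists>y. x + y *\<^sub>R b \<in> E" if x: "x \<in> C" for x
      using E
    proof
      assume "E \<in> G ` \<Xi>"
      then obtain \<xi> where "E = G \<xi>" by blast
      then show ?thesis using drop[OF x] x by (intro exI[of _ "\<xi> x"]) (simp add: G_def)
    next
      assume "E \<in> W ` \<W>"
      then obtain U where U: "E = W U" "U \<in> \<W>" by blast
      obtain y where "y \<in> band \<Xi> U x" using band[OF U(2) x] by blast
      then show ?thesis using drop[OF x] x U(1) by (intro exI[of _ y]) (simp add: W_def)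
    qed
    show "sgn (poly (f (drop_coord b z)) (z \<bullet> b)) = sgn (poly (f (drop_coord b w)) (w \<bullet> b))"
      if f: "f \<in> F" and z: "z \<in> E" and w: "w \<in> E" for f z w
      using E
    proof
      assume "E \<in> G ` \<Xi>"
      then obtain \<xi> where xi: "E = G \<xi>" "\<xi> \<in> \<Xi>" by blast
      show ?thesis
      proof (rule sgnconst[OF _ f z w])
        show "connected E" using homG[OF xi(2)] conn xi(1) by blast
        show "(\<forall>z\<in>E. poly (f (drop_coord b z)) (z \<bullet> b) = 0) \<or> (\<forall>z\<in>E. poly (f (drop_coord b z)) (z \<bullet> b) \<noteq> 0)"
          using \<Xi>(7)[OF f xi(2)] xi(1) by (auto simp: G_def)
      qed
    next
      assume "E \<in> W ` \<W>"
      then obtain U where U: "E = W U" "U \<in> \<W>" by blast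
      show ?thesis
      proof (rule sgnconst[OF _ f z w])
        show "connected E" using homW[OF U(2)] conn U(1) by blast
        show "(\<forall>z\<in>E. poly (f (drop_coord b z)) (z \<bullet> b) = 0) \<or> (\<forall>z\<in>E. poly (f (drop_coord b z)) (z \<bullet> b) \<noteq> 0)"
          using \<Xi>(4)[OF f]
        proof
          assume f0: "\<forall>x\<in>C. f x \<noteq> 0"
          have "poly (f (drop_coord b z)) (z \<bullet> b) \<noteq> 0" if "z \<in> E" for z
          proof
            assume 0: "poly (f (drop_coord b z)) (z \<bullet> b) = 0"
            have zC: "drop_coord b z \<in> C" "z \<bullet> b \<in> band \<Xi> U (drop_coord b z)"
              using \<open>z \<in> E\<close> U(1) by (simp_all add: W_def)
            obtain \<xi> where "\<xi> \<in> \<Xi>" "z \<bullet> b = \<xi> (drop_coord b z)"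
              using \<Xi>(5)[OF zC(1) f bspec[OF f0 zC(1)] 0] by blast
            then show False using zC(2) band_outside by metis
          qed
          then show ?thesis by blast
        qed (use U(1) in \<open>simp add: W_def\<close>)
      qed
    qed
  qed
qed

section \<open>Decomposition into cells of constant sign\<close>

definition sign_invariant :: "('a \<Rightarrow> real) set \<Rightarrow> 'a set \<Rightarrow> bool" where
  "sign_invariant P C \<longleftrightarrow> (\<forall>p\<in>P. \<forall>x\<in>C. \<forall>y\<in>C. sgn (p x) = sgn (p y))"

lemma sign_invariantI:
  "(\<And>p x y. p \<in> P \<Longrightarrow> x \<in> C \<Longrightarrow> y \<in> C \<Longrightarrow> sgn (p x) = sgn (p y)) \<Longrightarrow> sign_invariant P C"
  unfolding sign_invariant_def by (intro ballI)

lemma sign_invariantD: "sign_invariant P C \<Longrightarrow> p \<in> P \<Longrightarrow> x \<in> C \<Longrightarrow> y \<in> C \<Longrightarrow> sgn (p x) = sgn (p y)"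
  unfolding sign_invariant_def by (drule (1) bspec)+

definition cell_decomposition :: "'a::euclidean_space set \<Rightarrow> ('a \<Rightarrow> real) set \<Rightarrow> 'a set set \<Rightarrow> bool" where
  "cell_decomposition B P \<C> \<longleftrightarrow> finite \<C> \<and> \<Union>\<C> = flat B \<and> pairwise disjnt \<C> \<and>
     (\<forall>C\<in>\<C>. C \<in> semialgebraic \<and> (\<exists>D\<subseteq>B. C homeomorphic cube D) \<and> sign_invariant P C)"

text \<open>The assumption \<open>base\<close> is the induction hypothesis of the existence theorem.
  Base cells and the stacks over them are kept apart in the conclusion: the existence theorem
  collects the stacks, the projection theorem returns to the base cells.\<close>

lemma cylindrical_decomposition:
  fixes b :: "'a::euclidean_space"
  assumes b: "b \<in> Basis" "b \<notin> B" and P: "finite P" "P \<subseteq> poly_fun"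
    and base: "\<And>Q. finite Q \<Longrightarrow> Q \<subseteq> poly_fun \<Longrightarrow> \<exists>\<C>. cell_decomposition B Q \<C>"
  obtains \<C> \<D> where "cell_decomposition B {} \<C>"
    "\<And>C. C \<in> \<C> \<Longrightarrow> finite (\<D> C) \<and> \<Union>(\<D> C) = {z. drop_coord b z \<in> C} \<and> pairwise disjnt (\<D> C) \<and>
      (\<forall>E\<in>\<D> C. E \<in> semialgebraic \<and> (\<exists>D\<subseteq>insert b B. E homeomorphic cube D) \<and>
        (\<forall>x\<in>C. \<exists>y. x + y *\<^sub>R b \<in> E) \<and> sign_invariant P E)"
proof -
  have "\<forall>p\<in>P. \<exists>f. f \<in> poly_family \<and> (\<forall>x t. poly (f x) t = p (x + t *\<^sub>R b))"
    using P(2) by (meson poly_fun_along_basis[OF _ b(1)] subsetD)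
  then obtain f where "\<forall>p\<in>P. f p \<in> poly_family \<and> (\<forall>x t. poly (f p x) t = p (x + t *\<^sub>R b))"
    by (rule bchoice[elim_format]) blast
  then have f: "f p \<in> poly_family" "\<And>x t. poly (f p x) t = p (x + t *\<^sub>R b)" if "p \<in> P" for p
    using that by auto
  have pf: "poly (f p (drop_coord b z)) (z \<bullet> b) = p z" if "p \<in> P" for p z
    using f(2)[OF that] by (simp add: drop_coord_def)
  have F: "finite (f ` P)" "f ` P \<subseteq> poly_family" using P f(1) by auto
  obtain \<A> where A: "finite \<A>" "\<A> \<subseteq> semialgebraic" "\<Union>\<A> = UNIV" "\<forall>A\<in>\<A>. delineable b (f ` P) A"
    using piecewise_delineable[OF F, of b] unfolding piecewise_def by blast
  have "\<forall>A\<in>\<A>. \<exists>Q. finite Q \<and> Q \<subseteq> poly_fun \<and>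
    (\<forall>x y. (\<forall>p\<in>Q. sgn (p x) = sgn (p y)) \<longrightarrow> (x \<in> A \<longleftrightarrow> y \<in> A))"
  proof
    fix A assume "A \<in> \<A>"
    then have "A \<in> semialgebraic" using A(2) by blast
    then show "\<exists>Q. finite Q \<and> Q \<subseteq> poly_fun \<and>
      (\<forall>x y. (\<forall>p\<in>Q. sgn (p x) = sgn (p y)) \<longrightarrow> (x \<in> A \<longleftrightarrow> y \<in> A))"
    proof (rule semialgebraic_sign_determined)
      fix Q assume Q: "finite Q" "Q \<subseteq> poly_fun"
        "\<And>x y. (\<And>p. p \<in> Q \<Longrightarrow> sgn (p x) = sgn (p y)) \<Longrightarrow> x \<in> A \<longleftrightarrow> y \<in> A"
      have "x \<in> A \<longleftrightarrow> y \<in> A" if "\<forall>p\<in>Q. sgn (p x) = sgn (p y)" for x y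
        by (rule Q(3)) (rule bspec[OF that])
      with Q(1,2) show ?thesis by (intro exI[of _ Q] conjI allI impI)
    qed
  qed
  then obtain Q where "\<forall>A\<in>\<A>. finite (Q A) \<and> Q A \<subseteq> poly_fun \<and>
    (\<forall>x y. (\<forall>p\<in>Q A. sgn (p x) = sgn (p y)) \<longrightarrow> (x \<in> A \<longleftrightarrow> y \<in> A))"
    by (rule bchoice[elim_format]) blast
  note Q' = bspec[OF this]
  have Q: "finite (Q A)" "Q A \<subseteq> poly_fun" if "A \<in> \<A>" for A using Q'[OF that] by auto
  have QA: "x \<in> A \<longleftrightarrow> y \<in> A" if "A \<in> \<A>" "\<forall>p\<in>Q A. sgn (p x) = sgn (p y)" for A x y
    using Q'[OF that(1)] that(2) by (elim conjE) (drule spec, drule spec, erule (1) mp)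
  \<comment> \<open>The base is decomposed for all polynomials that determine the pieces of the
    delineable cover, so that each base cell lies inside a single piece.\<close>
  have "\<exists>\<C>. cell_decomposition B (\<Union>(Q ` \<A>)) \<C>"
    by (rule base) (use Q A(1) in auto)
  then obtain \<C> where \<C>: "cell_decomposition B (\<Union>(Q ` \<A>)) \<C>" by blast
  have cell: "cell_decomposition B {} \<C>" using \<C> by (simp add: cell_decomposition_def sign_invariant_def)
  let ?R = "\<lambda>C \<D>. finite \<D> \<and> \<Union>\<D> = {z. drop_coord b z \<in> C} \<and> pairwise disjnt \<D> \<and>
      (\<forall>E\<in>\<D>. E \<in> semialgebraic \<and> (\<exists>D\<subseteq>insert b B. E homeomorphic cube D) \<and>
        (\<forall>x\<in>C. \<exists>y. x + y *\<^sub>R b \<in> E) \<and> sign_invariant P E)"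
  have "\<exists>\<D>. ?R C \<D>" if C: "C \<in> \<C>" for C
  proof -
    have C': "C \<in> semialgebraic" "\<exists>D\<subseteq>B. C homeomorphic cube D" "C \<subseteq> flat B"
      using \<C> C by (auto simp: cell_decomposition_def)
    then obtain D where D: "D \<subseteq> B" "C homeomorphic cube D" by blast
    have "C \<noteq> {}" using D(2) cube_nonempty[of D] by (auto simp: homeomorphic_empty(2))
    then obtain x0 where x0: "x0 \<in> C" by blast
    then obtain A where A': "A \<in> \<A>" "x0 \<in> A" using A(3) by blast
    have "C \<subseteq> A"
    proof
      fix x assume x: "x \<in> C"
      have "sign_invariant (\<Union>(Q ` \<A>)) C" using \<C> C by (simp add: cell_decomposition_def)
      then have "\<forall>p\<in>Q A. sgn (p x) = sgn (p x0)"
        using x x0 A'(1) by (auto intro: sign_invariantD)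
      from QA[OF A'(1) this] show "x \<in> A" using A'(2) by simp
    qed
    moreover have "connected C" using D(2) convex_cube homeomorphic_connectedness convex_connected by blast
    ultimately obtain \<Xi> where del: "delineates b (f ` P) C \<Xi>"
      using A(4) A'(1) C'(1) by (meson delineableD)
    have C0: "x \<bullet> b = 0" if "x \<in> C" for x using C'(3) that b by (auto simp: flat_def)
    show ?thesis
    proof (rule cylinder_decomposition[OF b C0 C'(1) D(2,1) del F(2)])
      fix \<D> assume \<D>: "finite \<D>" "\<Union>\<D> = {z. drop_coord b z \<in> C}" "pairwise disjnt \<D>"
        "\<And>E. E \<in> \<D> \<Longrightarrow> E \<in> semialgebraic" "\<And>E. E \<in> \<D> \<Longrightarrow> \<exists>D\<subseteq>insert b B. E homeomorphic cube D"
        "\<And>E x. E \<in> \<D> \<Longrightarrow> x \<in> C \<Longrightarrow> \<exists>y. x + y *\<^sub>R b \<in> E"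
        "\<And>E f' z w. E \<in> \<D> \<Longrightarrow> f' \<in> f ` P \<Longrightarrow> z \<in> E \<Longrightarrow> w \<in> E \<Longrightarrow>
          sgn (poly (f' (drop_coord b z)) (z \<bullet> b)) = sgn (poly (f' (drop_coord b w)) (w \<bullet> b))"
      have "sign_invariant P E" if E: "E \<in> \<D>" for E
      proof (rule sign_invariantI)
        fix p z w assume p: "p \<in> P" and zw: "z \<in> E" "w \<in> E"
        show "sgn (p z) = sgn (p w)"
          using \<D>(7)[OF E imageI[OF p] zw] by (simp only: pf[OF p])
      qed
      then have "?R C \<D>" using \<D>(1-6) by simp
      then show ?thesis by blast
    qed
  qed
  then have "\<forall>C\<in>\<C>. \<exists>\<D>. ?R C \<D>" by blast
  then obtain \<D> where "\<forall>C\<in>\<C>. ?R C (\<D> C)" by (rule bchoice[elim_format]) blast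
  then show ?thesis using that[OF cell, of \<D>] by blast
qed

text \<open>Induction on the coordinates: the origin is the only cell for \<open>B = {}\<close>, and
  a further coordinate replaces every cell by the stack over it.\<close>

theorem cell_decomposition_exists:
  fixes B :: "'a::euclidean_space set"
  assumes "B \<subseteq> Basis" "finite P" "P \<subseteq> poly_fun"
  shows "\<exists>\<C>. cell_decomposition B P \<C>"
proof -
  have "finite B" using assms(1) finite_Basis finite_subset by blast
  then show ?thesis using assms
  proof (induction B arbitrary: P)
    case empty
    have "flat {} = {0::'a}" by (auto simp: flat_def euclidean_eq_iff[where 'a='a])
    moreover have "cube {} = {0::'a}" by (auto simp: cube_def euclidean_eq_iff[where 'a='a])
    moreover have "(\<lambda>x::'a. x \<bullet> x) \<in> poly_fun"
      by (rule poly_fun_inner) (auto intro: pf_coord)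
    then have "{x::'a. x \<bullet> x = 0} \<in> semialgebraic" by (rule semialgebraic_eq[OF _ pf_const])
    then have "{0::'a} \<in> semialgebraic" by simp
    ultimately have "cell_decomposition {} P {{0::'a}}"
      unfolding cell_decomposition_def
      by (intro conjI ballI exI[of _ "{}"]) (simp_all add: homeomorphic_refl sign_invariant_def)
    then show ?case by blast
  next
    case (insert b B)
    have b: "b \<in> Basis" "b \<notin> B" using insert by auto
    have base: "\<exists>\<C>. cell_decomposition B Q \<C>" if "finite Q" "Q \<subseteq> poly_fun" for Q
      using insert.IH insert.prems(1) that by simp
    obtain \<C> \<D> where \<C>: "cell_decomposition B {} \<C>"
      and \<D>: "\<And>C. C \<in> \<C> \<Longrightarrow> finite (\<D> C) \<and> \<Union>(\<D> C) = {z. drop_coord b z \<in> C} \<and> pairwise disjnt (\<D> C) \<and>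
      (\<forall>E\<in>\<D> C. E \<in> semialgebraic \<and> (\<exists>D\<subseteq>insert b B. E homeomorphic cube D) \<and>
        (\<forall>x\<in>C. \<exists>y. x + y *\<^sub>R b \<in> E) \<and> sign_invariant P E)"
      using cylindrical_decomposition[OF b insert.prems(2,3) base] by blast
    have "cell_decomposition (insert b B) P (\<Union>C\<in>\<C>. \<D> C)"
      unfolding cell_decomposition_def
    proof (intro conjI)
      show "finite (\<Union>C\<in>\<C>. \<D> C)" using \<C> \<D> by (auto simp: cell_decomposition_def)
      have "\<Union>(\<Union>C\<in>\<C>. \<D> C) = (\<Union>C\<in>\<C>. \<Union>(\<D> C))" by blast
      also have "\<dots> = (\<Union>C\<in>\<C>. {z. drop_coord b z \<in> C})" using \<D> by (intro SUP_cong) simp_all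
      also have "\<dots> = {z. drop_coord b z \<in> \<Union>\<C>}" by auto
      also have "\<dots> = flat (insert b B)" using \<C> flat_insert[OF b] by (simp add: cell_decomposition_def)
      finally show "\<Union>(\<Union>C\<in>\<C>. \<D> C) = flat (insert b B)" .
      show "pairwise disjnt (\<Union>C\<in>\<C>. \<D> C)"
        unfolding pairwise_def
      proof (intro ballI impI)
        fix E E' assume "E \<in> (\<Union>C\<in>\<C>. \<D> C)" "E' \<in> (\<Union>C\<in>\<C>. \<D> C)" and ne: "E \<noteq> E'"
        then obtain C C' where C: "C \<in> \<C>" "E \<in> \<D> C" "C' \<in> \<C>" "E' \<in> \<D> C'" by blast
        show "disjnt E E'"
        proof (cases "C = C'")
          case True
          then show ?thesis using \<D>[OF C(1)] C ne by (auto simp: pairwise_def)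
        next
          case False
          then have "disjnt C C'" using \<C> C by (auto simp: cell_decomposition_def pairwise_def)
          moreover have "E \<subseteq> {z. drop_coord b z \<in> C}" "E' \<subseteq> {z. drop_coord b z \<in> C'}"
            using \<D>[OF C(1)] \<D>[OF C(3)] Union_upper[OF C(2)] Union_upper[OF C(4)] by simp_all
          ultimately show ?thesis unfolding disjnt_def by blast
        qed
      qed
      show "\<forall>E\<in>(\<Union>C\<in>\<C>. \<D> C). E \<in> semialgebraic \<and> (\<exists>D\<subseteq>insert b B. E homeomorphic cube D) \<and> sign_invariant P E"
      proof
        fix E assume "E \<in> (\<Union>C\<in>\<C>. \<D> C)"
        then obtain C where "C \<in> \<C>" "E \<in> \<D> C" by blast
        then show "E \<in> semialgebraic \<and> (\<exists>D\<subseteq>insert b B. E homeomorphic cube D) \<and> sign_invariant P E"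
          using \<D>[OF \<open>C \<in> \<C>\<close>] by simp
      qed
    qed
    then show ?case by blast
  qed
qed

text \<open>Each cell of a stack maps onto its base cell and lies in \<open>S\<close> or misses it,
  so the base points below \<open>S\<close> form a union of base cells. The set in question is the
  whole cylinder over this union, because it is invariant under translation along
  \<open>b\<close>.\<close>

lemma semialgebraic_projection_basis:
  fixes b :: "'a::euclidean_space"
  assumes b: "b \<in> Basis" and S: "S \<in> semialgebraic"
  shows "{x. \<exists>t. x + t *\<^sub>R b \<in> S} \<in> semialgebraic"
proof -
  obtain P where P: "finite P" "P \<subseteq> poly_fun"
    "\<And>x y. (\<And>p. p \<in> P \<Longrightarrow> sgn (p x) = sgn (p y)) \<Longrightarrow> x \<in> S \<longleftrightarrow> y \<in> S"
    using semialgebraic_sign_determined[OF S] by blast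
  let ?B = "Basis - {b}"
  have base: "\<exists>\<C>. cell_decomposition ?B Q \<C>" if "finite Q" "Q \<subseteq> poly_fun" for Q :: "('a \<Rightarrow> real) set"
    using that by (intro cell_decomposition_exists) auto
  obtain \<C> \<D> where \<C>: "cell_decomposition ?B {} \<C>"
    and \<D>: "\<And>C. C \<in> \<C> \<Longrightarrow> finite (\<D> C) \<and> \<Union>(\<D> C) = {z. drop_coord b z \<in> C} \<and> pairwise disjnt (\<D> C) \<and>
      (\<forall>E\<in>\<D> C. E \<in> semialgebraic \<and> (\<exists>D\<subseteq>insert b ?B. E homeomorphic cube D) \<and>
        (\<forall>x\<in>C. \<exists>y. x + y *\<^sub>R b \<in> E) \<and> sign_invariant P E)"
    using cylindrical_decomposition[OF b _ P(1,2) base] by blast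
  define \<C>' where "\<C>' = {C\<in>\<C>. \<exists>x\<in>C. \<exists>t. x + t *\<^sub>R b \<in> S}"
  have flat: "flat ?B = {x. x \<bullet> b = 0}" using b by (auto simp: flat_def)
  have drop0: "drop_coord b z \<bullet> b = 0" for z using b by (simp add: drop_coord_def inner_diff_left)
  have all: "\<exists>t. x + t *\<^sub>R b \<in> S" if C: "C \<in> \<C>'" and x: "x \<in> C" for C x
  proof -
    obtain x0 t0 where x0: "C \<in> \<C>" "x0 \<in> C" "x0 + t0 *\<^sub>R b \<in> S" using C by (auto simp: \<C>'_def)
    have "x0 \<bullet> b = 0" using \<C> x0 flat by (auto simp: cell_decomposition_def)
    then have "drop_coord b (x0 + t0 *\<^sub>R b) = x0" using b by (simp add: drop_coord_def inner_add_left)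
    then have "x0 + t0 *\<^sub>R b \<in> \<Union>(\<D> C)" using \<D>[OF x0(1)] x0(2) by simp
    then obtain E where E: "E \<in> \<D> C" "x0 + t0 *\<^sub>R b \<in> E" by (rule UnionE)
    have *: "(\<forall>x\<in>C. \<exists>y. x + y *\<^sub>R b \<in> E) \<and> sign_invariant P E"
      using \<D>[OF x0(1)] E(1) by simp
    then obtain y where y: "x + y *\<^sub>R b \<in> E" using x by blast
    have "x + y *\<^sub>R b \<in> S \<longleftrightarrow> x0 + t0 *\<^sub>R b \<in> S"
      by (rule P(3)) (rule sign_invariantD[OF conjunct2[OF *] _ y E(2)])
    then show ?thesis using x0 by blast
  qed
  have "{x. \<exists>t. x + t *\<^sub>R b \<in> S} = {z. drop_coord b z \<in> \<Union>\<C>'}"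
  proof (intro set_eqI iffI)
    fix x assume "x \<in> {x. \<exists>t. x + t *\<^sub>R b \<in> S}"
    then obtain t where "x + t *\<^sub>R b \<in> S" by blast
    moreover have "x + t *\<^sub>R b = drop_coord b x + (t + x \<bullet> b) *\<^sub>R b"
      by (simp add: drop_coord_def algebra_simps)
    ultimately have t: "drop_coord b x + (t + x \<bullet> b) *\<^sub>R b \<in> S" by simp
    have "drop_coord b x \<in> \<Union>\<C>" using \<C> flat drop0 by (simp add: cell_decomposition_def)
    then obtain C where C: "C \<in> \<C>" "drop_coord b x \<in> C" by blast
    then have "C \<in> \<C>'" unfolding \<C>'_def using t by blast
    then show "x \<in> {z. drop_coord b z \<in> \<Union>\<C>'}" using C by blast
  next
    fix x assume "x \<in> {z. drop_coord b z \<in> \<Union>\<C>'}"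
    then obtain t where "drop_coord b x + t *\<^sub>R b \<in> S" using all by blast
    moreover have "drop_coord b x + t *\<^sub>R b = x + (t - x \<bullet> b) *\<^sub>R b"
      by (simp add: drop_coord_def algebra_simps)
    ultimately show "x \<in> {x. \<exists>t. x + t *\<^sub>R b \<in> S}" by (metis (mono_tags) mem_Collect_eq)
  qed
  moreover have "\<Union>\<C>' \<in> semialgebraic"
    using semialgebraic_Un_family[of \<C>' "\<lambda>C. C"] \<C> by (auto simp: cell_decomposition_def \<C>'_def)
  ultimately show ?thesis using semialgebraic_vimage_drop_coord by metis
qed

lemma semialgebraic_projection:
  fixes S :: "('a::euclidean_space \<times> 'b::euclidean_space) set"
  assumes S: "S \<in> semialgebraic"
  shows "{x. \<exists>y. (x, y) \<in> S} \<in> semialgebraic"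
proof -
  \<comment> \<open>Displacements in \<open>span K\<close> keep the statement inside the product
    space, so that each induction step eliminates one basis vector \<open>(0, c)\<close>.\<close>
  have "{w. \<exists>y\<in>span K. w + (0, y) \<in> S} \<in> semialgebraic" if "finite K" "K \<subseteq> Basis" for K :: "'b set"
    using that
  proof (induction K)
    case empty
    then show ?case using S by (simp add: zero_prod_def[symmetric])
  next
    case (insert c K)
    let ?T = "{w. \<exists>y\<in>span K. w + (0, y) \<in> S}"
    have "{x. \<exists>t. x + t *\<^sub>R (0, c) \<in> ?T} \<in> semialgebraic"
      using insert by (intro semialgebraic_projection_basis) (auto simp: Basis_prod_def)
    also have "{x. \<exists>t. x + t *\<^sub>R (0, c) \<in> ?T} = {w. \<exists>y\<in>span (insert c K). w + (0, y) \<in> S}"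
    proof (intro set_eqI iffI)
      fix x assume "x \<in> {x. \<exists>t. x + t *\<^sub>R (0, c) \<in> ?T}"
      then obtain t y where "y \<in> span K" "x + t *\<^sub>R (0, c) + (0, y) \<in> S" by blast
      moreover have "x + t *\<^sub>R (0, c) + (0, y) = x + (0, t *\<^sub>R c + y)" by (cases x) simp
      moreover have "t *\<^sub>R c + y \<in> span (insert c K)"
        using calculation(1) by (auto simp: span_breakdown_eq intro!: exI[of _ t])
      ultimately show "x \<in> {w. \<exists>y\<in>span (insert c K). w + (0, y) \<in> S}"
        by (intro CollectI bexI[of _ "t *\<^sub>R c + y"]) (simp_all only:)
    next
      fix x assume "x \<in> {w. \<exists>y\<in>span (insert c K). w + (0, y) \<in> S}"
      then obtain y where y: "y \<in> span (insert c K)" "x + (0, y) \<in> S" by blast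
      then obtain t where "y - t *\<^sub>R c \<in> span K" by (auto simp: span_breakdown_eq)
      moreover have "x + (0, y) = x + t *\<^sub>R (0, c) + (0, y - t *\<^sub>R c)" by (cases x) simp
      ultimately show "x \<in> {x. \<exists>t. x + t *\<^sub>R (0, c) \<in> ?T}" using y(2)
        by (intro CollectI exI[of _ t] bexI[of _ "y - t *\<^sub>R c"]) (simp_all only:)
    qed
    finally show ?case .
  qed
  from this[of Basis] have "{w. \<exists>y. w + (0, y) \<in> S} \<in> semialgebraic" by simp
  \<comment> \<open>The slice with second component \<open>0\<close> brings the set back to the
    first factor.\<close>
  then have "(\<lambda>x. (x, 0)) -` {w. \<exists>y. w + (0, y) \<in> S} \<in> semialgebraic"
    by (rule semialgebraic_vimage) (auto simp: Basis_prod_def intro: poly_fun_inner_const pf_const)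
  then show ?thesis by (simp add: vimage_def)
qed

section \<open>Max filtering for semialgebraic groups\<close>

lemma open_cube_eq_cube: "open_cube J = cube ((\<lambda>i. axis i (1::real)) ` J)"
  by (auto simp: open_cube_def cube_def Basis_vec_def inner_axis axis_eq_axis image_iff)

lemma subset_Basis_vec:
  fixes D :: "(real^'n) set"
  assumes "D \<subseteq> Basis"
  shows "D = (\<lambda>i. axis i 1) ` {i. axis i 1 \<in> D}"
  using assms by (auto simp: Basis_vec_def)

text \<open>By sign invariance the cells contained in \<open>S\<close> cover it. A cell modelled on
  the full cube would be nonempty and, by invariance of domain, open, against the empty interior; so
  every model cube misses a coordinate.\<close>

lemma sa_dim_le_interior_empty:
  fixes S :: "(real^'n::finite) set"
  assumes "S \<in> semialgebraic" "interior S = {}"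
  shows "sa_dim_le S (int CARD('n) - 1)"
proof -
  obtain P where P: "finite P" "P \<subseteq> poly_fun"
    and PS: "\<And>x y. (\<And>p. p \<in> P \<Longrightarrow> sgn (p x) = sgn (p y)) \<Longrightarrow> x \<in> S \<longleftrightarrow> y \<in> S"
    using semialgebraic_sign_determined[OF assms(1)] by blast
  obtain \<C> where cd: "cell_decomposition Basis P \<C>"
    using cell_decomposition_exists[OF order_refl P] by blast
  have \<C>: "finite \<C>" "\<Union>\<C> = UNIV" "pairwise disjnt \<C>"
    "\<And>C. C \<in> \<C> \<Longrightarrow> C \<in> semialgebraic \<and> (\<exists>D\<subseteq>Basis. C homeomorphic cube (D :: (real^'n) set)) \<and> sign_invariant P C"
    using cd by (simp_all add: cell_decomposition_def flat_def)
  show ?thesis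
    unfolding sa_dim_le_def
  proof (intro exI[of _ "{C\<in>\<C>. C \<subseteq> S}"] conjI ballI)
    show "finite {C\<in>\<C>. C \<subseteq> S}" using \<C>(1) by simp
    show "\<Union>{C\<in>\<C>. C \<subseteq> S} = S"
    proof
      show "S \<subseteq> \<Union>{C\<in>\<C>. C \<subseteq> S}"
      proof
        fix x assume x: "x \<in> S"
        obtain C where C: "C \<in> \<C>" "x \<in> C" using \<C>(2) by blast
        have "C \<subseteq> S"
        proof
          fix y assume y: "y \<in> C"
          have "x \<in> S \<longleftrightarrow> y \<in> S"
            by (rule PS) (rule sign_invariantD[OF conjunct2[OF conjunct2[OF \<C>(4)[OF C(1)]]] _ C(2) y])
          then show "y \<in> S" using x by simp
        qed
        then show "x \<in> \<Union>{C\<in>\<C>. C \<subseteq> S}" using C by blast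
      qed
    qed blast
    show "pairwise disjnt {C\<in>\<C>. C \<subseteq> S}" using \<C>(3) by (auto simp: pairwise_def)
    fix C assume "C \<in> {C\<in>\<C>. C \<subseteq> S}"
    then have C: "C \<in> \<C>" "C \<subseteq> S" by auto
    show "C \<in> semialgebraic" using \<C>(4)[OF C(1)] by (rule conjunct1)
    obtain D :: "(real^'n) set" where D: "D \<subseteq> Basis" "C homeomorphic cube D"
      using \<C>(4)[OF C(1)] by (elim conjE exE)
    define J where "J = {i. axis i (1::real) \<in> D}"
    have hom: "C homeomorphic open_cube J"
      using D(2) subset_Basis_vec[OF D(1)] by (simp add: open_cube_eq_cube J_def)
    have "J \<noteq> UNIV"
    proof
      assume J: "J = UNIV"
      have "open_cube (UNIV :: 'n set) = (\<Inter>i. {x. 0 < x $ i} \<inter> {x. x $ i < 1})"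
        by (auto simp: open_cube_def)
      also have "open \<dots>" by (intro open_INT finite ballI open_Int open_halfspace_component_gt_cart open_halfspace_component_lt_cart)
      finally have op: "open (open_cube (UNIV :: 'n set))" .
      obtain f g where fg: "homeomorphism (open_cube (UNIV :: 'n set)) C f g"
        using hom J by (metis homeomorphic_def homeomorphism_symD)
      have "open (f ` open_cube (UNIV :: 'n set))"
        using fg op by (intro invariance_of_domain) (auto simp: homeomorphism_def intro: inj_on_inverseI)
      then have "open C" using fg by (simp add: homeomorphism_def)
      then have "C = {}" using C(2) assms(2) interior_maximal by blast
      then have "cube D = {}" using D(2) by (simp add: homeomorphic_empty)
      then show False using cube_nonempty by blast
    qed
    then have "card J < CARD('n)" by (intro psubset_card_mono) auto
    then show "\<exists>J::'n set. C homeomorphic open_cube J \<and> int (card J) \<le> int CARD('n) - 1"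
      using hom by (intro exI[of _ J]) auto
  qed
qed

section \<open>Finite unions of locally closed sets\<close>

definition constructible :: "'a::topological_space set \<Rightarrow> bool" where
  "constructible S \<longleftrightarrow> (\<exists>\<L>. finite \<L> \<and> S = \<Union>\<L> \<and> (\<forall>L\<in>\<L>. \<exists>U F. open U \<and> closed F \<and> L = U \<inter> F))"

lemma constructible_locally_closed: "open U \<Longrightarrow> closed F \<Longrightarrow> constructible (U \<inter> F)"
  unfolding constructible_def by (rule exI[of _ "{U \<inter> F}"]) auto

lemma constructible_Un: "constructible S \<Longrightarrow> constructible T \<Longrightarrow> constructible (S \<union> T)"
  unfolding constructible_def
  by (elim exE conjE, rename_tac \<L> \<M>, rule_tac x="\<L> \<union> \<M>" in exI) auto

lemma constructible_Int:
  assumes "constructible S" "constructible T"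
  shows "constructible (S \<inter> T)"
proof -
  obtain \<L> \<M> where L: "finite \<L>" "S = \<Union>\<L>" "\<forall>L\<in>\<L>. \<exists>U F. open U \<and> closed F \<and> L = U \<inter> F"
    and M: "finite \<M>" "T = \<Union>\<M>" "\<forall>L\<in>\<M>. \<exists>U F. open U \<and> closed F \<and> L = U \<inter> F"
    using assms unfolding constructible_def by blast
  have "\<exists>U F. open U \<and> closed F \<and> L \<inter> M = U \<inter> F" if LM: "L \<in> \<L>" "M \<in> \<M>" for L M
  proof -
    obtain U F where "open U" "closed F" "L = U \<inter> F" using bspec[OF L(3) LM(1)] by (elim exE conjE)
    moreover obtain U' F' where "open U'" "closed F'" "M = U' \<inter> F'"
      using bspec[OF M(3) LM(2)] by (elim exE conjE)
    ultimately show ?thesis by (intro exI[of _ "U \<inter> U'"] exI[of _ "F \<inter> F'"]) auto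
  qed
  then show ?thesis
    unfolding constructible_def
    by (intro exI[of _ "(\<lambda>LM. fst LM \<inter> snd LM) ` (\<L> \<times> \<M>)"] conjI ballI)
      (use L(1) M(1) in simp, unfold L(2) M(2), fastforce, clarsimp)
qed

text \<open>The complement of \<open>U \<inter> F\<close> is the union of a closed and an open set;
  De Morgan's laws reduce the rest to finite intersections.\<close>

lemma constructible_Compl:
  assumes "constructible S" shows "constructible (- S)"
proof -
  obtain \<L> where L: "finite \<L>" "S = \<Union>\<L>" "\<forall>L\<in>\<L>. \<exists>U F. open U \<and> closed F \<and> L = U \<inter> F"
    using assms unfolding constructible_def by blast
  have "constructible (- \<Union>\<L>)" using L(1,3)
  proof (induction \<L>)
    case empty
    then show ?case using constructible_locally_closed[OF open_UNIV closed_UNIV] by simp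
  next
    case (insert L \<L>)
    then obtain U F where "open U" "closed F" "L = U \<inter> F" by auto
    then have "constructible (- L)"
      using constructible_Un[OF constructible_locally_closed[of UNIV "- U"] constructible_locally_closed[of "- F" UNIV]]
      by (simp add: open_Compl closed_Compl)
    then have "constructible (- L \<inter> - \<Union>\<L>)" using insert by (intro constructible_Int) auto
    then show ?case by simp
  qed
  then show ?thesis using L(2) by simp
qed

lemma constructible_semialgebraic: "S \<in> semialgebraic \<Longrightarrow> constructible S"
proof (induction rule: semialgebraic.induct)
  case (sa_basic p)
  have "closed {x. p x \<ge> 0}"
    using continuous_on_poly_fun[OF sa_basic continuous_on_id]
    by (intro closed_Collect_le continuous_on_const) simp
  then show ?case using constructible_locally_closed[OF open_UNIV] by simp
qed (auto intro: constructible_Un constructible_Int constructible_Compl)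

text \<open>Induction on the locally closed parts. Either the other parts have a point off the
  closure of \<open>L\<close>, near which \<open>L\<close> is invisible; or \<open>L\<close> is
  dense in the union inside the open set considered, and a locally closed set is relatively open in
  its closure.\<close>

lemma constructible_open_in_closure:
  fixes S :: "'a::metric_space set"
  assumes "constructible S" "S \<noteq> {}"
  obtains u e where "u \<in> S" "e > 0" "ball u e \<inter> closure S \<subseteq> S"
proof -
  obtain \<L> where L: "finite \<L>" "S = \<Union>\<L>" "\<forall>L\<in>\<L>. \<exists>U F. open U \<and> closed F \<and> L = U \<inter> F"
    using assms unfolding constructible_def by blast
  \<comment> \<open>Localised to an open set \<open>V\<close>, so that the induction hypothesis can
    be applied away from the closure of \<open>L\<close>.\<close>
  have "\<exists>u\<in>V. u \<in> \<Union>\<L> \<and> (\<exists>e>0. ball u e \<inter> closure (\<Union>\<L>) \<subseteq> \<Union>\<L>)" if "open V" "V \<inter> \<Union>\<L> \<noteq> {}" for V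
    using L(1,3) that
  proof (induction \<L> arbitrary: V)
    case empty
    then show ?case by simp
  next
    case (insert L \<L>)
    obtain U F where UF: "open U" "closed F" "L = U \<inter> F" using insert.prems(1) by auto
    show ?case
    proof (cases "V \<inter> \<Union>\<L> \<subseteq> closure L")
      case False
      have "\<exists>u\<in>V - closure L. u \<in> \<Union>\<L> \<and> (\<exists>e>0. ball u e \<inter> closure (\<Union>\<L>) \<subseteq> \<Union>\<L>)"
        using insert.prems False by (intro insert.IH) auto
      then obtain u e where u: "u \<in> V" "u \<notin> closure L" "u \<in> \<Union>\<L>" "e > 0" "ball u e \<inter> closure (\<Union>\<L>) \<subseteq> \<Union>\<L>" by blast
      have "open (- closure L)" "u \<in> - closure L" using u by auto
      then obtain d where d: "d > 0" "ball u d \<subseteq> - closure L" using open_contains_ball by metis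
      have "ball u (min d e) \<inter> closure (\<Union>(insert L \<L>)) \<subseteq> \<Union>(insert L \<L>)"
        using u d by (auto simp: closure_Un subset_iff)
      then show ?thesis using u d by (intro bexI[of _ u] conjI exI[of _ "min d e"]) auto
    next
      case True
      have "L \<subseteq> closure L" by (rule closure_subset)
      then have VS: "V \<inter> \<Union>(insert L \<L>) \<subseteq> closure L" using True by auto
      then have "V \<inter> closure L \<noteq> {}" using insert.prems(3) by blast
      then have "V \<inter> L \<noteq> {}" using open_Int_closure_eq_empty[OF insert.prems(2)] by blast
      then obtain u where u: "u \<in> V" "u \<in> L" by blast
      have "open (V \<inter> U)" "u \<in> V \<inter> U" using insert.prems(2) UF u by auto
      then obtain e where e: "e > 0" "ball u e \<subseteq> V \<inter> U" using open_contains_ball by metis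
      have "V \<inter> closure (\<Union>(insert L \<L>)) \<subseteq> closure (V \<inter> \<Union>(insert L \<L>))"
        by (rule open_Int_closure_subset[OF insert.prems(2)])
      also have "\<dots> \<subseteq> closure L" using VS closure_mono closure_closure by metis
      also have "\<dots> \<subseteq> F" using UF by (intro closure_minimal) auto
      finally have "ball u e \<inter> closure (\<Union>(insert L \<L>)) \<subseteq> L" using e(2) UF(3) by blast
      then show ?thesis using u e by (intro bexI[of _ u]) auto
    qed
  qed
  from this[of UNIV] show ?thesis using that assms(2) L(2) by auto
qed

section \<open>Closedness and compactness of the group and its orbits\<close>

lemma tendsto_matrix_matrix_mult:
  fixes A :: "'a \<Rightarrow> real^'n^'m" and B :: "'a \<Rightarrow> real^'k^'n"
  assumes "(A \<longlongrightarrow> a) F" "(B \<longlongrightarrow> b) F"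
  shows "((\<lambda>x. A x ** B x) \<longlongrightarrow> a ** b) F"
  unfolding matrix_matrix_mult_def
  by (intro tendsto_vec_lambda tendsto_sum tendsto_mult tendsto_vec_nth assms)

lemma tendsto_transpose:
  fixes A :: "'a \<Rightarrow> real^'n^'m"
  assumes "(A \<longlongrightarrow> a) F"
  shows "((\<lambda>x. transpose (A x)) \<longlongrightarrow> transpose a) F"
  unfolding transpose_def by (intro tendsto_vec_lambda tendsto_vec_nth assms)

lemma matrix_inv_orthogonal:
  fixes g :: "real^'n^'n"
  assumes "orthogonal_matrix g"
  shows "matrix_inv g = transpose g"
proof -
  have "\<exists>A. g ** A = mat 1 \<and> A ** g = mat 1" using assms by (auto simp: orthogonal_matrix_def)
  then have "g ** matrix_inv g = mat 1 \<and> matrix_inv g ** g = mat 1"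
    unfolding matrix_inv_def by (rule someI_ex)
  then show ?thesis using assms unfolding orthogonal_matrix_def
    by (metis matrix_mul_assoc matrix_mul_lid matrix_mul_rid)
qed

locale semialgebraic_group =
  fixes G :: "(real^'d^'d::finite) set"
  assumes G: "semialg_orth_subgroup G"
begin

lemma orth: "g \<in> G \<Longrightarrow> orthogonal_matrix g" and one: "mat 1 \<in> G"
  and mult: "g \<in> G \<Longrightarrow> h \<in> G \<Longrightarrow> g ** h \<in> G" and semialg: "G \<in> semialgebraic"
  using G by (auto simp: semialg_orth_subgroup_def)

lemma transpose_mem: "g \<in> G \<Longrightarrow> transpose g \<in> G"
  using G matrix_inv_orthogonal[OF orth] by (metis semialg_orth_subgroup_def)

text \<open>The usual argument for topological groups: near \<open>u\<close> the closure of
  \<open>G\<close> is contained in \<open>G\<close>, and translations carry this to every point of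
  the closure.\<close>

lemma closed_G: "closed G"
proof -
  obtain u e where u: "u \<in> G" "e > 0" "ball u e \<inter> closure G \<subseteq> G"
    using constructible_open_in_closure[OF constructible_semialgebraic[OF semialg]] one by blast
  have "g \<in> G" if g: "g \<in> closure G" for g
  proof -
    obtain h where h: "\<And>n::nat. h n \<in> G" "h \<longlonglongrightarrow> g" using g[unfolded closure_sequential] by blast
    have "(\<lambda>n. transpose (h n) ** h n) \<longlonglongrightarrow> transpose g ** g"
      by (intro tendsto_matrix_matrix_mult tendsto_transpose h)
    moreover have "(\<lambda>n. transpose (h n) ** h n) = (\<lambda>n. mat 1)"
      using orth h(1) by (auto simp: orthogonal_matrix_def)
    ultimately have g1: "transpose g ** g = mat 1" using LIMSEQ_unique tendsto_const by metis
    \<comment> \<open>Multiplication by the transpose of \<open>h n\<close> moves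
      \<open>g ** u\<close> close to \<open>u\<close>; the product still lies in the closure of
      \<open>G\<close>, as is shown below by approximating \<open>g\<close>.\<close>
    have "(\<lambda>n. transpose (h n) ** g ** u) \<longlonglongrightarrow> transpose g ** g ** u"
      by (intro tendsto_matrix_matrix_mult tendsto_transpose h tendsto_const)
    then have "(\<lambda>n. transpose (h n) ** g ** u) \<longlonglongrightarrow> u" by (simp add: g1)
    then have "\<forall>\<^sub>F n in sequentially. transpose (h n) ** g ** u \<in> ball u e"
      by (rule topological_tendstoD) (use u(2) in auto)
    then obtain n where n: "transpose (h n) ** g ** u \<in> ball u e" by (auto simp: eventually_sequentially)
    have "(\<lambda>m. transpose (h n) ** h m ** u) \<longlonglongrightarrow> transpose (h n) ** g ** u"
      by (intro tendsto_matrix_matrix_mult h tendsto_const)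
    moreover have "transpose (h n) ** h m ** u \<in> G" for m
      by (intro mult transpose_mem h u)
    ultimately have "transpose (h n) ** g ** u \<in> closure G"
      unfolding closure_sequential by (intro exI[of _ "\<lambda>m. transpose (h n) ** h m ** u"]) simp
    then have "transpose (h n) ** g ** u \<in> G" using n u(3) by blast
    \<comment> \<open>Undoing both translations recovers \<open>g\<close>.\<close>
    from mult[OF mult[OF h(1) this] transpose_mem[OF u(1)]]
    have "h n ** (transpose (h n) ** g ** u) ** transpose u \<in> G" .
    moreover have "h n ** (transpose (h n) ** g ** u) ** transpose u = (h n ** transpose (h n)) ** g ** (u ** transpose u)"
      by (simp only: matrix_mul_assoc)
    moreover have "h n ** transpose (h n) = mat 1" "u ** transpose u = mat 1"
      using orth[OF h(1)] orth[OF u(1)] by (simp_all add: orthogonal_matrix_def)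
    ultimately show "g \<in> G" by (simp only: matrix_mul_lid matrix_mul_rid)
  qed
  then show ?thesis using closure_subset by (metis closure_closed closed_closure subset_antisym subsetI)
qed

lemma inner_G: "g \<in> G \<Longrightarrow> (g *v x) \<bullet> y = x \<bullet> (transpose g *v y)"
  by (metis dot_lmul_matrix inner_commute vector_transpose_matrix)

lemma transpose_mult_vec: "g \<in> G \<Longrightarrow> transpose g *v (g *v x) = x"
  using orth[of g] by (simp add: orthogonal_matrix_def matrix_vector_mul_assoc)

lemma norm_G: "g \<in> G \<Longrightarrow> norm (g *v x) = norm x"
  by (simp only: norm_eq_sqrt_inner inner_G transpose_mult_vec)

text \<open>The rows of an orthogonal matrix are unit vectors, which bounds its norm.\<close>

lemma compact_G: "compact G"
proof -
  have "norm g \<le> CARD('d)" if g: "g \<in> G" for g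
  proof -
    have "norm (row i g) = 1" for i using orth[OF g] by (simp add: orthogonal_matrix_orthonormal_rows)
    then have "norm (g $ i) = 1" for i by (simp add: row_def vec_nth_inverse)
    moreover have "norm g \<le> (\<Sum>i\<in>UNIV. norm (g $ i))" unfolding norm_vec_def by (rule L2_set_le_sum) simp
    ultimately show ?thesis by simp
  qed
  then show ?thesis using closed_G by (auto simp: compact_eq_bounded_closed bounded_iff)
qed

lemma self_in_orbit: "x \<in> orbit G x"
  unfolding orbit_def by (rule image_eqI[OF _ one]) simp

lemma norm_orbit: "p \<in> orbit G x \<Longrightarrow> norm p = norm x"
  by (auto simp: orbit_def norm_G)

lemma orbit_sym_trans:
  assumes "p \<in> orbit G x" "q \<in> orbit G x"
  shows "\<exists>g\<in>G. q = g *v p"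
proof -
  obtain g h where gh: "g \<in> G" "p = g *v x" "h \<in> G" "q = h *v x" using assms by (auto simp: orbit_def)
  then have "q = (h ** transpose g) *v p"
    by (simp only: matrix_vector_mul_assoc[symmetric] transpose_mult_vec)
  then show ?thesis using gh mult transpose_mem by blast
qed

lemma orbit_eq_if_meets:
  assumes "p \<in> orbit G x" "p \<in> orbit G y"
  shows "orbit G x = orbit G y"
proof -
  have "orbit G x \<subseteq> orbit G y" if p: "p \<in> orbit G x" "p \<in> orbit G y" for x y
  proof
    fix q assume "q \<in> orbit G x"
    then obtain g where g: "g \<in> G" "q = g *v p" using orbit_sym_trans p by blast
    obtain h where h: "h \<in> G" "p = h *v y" using p by (auto simp: orbit_def)
    have "q = (g ** h) *v y" using g h by (simp add: matrix_vector_mul_assoc)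
    then show "q \<in> orbit G y" unfolding orbit_def using mult[OF g(1) h(1)] by blast
  qed
  then show ?thesis using assms by blast
qed

lemma orbit_scaleR: "p \<in> orbit G x \<Longrightarrow> c *\<^sub>R p \<in> orbit G (c *\<^sub>R x)"
  by (auto simp: orbit_def matrix_vector_mult_scaleR)

lemma compact_orbit: "compact (orbit G x)"
proof -
  have "continuous_on G (\<lambda>g. g *v x)"
    unfolding matrix_vector_mult_def by (intro continuous_intros)
  then show ?thesis unfolding orbit_def by (intro compact_continuous_image compact_G)
qed

section \<open>The max filter as a maximum over one orbit\<close>

lemma max_filter_bdd: "bdd_above ((\<lambda>pq. fst pq \<bullet> snd pq) ` (orbit G z \<times> orbit G x))"
proof (rule bdd_aboveI2)
  fix pq assume "pq \<in> orbit G z \<times> orbit G x"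
  then show "fst pq \<bullet> snd pq \<le> norm z * norm x"
    using norm_cauchy_schwarz[of "fst pq" "snd pq"] norm_orbit[of "fst pq" z] norm_orbit[of "snd pq" x] by auto
qed

lemma max_filter_ge: "p \<in> orbit G z \<Longrightarrow> q \<in> orbit G x \<Longrightarrow> p \<bullet> q \<le> max_filter G z x"
  unfolding max_filter_def using cSUP_upper[OF _ max_filter_bdd, of "(p, q)"] by simp

lemma max_filter_inner_ge: "q \<in> orbit G x \<Longrightarrow> z \<bullet> q \<le> max_filter G z x"
  by (rule max_filter_ge[OF self_in_orbit])

text \<open>Moving \<open>g\<close> to the other side of the inner product replaces a pair of orbit
  points by \<open>z\<close> and a point of the orbit of \<open>x\<close>. A linear function attains
  its maximum on this compact orbit.\<close>

lemma max_filter_attained: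
  obtains q where "q \<in> orbit G x" "max_filter G z x = z \<bullet> q"
proof -
  obtain q where q: "q \<in> orbit G x" "\<And>p. p \<in> orbit G x \<Longrightarrow> z \<bullet> p \<le> z \<bullet> q"
    using continuous_attains_sup[OF compact_orbit _ continuous_on_inner[OF continuous_on_const continuous_on_id], of x z]
      self_in_orbit[of x] by blast
  have "max_filter G z x \<le> z \<bullet> q"
    unfolding max_filter_def
  proof (rule cSUP_least)
    show "orbit G z \<times> orbit G x \<noteq> {}" using self_in_orbit by blast
    fix pq assume "pq \<in> orbit G z \<times> orbit G x"
    then obtain g h where g: "g \<in> G" "fst pq = g *v z" and h: "h \<in> G" "snd pq = h *v x"
      by (auto simp: orbit_def)
    have "fst pq \<bullet> snd pq = z \<bullet> ((transpose g ** h) *v x)"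
      using g h by (simp only: inner_G matrix_vector_mul_assoc)
    also have "\<dots> \<le> z \<bullet> q" by (rule q(2)) (auto simp: orbit_def intro: mult transpose_mem g h)
    finally show "fst pq \<bullet> snd pq \<le> z \<bullet> q" .
  qed
  moreover have "z \<bullet> q \<le> max_filter G z x" by (rule max_filter_inner_ge[OF q(1)])
  ultimately show ?thesis using that q(1) by (simp add: order_antisym)
qed

text \<open>Two maxima are compared by quantifiers over \<open>G\<close> and a polynomial inequality
  alone, which is the form that projections can eliminate.\<close>

lemma max_filter_le_iff:
  "max_filter G z x \<le> max_filter G z y \<longleftrightarrow> (\<forall>g\<in>G. \<exists>h\<in>G. z \<bullet> (g *v x) \<le> z \<bullet> (h *v y))"
proof
  assume *: "max_filter G z x \<le> max_filter G z y"
  obtain q where "q \<in> orbit G y" "max_filter G z y = z \<bullet> q" by (rule max_filter_attained)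
  then obtain h where h: "h \<in> G" "max_filter G z y = z \<bullet> (h *v y)" by (auto simp: orbit_def)
  have "z \<bullet> (g *v x) \<le> z \<bullet> (h *v y)" if "g \<in> G" for g
    using max_filter_inner_ge[of "g *v x" x z] * h that by (auto simp: orbit_def)
  then show "\<forall>g\<in>G. \<exists>h\<in>G. z \<bullet> (g *v x) \<le> z \<bullet> (h *v y)" using h(1) by blast
next
  assume *: "\<forall>g\<in>G. \<exists>h\<in>G. z \<bullet> (g *v x) \<le> z \<bullet> (h *v y)"
  obtain q where "q \<in> orbit G x" "max_filter G z x = z \<bullet> q" by (rule max_filter_attained)
  then obtain g where g: "g \<in> G" "max_filter G z x = z \<bullet> (g *v x)" by (auto simp: orbit_def)
  then obtain h where "h \<in> G" "z \<bullet> (g *v x) \<le> z \<bullet> (h *v y)" using * by blast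
  then show "max_filter G z x \<le> max_filter G z y"
    using g max_filter_inner_ge[of "h *v y" y z] by (auto simp: orbit_def)
qed

text \<open>Two projections remove the quantifiers of \<open>max_filter_le_iff\<close>: the first
  removes \<open>h\<close>, the second removes \<open>g\<close> after the universal quantifier has
  become an existential one on the complement.\<close>

lemma semialgebraic_max_filter_le:
  "{z. max_filter G z x \<le> max_filter G z y} \<in> semialgebraic"
proof -
  have nth: "(\<lambda>w. f w $ i) \<in> poly_fun" if "\<And>c. (\<lambda>w. f w \<bullet> c) \<in> poly_fun" for f :: "'a::euclidean_space \<Rightarrow> real^'d" and i
    using that[of "axis i 1"] by (simp add: inner_axis)
  have nth2: "(\<lambda>w. f w $ i $ j) \<in> poly_fun" if "\<And>c. (\<lambda>w. f w \<bullet> c) \<in> poly_fun"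
    for f :: "'a::euclidean_space \<Rightarrow> real^'d^'d" and i j
    using that[of "axis i (axis j 1)"] by (simp add: inner_axis)
  have mv: "(\<lambda>w. f w \<bullet> (g w *v x)) \<in> poly_fun"
    if "\<And>c. (\<lambda>w. f w \<bullet> c) \<in> poly_fun" "\<And>c. (\<lambda>w. g w \<bullet> c) \<in> poly_fun"
    for f :: "'a::euclidean_space \<Rightarrow> real^'d" and g :: "'a \<Rightarrow> real^'d^'d" and x
    unfolding inner_vec_def matrix_vector_mult_def inner_real_def vec_lambda_beta
    by (intro poly_fun_sum pf_mult nth nth2 that pf_const)
  let ?z = "\<lambda>w::((real^'d) \<times> (real^'d^'d)) \<times> (real^'d^'d). fst (fst w)"
  let ?g = "\<lambda>w::((real^'d) \<times> (real^'d^'d)) \<times> (real^'d^'d). snd (fst w)"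
  let ?h = "\<lambda>w::((real^'d) \<times> (real^'d^'d)) \<times> (real^'d^'d). snd w"
  have z: "(\<lambda>w. ?z w \<bullet> c) \<in> poly_fun" for c
    using poly_fun_inner_const[of "((c, 0), 0)"] by (simp add: inner_prod_def)
  have g: "(\<lambda>w. ?g w \<bullet> c) \<in> poly_fun" for c
    using poly_fun_inner_const[of "((0, c), 0)"] by (simp add: inner_prod_def)
  have h: "(\<lambda>w. ?h w \<bullet> c) \<in> poly_fun" for c
    using poly_fun_inner_const[of "(0, c)"] by (simp add: inner_prod_def)
  have g': "(\<lambda>w::(real^'d) \<times> (real^'d^'d). snd w \<bullet> c) \<in> poly_fun" for c
    using poly_fun_inner_const[of "(0, c)"] by (simp add: inner_prod_def)
  have "{w. ?z w \<bullet> (?g w *v x) \<le> ?z w \<bullet> (?h w *v y)} \<in> semialgebraic"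
    by (intro semialgebraic_le mv z g h)
  moreover have "?h -` G \<in> semialgebraic" by (rule semialgebraic_vimage[OF semialg h])
  ultimately have "{w. ?h w \<in> G \<and> ?z w \<bullet> (?g w *v x) \<le> ?z w \<bullet> (?h w *v y)} \<in> semialgebraic"
    using sa_inter by (fastforce simp: vimage_def Collect_conj_eq)
  from semialgebraic_projection[OF this]
  have 1: "{v. \<exists>h. h \<in> G \<and> fst v \<bullet> (snd v *v x) \<le> fst v \<bullet> (h *v y)} \<in> semialgebraic" by simp
  have 2: "{v :: (real^'d) \<times> (real^'d^'d). snd v \<in> G} \<in> semialgebraic"
    unfolding vimage_def[symmetric] by (rule semialgebraic_vimage[OF semialg g'])
  have "{v. snd v \<in> G \<and> \<not> (\<exists>h\<in>G. fst v \<bullet> (snd v *v x) \<le> fst v \<bullet> (h *v y))} =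
    {v. snd v \<in> G} \<inter> - {v. \<exists>h. h \<in> G \<and> fst v \<bullet> (snd v *v x) \<le> fst v \<bullet> (h *v y)}" by auto
  also have "\<dots> \<in> semialgebraic" by (intro sa_inter sa_compl 1 2)
  finally have "- {z. \<exists>g. (z, g) \<in> {v. snd v \<in> G \<and> \<not> (\<exists>h\<in>G. fst v \<bullet> (snd v *v x) \<le> fst v \<bullet> (h *v y))}} \<in> semialgebraic"
    by (intro sa_compl semialgebraic_projection)
  also have "- {z. \<exists>g. (z, g) \<in> {v. snd v \<in> G \<and> \<not> (\<exists>h\<in>G. fst v \<bullet> (snd v *v x) \<le> fst v \<bullet> (h *v y))}} =
    {z. max_filter G z x \<le> max_filter G z y}"
    by (auto simp: max_filter_le_iff)
  finally show ?thesis .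
qed

lemma semialgebraic_max_filter_eq:
  "{z. max_filter G z x = max_filter G z y} \<in> semialgebraic"
proof -
  have "{z. max_filter G z x = max_filter G z y} =
    {z. max_filter G z x \<le> max_filter G z y} \<inter> {z. max_filter G z y \<le> max_filter G z x}" by auto
  then show ?thesis by (simp only: sa_inter[OF semialgebraic_max_filter_le semialgebraic_max_filter_le])
qed

text \<open>The quadratic growth keeps the maximisers at points near \<open>w\<close> close to \<open>p\<close>.\<close>

definition sharp :: "real^'d \<Rightarrow> real^'d \<Rightarrow> real \<Rightarrow> real^'d \<Rightarrow> bool" where
  "sharp x w t p \<longleftrightarrow> t > 0 \<and> p \<in> orbit G x \<and> max_filter G w x = w \<bullet> p \<and>
     (\<forall>q\<in>orbit G x. w \<bullet> q \<le> w \<bullet> p - t / 2 * (norm (p - q))\<^sup>2)"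

text \<open>Points of one orbit have equal norms, so \<open>p \<bullet> q\<close> is
  \<open>p \<bullet> p\<close> minus half of the squared distance of \<open>p\<close> and
  \<open>q\<close>. Adding a multiple of a maximiser \<open>p\<close> to \<open>z\<close> thus
  penalises every other \<open>q\<close> quadratically.\<close>

lemma sharp_exists:
  assumes "e > 0"
  obtains w t p where "w \<in> ball z e" "sharp x w t p"
proof -
  obtain p where p: "p \<in> orbit G x" "max_filter G z x = z \<bullet> p" by (rule max_filter_attained)
  \<comment> \<open>Small enough for the norm of \<open>t *\<^sub>R p\<close> to stay below
    \<open>e\<close>; the summand \<open>1\<close> covers \<open>p = 0\<close>.\<close>
  define t where "t = e / (2 * (norm p + 1))"
  have t: "t > 0" using assms by (simp add: t_def add_nonneg_pos)
  define w where "w = z + t *\<^sub>R p"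
  have "norm (t *\<^sub>R p) = e * (norm p / (2 * (norm p + 1)))" using t assms by (simp add: t_def)
  also have "\<dots> < e * 1" using assms by (intro mult_strict_left_mono) (auto simp: divide_simps add_nonneg_pos)
  finally have w: "w \<in> ball z e" by (simp add: w_def dist_norm)
  have bound: "w \<bullet> q \<le> w \<bullet> p - t / 2 * (norm (p - q))\<^sup>2" if q: "q \<in> orbit G x" for q
  proof -
    have "norm p = norm q" using norm_orbit p q by metis
    then have "p \<bullet> p = q \<bullet> q" by (simp add: norm_eq)
    then have "(norm (p - q))\<^sup>2 = 2 * (p \<bullet> p) - 2 * (p \<bullet> q)"
      by (simp add: power2_norm_eq_inner inner_diff inner_commute)
    moreover have "z \<bullet> q \<le> z \<bullet> p" using max_filter_inner_ge[OF q, of z] p(2) by simp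
    moreover have "t * (p \<bullet> q) = t * (p \<bullet> p) - t / 2 * (2 * (p \<bullet> p) - 2 * (p \<bullet> q))"
      by (simp add: algebra_simps)
    ultimately show ?thesis by (simp only: w_def inner_add_left inner_scaleR_left)
  qed
  obtain q where q: "q \<in> orbit G x" "max_filter G w x = w \<bullet> q" by (rule max_filter_attained)
  have "max_filter G w x = w \<bullet> p"
    using bound[OF q(1)] q(2) max_filter_inner_ge[OF p(1), of w] t
    by (smt (verit) divide_pos_pos mult_nonneg_nonneg zero_le_power2)
  then have "sharp x w t p" using t p bound by (simp add: sharp_def)
  then show ?thesis using that w by blast
qed

text \<open>Optimality of \<open>q\<close> at \<open>z\<close> and the growth at \<open>w\<close>
  bound \<open>t / 2 * (norm (p - q))\<^sup>2\<close> by \<open>(w - z) \<bullet> (p - q)\<close>.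
  Cauchy-Schwarz then allows division by \<open>norm (p - q)\<close>.\<close>

lemma sharp_Lipschitz:
  assumes "sharp x w t p" "q \<in> orbit G x" "max_filter G z x = z \<bullet> q"
  shows "norm (p - q) \<le> 2 / t * norm (w - z)"
proof (cases "p = q")
  case True
  then show ?thesis using assms(1) by (simp add: sharp_def)
next
  case False
  have t: "t > 0" and p: "p \<in> orbit G x" "w \<bullet> q \<le> w \<bullet> p - t / 2 * (norm (p - q))\<^sup>2"
    using assms by (auto simp: sharp_def)
  have "z \<bullet> p \<le> z \<bullet> q" using max_filter_inner_ge[OF p(1), of z] assms(3) by simp
  then have "t / 2 * (norm (p - q))\<^sup>2 \<le> (w - z) \<bullet> (p - q)"
    using p(2) by (simp add: inner_diff algebra_simps)
  also have "\<dots> \<le> norm (w - z) * norm (p - q)" by (rule norm_cauchy_schwarz)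
  finally have "(t / 2 * norm (p - q)) * norm (p - q) \<le> norm (w - z) * norm (p - q)"
    by (simp add: power2_eq_square algebra_simps)
  then have "t / 2 * norm (p - q) \<le> norm (w - z)" using False by simp
  then show ?thesis using t by (simp add: field_simps)
qed

text \<open>From a sharp point \<open>w\<close> in the supposed ball, move along \<open>u\<close>,
  from the maximiser \<open>p\<close> of one orbit towards the maximiser \<open>q\<close> of the
  other. The filter of \<open>y\<close> gains at least \<open>s * (u \<bullet> q)\<close>, while
  quadratic growth keeps the gain of the filter of \<open>x\<close> smaller, so the two cannot
  agree.\<close>

lemma max_filter_eq_interior_empty:
  assumes "orbit G x \<noteq> orbit G y"
  shows "interior {z. max_filter G z x = max_filter G z y} = {}"
proof (rule ccontr)
  let ?Z = "{z. max_filter G z x = max_filter G z y}"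
  assume "interior ?Z \<noteq> {}"
  then obtain z0 where "z0 \<in> interior ?Z" by blast
  then obtain e where e: "e > 0" "ball z0 e \<subseteq> ?Z" using mem_interior by blast
  obtain w t p where w: "w \<in> ball z0 e" "sharp x w t p" using sharp_exists[OF e(1)] by blast
  have t: "t > 0" and p: "p \<in> orbit G x" "max_filter G w x = w \<bullet> p"
    "\<And>q. q \<in> orbit G x \<Longrightarrow> w \<bullet> q \<le> w \<bullet> p - t / 2 * (norm (p - q))\<^sup>2"
    using w(2) by (auto simp: sharp_def)
  obtain q where q: "q \<in> orbit G y" "max_filter G w y = w \<bullet> q" by (rule max_filter_attained)
  have wq: "w \<bullet> q = w \<bullet> p" using w(1) e(2) p(2) q(2) by auto
  define u where "u = q - p"
  have "u \<noteq> 0"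
  proof
    assume "u = 0"
    then have "p \<in> orbit G y" using q by (simp add: u_def)
    then show False using orbit_eq_if_meets[OF p(1)] assms by blast
  qed
  obtain d where d: "d > 0" "ball w d \<subseteq> ball z0 e" using w(1) open_contains_ball_eq[OF open_ball] by blast
  \<comment> \<open>The bound by \<open>t\<close> lets the growth term pay for the movement of the
    maximiser; the other bound keeps the new point in the ball.\<close>
  define s where "s = min t (d / (2 * norm u))"
  have s: "s > 0" "s \<le> t" "s * norm u < d" using t d \<open>u \<noteq> 0\<close>
    by (auto simp: s_def min_def field_simps split: if_splits)
  have "w + s *\<^sub>R u \<in> ball w d" using s by (simp add: dist_norm)
  then have eq: "max_filter G (w + s *\<^sub>R u) x = max_filter G (w + s *\<^sub>R u) y" using d e by blast
  obtain p' where p': "p' \<in> orbit G x" "max_filter G (w + s *\<^sub>R u) x = (w + s *\<^sub>R u) \<bullet> p'"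
    by (rule max_filter_attained)
  have "(w + s *\<^sub>R u) \<bullet> q \<le> (w + s *\<^sub>R u) \<bullet> p'"
    using max_filter_inner_ge[OF q(1), of "w + s *\<^sub>R u"] eq p'(2) by simp
  then have "s * (u \<bullet> q) \<le> s * (u \<bullet> p') - t / 2 * (norm (p - p'))\<^sup>2"
    using p(3)[OF p'(1)] wq by (simp add: inner_add_left)
  then have "s * (u \<bullet> u) \<le> s * (u \<bullet> (p' - p)) - t / 2 * (norm (p - p'))\<^sup>2"
    by (simp add: u_def inner_diff algebra_simps)
  also have "\<dots> \<le> s * (norm u * norm (p - p')) - s / 2 * (norm (p - p'))\<^sup>2"
  proof -
    have "u \<bullet> (p' - p) \<le> norm u * norm (p - p')"
      using norm_cauchy_schwarz[of u "p' - p"] by (simp add: norm_minus_commute)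
    moreover have "s / 2 * (norm (p - p'))\<^sup>2 \<le> t / 2 * (norm (p - p'))\<^sup>2"
      using s by (intro mult_right_mono) auto
    ultimately show ?thesis using s by (simp add: diff_mono)
  qed
  also have "\<dots> = s * (norm u * norm (p - p') - (norm (p - p'))\<^sup>2 / 2)" by (simp add: algebra_simps)
  finally have "u \<bullet> u \<le> norm u * norm (p - p') - (norm (p - p'))\<^sup>2 / 2"
    using s(1) by simp
  \<comment> \<open>This bound cancels the quadratic term in \<open>p - p'\<close> and leaves only
    half of \<open>(norm u)\<^sup>2\<close>, which is too small.\<close>
  moreover have "norm u * norm (p - p') \<le> (norm u)\<^sup>2 / 2 + (norm (p - p'))\<^sup>2 / 2"
    using sum_squares_bound[of "norm u" "norm (p - p')"] by simp
  ultimately have "(norm u)\<^sup>2 \<le> (norm u)\<^sup>2 / 2" by (simp add: power2_norm_eq_inner)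
  then show False using \<open>u \<noteq> 0\<close> by simp
qed

lemma strongly_separating_1: "strongly_separating G 1"
  unfolding strongly_separating_def
proof (intro allI impI)
  fix x y assume "orbit G x \<noteq> orbit G y"
  then show "sa_dim_le {z. max_filter G z x = max_filter G z y} (int CARD('d) - int 1)"
    using sa_dim_le_interior_empty[OF semialgebraic_max_filter_eq max_filter_eq_interior_empty] by simp
qed

text \<open>On a sphere equality in Cauchy-Schwarz is attained, so the filter is
  \<open>norm z * norm x\<close>. Distinct orbits have distinct norms, and only \<open>z = 0\<close>
  remains.\<close>

lemma strongly_separating_transitive:
  assumes sphere: "\<And>x. orbit G x = {y. norm y = norm x}"
  shows "strongly_separating G CARD('d)"
  unfolding strongly_separating_def
proof (intro allI impI)
  fix x y assume ne: "orbit G x \<noteq> orbit G y"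
  have mf: "max_filter G z x = norm z * norm x" for z x
  proof (cases "z = 0")
    case True
    obtain q where "max_filter G z x = z \<bullet> q" using max_filter_attained by blast
    then show ?thesis using True by simp
  next
    case False
    obtain q where q: "q \<in> orbit G x" "max_filter G z x = z \<bullet> q" by (rule max_filter_attained)
    have "z \<bullet> q \<le> norm z * norm x" using norm_cauchy_schwarz[of z q] norm_orbit[OF q(1)] by simp
    moreover have "z \<bullet> ((norm x / norm z) *\<^sub>R z) \<le> max_filter G z x"
      by (rule max_filter_inner_ge) (use False in \<open>simp add: sphere\<close>)
    moreover have "z \<bullet> ((norm x / norm z) *\<^sub>R z) = norm z * norm x"
      using False by (simp add: dot_square_norm power2_eq_square)
    ultimately show ?thesis using q(2) by simp
  qed
  have "norm x \<noteq> norm y" using ne sphere by auto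
  then have "{z. max_filter G z x = max_filter G z y} = {0}" by (auto simp: mf)
  moreover have "sa_dim_le {0::real^'d} 0"
    unfolding sa_dim_le_def
  proof (intro exI[of _ "{{0}}"] conjI ballI)
    fix C :: "(real^'d) set" assume C: "C \<in> {{0}}"
    have "(\<lambda>x::real^'d. x \<bullet> x) \<in> poly_fun" by (rule poly_fun_inner) (auto intro: pf_coord)
    from semialgebraic_eq[OF this pf_const[of 0]] show "C \<in> semialgebraic" using C by simp
    have "open_cube {} = {0::real^'d}" by (auto simp: open_cube_def vec_eq_iff)
    then show "\<exists>J::'d set. C homeomorphic open_cube J \<and> int (card J) \<le> 0"
      using C by (intro exI[of _ "{}"]) (auto simp: homeomorphic_refl)
  qed auto
  ultimately show "sa_dim_le {z. max_filter G z x = max_filter G z y} (int CARD('d) - int CARD('d))" by simp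
qed

end

section \<open>A lower bound for the dimension\<close>

text \<open>An open set, exhausted by compact ones, is intersected with a closed coordinate
  subspace.\<close>

lemma open_cube_sigma_compact:
  obtains K :: "nat \<Rightarrow> (real^'n::finite) set" where "\<And>k. compact (K k)" "(\<Union>k. K k) = open_cube J"
proof -
  define S :: "(real^'n) set" where "S = (\<Inter>i\<in>J. {x. 0 < x $ i} \<inter> {x. x $ i < 1})"
  define W :: "(real^'n) set" where "W = (\<Inter>i\<in>-J. {x. x $ i = 0})"
  have "open S" unfolding S_def
    by (intro open_INT finite ballI open_Int open_halfspace_component_gt_cart open_halfspace_component_lt_cart)
  then obtain C :: "nat \<Rightarrow> (real^'n) set" where C: "\<And>n. compact (C n)" "\<Union>(range C) = S"
    by (rule open_Union_compact_subsets) blast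
  have "closed W" unfolding W_def by (intro closed_INT ballI closed_Collect_eq continuous_intros)
  then have "compact (C n \<inter> W)" for n by (intro compact_Int_closed C)
  moreover have "(\<Union>n. C n \<inter> W) = S \<inter> W" using C(2) by blast
  moreover have "S \<inter> W = open_cube J" by (auto simp: S_def W_def open_cube_def)
  ultimately show ?thesis using that[of "\<lambda>n. C n \<inter> W"] by simp
qed

text \<open>Cells are broken into countably many compact pieces to prepare for Baire's theorem. Of
  each homeomorphism only an injective continuous map into a cube of small dimension is
  kept.\<close>

lemma sa_dim_le_compact_cover:
  fixes Z :: "(real^'n::finite) set"
  assumes "sa_dim_le Z m"
  obtains \<K> where "countable \<K>" "\<Union>\<K> = Z" "\<And>K. K \<in> \<K> \<Longrightarrow> compact K"
    "\<And>K. K \<in> \<K> \<Longrightarrow> \<exists>(J::'n set) k. int (card J) \<le> m \<and> continuous_on K k \<and> inj_on k K \<and> k ` K \<subseteq> open_cube J"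
proof -
  let ?Q = "\<lambda>K. compact K \<and> (\<exists>(J::'n set) k. int (card J) \<le> m \<and> continuous_on K k \<and> inj_on k K \<and> k ` K \<subseteq> open_cube J)"
  obtain P where P: "finite P" "\<Union>P = Z"
    and cells: "\<And>C. C \<in> P \<Longrightarrow> \<exists>J::'n set. C homeomorphic open_cube J \<and> int (card J) \<le> m"
    using assms unfolding sa_dim_le_def by blast
  have "\<exists>\<K>. countable \<K> \<and> \<Union>\<K> = C \<and> (\<forall>K\<in>\<K>. ?Q K)" if C: "C \<in> P" for C
  proof -
    obtain J :: "'n set" where J: "C homeomorphic open_cube J" "int (card J) \<le> m" using cells[OF C] by blast
    obtain k h where hk: "homeomorphism C (open_cube J) k h" using J(1) unfolding homeomorphic_def by blast
    obtain K :: "nat \<Rightarrow> (real^'n) set" where K: "\<And>n. compact (K n)" "(\<Union>n. K n) = open_cube J"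
      using open_cube_sigma_compact[where J=J] by blast
    have Kn: "K n \<subseteq> open_cube J" for n using K(2) by blast
    have hK: "h ` K n \<subseteq> C" for n using hk Kn[of n] by (auto simp: homeomorphism_def)
    have "?Q (h ` K n)" for n
    proof (intro conjI exI)
      show "compact (h ` K n)"
        using hk Kn[of n] by (intro compact_continuous_image K) (auto simp: homeomorphism_def intro: continuous_on_subset)
      show "continuous_on (h ` K n) k" using hk hK[of n] by (auto simp: homeomorphism_def intro: continuous_on_subset)
      show "inj_on k (h ` K n)"
        by (rule inj_on_inverseI[where g=h]) (use hk hK[of n] in \<open>auto simp: homeomorphism_def\<close>)
      show "k ` h ` K n \<subseteq> open_cube J" using hk hK[of n] by (auto simp: homeomorphism_def)
    qed (rule J)
    moreover have "(\<Union>n. h ` K n) = C"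
    proof -
      have "(\<Union>n. h ` K n) = h ` open_cube J" using K(2) by blast
      then show ?thesis using hk by (simp add: homeomorphism_def)
    qed
    ultimately show ?thesis by (intro exI[of _ "range (\<lambda>n. h ` K n)"]) auto
  qed
  then obtain \<K> where \<K>: "\<And>C. C \<in> P \<Longrightarrow> countable (\<K> C) \<and> \<Union>(\<K> C) = C \<and> (\<forall>K\<in>\<K> C. ?Q K)" by metis
  show ?thesis
  proof (rule that[of "\<Union>C\<in>P. \<K> C"])
    show "countable (\<Union>C\<in>P. \<K> C)" using \<K> by (intro countable_UN countable_finite[OF P(1)]) simp
    have "\<Union>(\<Union>C\<in>P. \<K> C) = (\<Union>C\<in>P. \<Union>(\<K> C))" by blast
    also have "\<dots> = (\<Union>C\<in>P. C)" by (intro SUP_cong) (use \<K> in auto)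
    finally show "\<Union>(\<Union>C\<in>P. \<K> C) = Z" using P(2) by simp
    have "?Q K" if "K \<in> (\<Union>C\<in>P. \<K> C)" for K
      using that by (rule UN_E) (drule \<K>, elim conjE, erule (1) bspec)
    then show "compact K" "\<exists>(J::'n set) k. int (card J) \<le> m \<and> continuous_on K k \<and> inj_on k K \<and> k ` K \<subseteq> open_cube J"
      if "K \<in> (\<Union>C\<in>P. \<K> C)" for K
      using that by simp_all
  qed
qed

text \<open>Otherwise all sets \<open>X - K\<close> would be open and dense in \<open>X\<close>, and
  by Baire's theorem so would be their intersection dense, although it is empty.\<close>

lemma Baire_compact_cover:
  fixes X :: "'a::{real_normed_vector,heine_borel} set"
  assumes "closed X" "X \<noteq> {}" "countable \<K>" "\<And>K. K \<in> \<K> \<Longrightarrow> closed K" "X \<subseteq> \<Union>\<K>"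
  obtains K u e where "K \<in> \<K>" "u \<in> X" "e > 0" "X \<inter> ball u e \<subseteq> K"
proof (rule ccontr)
  assume no: "\<not> thesis"
  note witness = that
  have dense: "X \<subseteq> closure (X - K)" if K: "K \<in> \<K>" for K
  proof
    fix u assume u: "u \<in> X"
    show "u \<in> closure (X - K)"
    proof (rule ccontr)
      assume "u \<notin> closure (X - K)"
      then obtain e where e: "e > 0" "ball u e \<subseteq> - closure (X - K)"
        using open_contains_ball[of "- closure (X - K)"] by auto
      have "X \<inter> ball u e \<subseteq> K" using e(2) closure_subset[of "X - K"] by blast
      then show False using witness[OF K u e(1)] no by blast
    qed
  qed
  have "X \<subseteq> closure (\<Inter>((\<lambda>K. X - K) ` \<K>))"
  proof (rule Baire[OF assms(1)])
    fix T assume "T \<in> (\<lambda>K. X - K) ` \<K>"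
    then obtain K where K: "K \<in> \<K>" "T = X - K" by blast
    have "openin (top_of_set X) (X \<inter> - K)" using assms(4)[OF K(1)] by (intro openin_open_Int) auto
    then show "openin (top_of_set X) T \<and> X \<subseteq> closure T" using dense K by (simp add: Diff_eq)
  qed (use assms(3) in simp)
  moreover have "\<Inter>((\<lambda>K. X - K) ` \<K>) = {}" using assms(2,5) by blast
  ultimately show False using assms(2) by simp
qed

text \<open>The zero set contains the graph of a continuous function over a ball in the hyperplane
  orthogonal to \<open>v\<close>. Cells being \<open>\<sigma>\<close>-compact, by Baire's theorem one of the cells would contain a
  piece of that graph, which is excluded by invariance of dimension.\<close>

lemma monotone_zero_set_not_sa_dim_le:
  fixes f :: "real^'n::finite \<Rightarrow> real"
  assumes r: "r > 0" and cont: "continuous_on (ball w r) f" and w: "f w = 0" and v: "v \<noteq> 0"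
    and inc: "\<And>z t. t > 0 \<Longrightarrow> z \<in> ball w r \<Longrightarrow> z + t *\<^sub>R v \<in> ball w r \<Longrightarrow> f z < f (z + t *\<^sub>R v)"
    and Z: "\<And>z. z \<in> ball w r \<Longrightarrow> f z = 0 \<Longrightarrow> z \<in> Z"
  shows "\<not> sa_dim_le Z (int CARD('n) - 2)"
proof
  assume "sa_dim_le Z (int CARD('n) - 2)"
  then obtain \<K> where \<K>: "countable \<K>" "\<Union>\<K> = Z" "\<And>K. K \<in> \<K> \<Longrightarrow> compact K"
    "\<And>K. K \<in> \<K> \<Longrightarrow> \<exists>(J::'n set) k. int (card J) \<le> int CARD('n) - 2 \<and> continuous_on K k \<and> inj_on k K \<and> k ` K \<subseteq> open_cube J"
    by (rule sa_dim_le_compact_cover) blast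
  define V where "V = {u. v \<bullet> u = 0}"
  have V: "subspace V" "dim V = CARD('n) - 1" "closed V"
    using v unfolding V_def by (auto simp: subspace_hyperplane dim_hyperplane closed_hyperplane)
  \<comment> \<open>With this value the points \<open>w - a *\<^sub>R v\<close> and
    \<open>w + a *\<^sub>R v\<close> lie halfway to the boundary of the ball.\<close>
  define a where "a = r / (2 * norm v)"
  have a: "a > 0" "a * norm v = r / 2" using r v by (auto simp: a_def)
  have wa: "w - a *\<^sub>R v \<in> ball w r" "w + a *\<^sub>R v \<in> ball w r" using a r by (simp_all add: dist_norm)
  have neg: "f (w - a *\<^sub>R v) < 0" using inc[OF a(1) wa(1)] r w by simp
  have pos: "f (w + a *\<^sub>R v) > 0" using inc[OF a(1) _ wa(2)] r w by simp
  have "open (ball w r \<inter> f -` {..<0})" "open (ball w r \<inter> f -` {0<..})"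
    using cont by (auto intro!: continuous_open_preimage)
  then obtain d1 d2 where d: "d1 > 0" "ball (w - a *\<^sub>R v) d1 \<subseteq> ball w r \<inter> f -` {..<0}"
    "d2 > 0" "ball (w + a *\<^sub>R v) d2 \<subseteq> ball w r \<inter> f -` {0<..}"
    using wa neg pos open_contains_ball_eq[of "ball w r \<inter> f -` {..<0}"] open_contains_ball_eq[of "ball w r \<inter> f -` {0<..}"]
    by (metis (no_types, lifting) IntI greaterThan_iff lessThan_iff vimageI2)
  \<comment> \<open>Displacements of norm at most \<open>\<rho>\<close> keep \<open>f\<close>
    negative at the lower and positive at the upper end of each segment, and keep the cylinder
    \<open>T\<close> inside the ball.\<close>
  define \<rho> where "\<rho> = min (min d1 d2) (r / 2) / 2"
  have \<rho>: "\<rho> > 0" "\<rho> < d1" "\<rho> < d2" "\<rho> < r / 2" using d r by (auto simp: \<rho>_def)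
  define X where "X = V \<inter> cball 0 \<rho>"
  define pt where "pt = (\<lambda>(u, t). w + u + t *\<^sub>R v)"
  define T where "T = pt ` (X \<times> {-a..a})"
  define M where "M = T \<inter> f -` {0}"
  have X: "closed X" "compact X" "0 \<in> X" using V(1,3) \<rho> subspace_0 by (auto simp: X_def compact_Int_closed Int_commute)
  have "compact T" unfolding T_def
    by (intro compact_continuous_image compact_Times X) (auto simp: pt_def case_prod_beta intro!: continuous_intros)
  have Tball: "T \<subseteq> ball w r"
  proof
    fix z assume "z \<in> T"
    then obtain u t where ut: "z = w + u + t *\<^sub>R v" "norm u \<le> \<rho>" "\<bar>t\<bar> \<le> a" by (auto simp: T_def pt_def X_def)
    have "norm (u + t *\<^sub>R v) \<le> norm u + \<bar>t\<bar> * norm v" using norm_triangle_ineq[of u "t *\<^sub>R v"] by simp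
    also have "\<dots> \<le> \<rho> + a * norm v" using ut by (intro add_mono mult_right_mono) auto
    also have "\<dots> < r" using a \<rho> by simp
    finally have "norm (z - w) < r" using ut(1) by (simp add: add.assoc)
    then show "z \<in> ball w r" by (simp add: dist_norm norm_minus_commute)
  qed
  have M: "compact M" unfolding M_def
  proof -
    have "closed (T \<inter> f -` {0})"
      using \<open>compact T\<close> cont Tball
      by (intro continuous_closed_preimage compact_imp_closed) (auto intro: continuous_on_subset)
    then show "compact (T \<inter> f -` {0})" using \<open>compact T\<close> by (metis Int_lower1 compact_Int_closed Int_absorb1)
  qed
  \<comment> \<open>The orthogonal projection of \<open>z - w\<close> to \<open>V\<close>. On
    \<open>M\<close> it is injective because \<open>f\<close> increases strictly along
    \<open>v\<close>, and its image contains \<open>X\<close> by the intermediate value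
    theorem.\<close>
  define \<pi> where "\<pi> z = (z - w) - (((z - w) \<bullet> v) / (v \<bullet> v)) *\<^sub>R v" for z
  have \<pi>: "\<pi> (w + u + t *\<^sub>R v) = u" if "u \<in> V" for u t
    using that v by (simp add: \<pi>_def V_def inner_add_left inner_commute algebra_simps)
  have \<pi>cont: "continuous_on S \<pi>" for S unfolding \<pi>_def by (intro continuous_intros) (use v in auto)
  have inj: "inj_on \<pi> M"
  proof (rule inj_onI)
    fix z z' assume z: "z \<in> M" "z' \<in> M" "\<pi> z = \<pi> z'"
    obtain u t where 1: "z = w + u + t *\<^sub>R v" "u \<in> V" using z(1) by (auto simp: M_def T_def pt_def X_def)
    obtain u' t' where 2: "z' = w + u' + t' *\<^sub>R v" "u' \<in> V" using z(2) by (auto simp: M_def T_def pt_def X_def)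
    have "u = u'" using \<pi>[OF 1(2)] \<pi>[OF 2(2)] z(3) 1(1) 2(1) by simp
    then have zz: "z' = z + (t' - t) *\<^sub>R v" "z = z' + (t - t') *\<^sub>R v" using 1 2 by (simp_all add: algebra_simps)
    have b: "z \<in> ball w r" "z' \<in> ball w r" "f z = 0" "f z' = 0" using z Tball by (auto simp: M_def)
    have "\<not> t < t'" using inc[of "t' - t" z] zz(1) b by auto
    moreover have "\<not> t' < t" using inc[of "t - t'" z'] zz(2) b by auto
    ultimately show "z = z'" using zz by simp
  qed
  have XM: "X \<subseteq> \<pi> ` M"
  proof
    fix u assume u: "u \<in> X"
    then have uV: "u \<in> V" "norm u \<le> \<rho>" by (auto simp: X_def)
    have sub: "(\<lambda>t. w + u + t *\<^sub>R v) ` {-a..a} \<subseteq> T" using u by (auto simp: T_def pt_def image_iff)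
    have "w + u + (-a) *\<^sub>R v \<in> ball (w - a *\<^sub>R v) d1" "w + u + a *\<^sub>R v \<in> ball (w + a *\<^sub>R v) d2"
      using uV \<rho> by (simp_all add: dist_norm)
    then have "w + u + (-a) *\<^sub>R v \<in> f -` {..<0}" "w + u + a *\<^sub>R v \<in> f -` {0<..}"
      using d(2,4) by blast+
    then have "f (w + u + (-a) *\<^sub>R v) \<le> 0" "0 \<le> f (w + u + a *\<^sub>R v)"
      by (simp_all only: vimage_eq lessThan_iff greaterThan_iff less_imp_le)
    moreover have "continuous_on {-a..a} (\<lambda>t. f (w + u + t *\<^sub>R v))"
      by (rule continuous_on_compose2[OF cont]) (use sub Tball in \<open>auto intro!: continuous_intros\<close>)
    ultimately obtain t where t: "-a \<le> t" "t \<le> a" "f (w + u + t *\<^sub>R v) = 0"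
      using IVT'[of "\<lambda>t. f (w + u + t *\<^sub>R v)" "-a" 0 a] a by auto
    have "w + u + t *\<^sub>R v \<in> T" using t(1,2) by (intro subsetD[OF sub] imageI) simp
    then have "w + u + t *\<^sub>R v \<in> M" unfolding M_def using t(3) by simp
    then show "u \<in> \<pi> ` M" using \<pi>[OF uV(1), of t] by (metis imageI)
  qed
  have cover: "X \<subseteq> \<Union>((\<lambda>K. \<pi> ` (M \<inter> K)) ` \<K>)"
  proof
    fix u assume "u \<in> X"
    then obtain z where z: "z \<in> M" "u = \<pi> z" using XM by blast
    then have "z \<in> Z" using Z Tball by (auto simp: M_def)
    then obtain K where "K \<in> \<K>" "z \<in> K" using \<K>(2) by blast
    then show "u \<in> \<Union>((\<lambda>K. \<pi> ` (M \<inter> K)) ` \<K>)" using z by blast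
  qed
  have MK: "compact (M \<inter> K)" if "K \<in> \<K>" for K using M \<K>(3)[OF that] by (intro compact_Int)
  have "closed Y" if "Y \<in> (\<lambda>K. \<pi> ` (M \<inter> K)) ` \<K>" for Y
    using that by (auto intro!: compact_imp_closed compact_continuous_image \<pi>cont MK)
  moreover have "X \<noteq> {}" "countable ((\<lambda>K. \<pi> ` (M \<inter> K)) ` \<K>)" using X(3) \<K>(1) by auto
  ultimately obtain Y u0 e where Y: "Y \<in> (\<lambda>K. \<pi> ` (M \<inter> K)) ` \<K>" "u0 \<in> X" "e > 0" "X \<inter> ball u0 e \<subseteq> Y"
    using Baire_compact_cover[OF X(1) _ _ _ cover] by metis
  obtain K where K: "K \<in> \<K>" "Y = \<pi> ` (M \<inter> K)" using Y(1) by (rule imageE)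
  note K = K(1) Y(4)[unfolded K(2)]
  obtain J :: "'n set" and k where Jk: "int (card J) \<le> int CARD('n) - 2" "continuous_on K k" "inj_on k K" "k ` K \<subseteq> open_cube J"
    using \<K>(4)[OF K(1)] by blast
  \<comment> \<open>The ball around the origin is open here, unlike the one defining
    \<open>X\<close>, so that \<open>\<O>\<close> is open in \<open>V\<close>.\<close>
  define \<O> where "\<O> = V \<inter> (ball u0 e \<inter> ball 0 \<rho>)"
  have OX: "\<O> \<subseteq> X \<inter> ball u0 e" by (auto simp: \<O>_def X_def)
  then have OK: "\<O> \<subseteq> \<pi> ` (M \<inter> K)" using K(2) by blast
  have "\<O> \<noteq> {}"
  proof -
    \<comment> \<open>The point \<open>u0\<close> may lie on the boundary of \<open>X\<close>; a
      slight shrinking brings it into the open ball.\<close>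
    define \<eta> where "\<eta> = min (1/2) (e / (2 * \<rho>))"
    have \<eta>: "\<eta> > 0" "\<eta> < 1" "\<eta> * \<rho> < e" using Y(3) \<rho>(1) by (auto simp: \<eta>_def min_def field_simps)
    have u0: "u0 \<in> V" "norm u0 \<le> \<rho>" using Y(2) by (auto simp: X_def)
    have "(1 - \<eta>) * norm u0 \<le> (1 - \<eta>) * \<rho>" using u0 \<eta> by (intro mult_left_mono) auto
    also have "\<dots> < 1 * \<rho>" using \<eta> \<rho> by (intro mult_strict_right_mono) auto
    finally have 1: "(1 - \<eta>) *\<^sub>R u0 \<in> ball 0 \<rho>" using \<eta> by simp
    have "\<eta> * norm u0 \<le> \<eta> * \<rho>" using u0 \<eta> by (intro mult_left_mono) auto
    then have "\<eta> * norm u0 < e" using \<eta>(3) by linarith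
    then have "(1 - \<eta>) *\<^sub>R u0 \<in> ball u0 e" using \<eta>(1) by (simp add: dist_norm scaleR_left_diff_distrib)
    moreover have "(1 - \<eta>) *\<^sub>R u0 \<in> V" using u0 V(1) subspace_scale by blast
    ultimately show ?thesis using 1 by (auto simp: \<O>_def)
  qed
  \<comment> \<open>The graph map, continuous on \<open>\<O>\<close> as the inverse of a continuous
    injection on a compact set.\<close>
  define \<sigma> where "\<sigma> = the_inv_into (M \<inter> K) \<pi>"
  have injMK: "inj_on \<pi> (M \<inter> K)" using inj inj_on_subset by blast
  have \<sigma>cont: "continuous_on \<O> \<sigma>"
  proof -
    have "continuous_on (\<pi> ` (M \<inter> K)) \<sigma>"
      by (rule continuous_on_inv[OF \<pi>cont MK[OF K(1)]]) (simp add: \<sigma>_def the_inv_into_f_f[OF injMK])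
    then show ?thesis using OK continuous_on_subset by blast
  qed
  have \<sigma>K: "\<sigma> ` \<O> \<subseteq> K"
    using OK the_inv_into_into[OF injMK _ order_refl] unfolding \<sigma>_def by blast
  have \<sigma>inj: "inj_on \<sigma> \<O>"
    using OK inj_on_the_inv_into[OF injMK] unfolding \<sigma>_def by (metis inj_on_subset)
  \<comment> \<open>The coordinate subspace that carries \<open>open_cube J\<close>. An injective
    continuous map into it from an open part of \<open>V\<close> contradicts invariance of
    dimension.\<close>
  define W :: "(real^'n) set" where "W = {x. \<forall>i\<in>Basis. i \<notin> (\<lambda>i. axis i 1) ` J \<longrightarrow> x \<bullet> i = 0}"
  have "subspace W" unfolding W_def by (auto simp: subspace_def inner_add_left)
  have "dim W = card ((\<lambda>i. axis i (1::real)) ` J)" unfolding W_def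
    by (rule dim_substandard) (auto simp: Basis_vec_def)
  also have "\<dots> \<le> card J" by (rule card_image_le) simp
  finally have dimW: "dim W \<le> card J" .
  have "open_cube J \<subseteq> W" by (auto simp: open_cube_def W_def Basis_vec_def inner_axis image_iff axis_eq_axis)
  have "dim V \<le> dim W"
  proof (rule invariance_of_dimension_subspaces[of V \<O> W "k \<circ> \<sigma>"])
    show "openin (top_of_set V) \<O>" unfolding \<O>_def by (intro openin_open_Int open_Int open_ball)
    show "continuous_on \<O> (k \<circ> \<sigma>)"
      by (intro continuous_on_compose \<sigma>cont continuous_on_subset[OF Jk(2) \<sigma>K])
    show "k \<circ> \<sigma> \<in> \<O> \<rightarrow> W" using \<sigma>K Jk(4) \<open>open_cube J \<subseteq> W\<close> by (force simp: image_subset_iff)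
    show "inj_on (k \<circ> \<sigma>) \<O>" by (intro comp_inj_on \<sigma>inj inj_on_subset[OF Jk(3) \<sigma>K])
  qed fact+
  then show False using V(2) dimW Jk(1) by linarith
qed

section \<open>Groups whose orbits are not the spheres\<close>

context semialgebraic_group
begin

lemma max_filter_diff_le: "max_filter G z x - max_filter G z' x \<le> norm (z - z') * norm x"
proof -
  obtain q where q: "q \<in> orbit G x" "max_filter G z x = z \<bullet> q" by (rule max_filter_attained)
  have "max_filter G z x - max_filter G z' x \<le> (z - z') \<bullet> q"
    using q max_filter_inner_ge[OF q(1), of z'] by (simp add: inner_diff_left)
  also have "\<dots> \<le> norm (z - z') * norm x" using norm_cauchy_schwarz[of "z - z'" q] norm_orbit[OF q(1)] by simp
  finally show ?thesis .
qed

lemma continuous_max_filter: "continuous_on S (\<lambda>z. max_filter G z x)"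
proof (rule lipschitz_on_continuous_on[of "norm x"], rule lipschitz_onI)
  show "dist (max_filter G z x) (max_filter G z' x) \<le> norm x * dist z z'" for z z'
    using max_filter_diff_le[of z x z'] max_filter_diff_le[of z' x z]
    by (simp add: dist_norm abs_le_iff norm_minus_commute mult.commute)
qed simp

lemma max_filter_scaleR:
  assumes "s \<ge> 0"
  shows "max_filter G z (s *\<^sub>R y) = s * max_filter G z y"
proof (rule antisym)
  obtain q where q: "q \<in> orbit G y" "max_filter G z y = z \<bullet> q" by (rule max_filter_attained)
  then show "s * max_filter G z y \<le> max_filter G z (s *\<^sub>R y)"
    using max_filter_inner_ge[OF orbit_scaleR[OF q(1)], of z s] by simp
  obtain p where p: "p \<in> orbit G (s *\<^sub>R y)" "max_filter G z (s *\<^sub>R y) = z \<bullet> p" by (rule max_filter_attained)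
  then obtain g where "g \<in> G" "p = s *\<^sub>R (g *v y)" by (auto simp: orbit_def matrix_vector_mult_scaleR)
  moreover then have "z \<bullet> (g *v y) \<le> max_filter G z y"
    by (intro max_filter_inner_ge) (auto simp: orbit_def)
  ultimately show "max_filter G z (s *\<^sub>R y) \<le> s * max_filter G z y"
    using p(2) assms by (simp add: mult_left_mono)
qed

text \<open>If unit vectors at an acute angle always shared their orbit, so would any two unit
  vectors: through the normalised midpoint when they are not antipodal, and otherwise through a
  vector orthogonal to both, which exists in dimension at least two. Scaling then makes every sphere
  an orbit.\<close>

lemma unit_vectors_with_distinct_orbits:
  assumes "\<not> (\<forall>x. orbit G x = {y. norm y = norm x})" "CARD('d) \<ge> 2"
  obtains x y where "norm x = 1" "norm y = 1" "x \<bullet> y > 0" "orbit G x \<noteq> orbit G y"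
proof (rule ccontr)
  assume "\<not> thesis"
  then have *: "orbit G x = orbit G y" if "norm x = 1" "norm y = 1" "x \<bullet> y > 0" for x y
    using that \<open>\<And>x y. norm x = 1 \<Longrightarrow> norm y = 1 \<Longrightarrow> 0 < x \<bullet> y \<Longrightarrow> orbit G x \<noteq> orbit G y \<Longrightarrow> thesis\<close> by blast
  have **: "orbit G x = orbit G y" if xy: "norm x = 1" "norm y = 1" "x + y \<noteq> 0" for x y
  proof -
    define m where "m = (1 / norm (x + y)) *\<^sub>R (x + y)"
    have "norm m = 1" using xy by (simp add: m_def)
    have xx: "x \<bullet> x = 1" "y \<bullet> y = 1" using xy by (simp_all add: dot_square_norm)
    have "(x + y) \<bullet> (x + y) > 0" using xy(3) by simp
    then have "1 + x \<bullet> y > 0" using xx by (simp add: inner_add inner_commute)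
    then have "x \<bullet> m > 0" "m \<bullet> y > 0" using xx xy(3)
      by (simp_all add: m_def inner_add inner_commute add.commute)
    then show ?thesis using *[OF xy(1) \<open>norm m = 1\<close>] *[OF \<open>norm m = 1\<close> xy(2)] by simp
  qed
  have unit: "orbit G x = orbit G y" if xy: "norm x = 1" "norm y = 1" for x y
  proof (cases "x + y = 0")
    case False
    then show ?thesis using ** xy by blast
  next
    case True
    obtain u where u: "u \<noteq> 0" "orthogonal x u" using orthogonal_to_vector_exists[of x] assms(2) by auto
    define u' where "u' = (1 / norm u) *\<^sub>R u"
    have u': "norm u' = 1" "x \<bullet> u' = 0" using u by (auto simp: u'_def orthogonal_def)
    have y: "y = - x" using True by (simp add: add_eq_0_iff)
    have xx: "x \<bullet> x = 1" using xy by (simp add: dot_square_norm)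
    have "x + u' \<noteq> 0" "u' + y \<noteq> 0" using u' xx y by (auto simp: add_eq_0_iff)
    then show ?thesis using **[OF xy(1) u'(1)] **[OF u'(1) xy(2)] by simp
  qed
  have "orbit G x = {y. norm y = norm x}" for x
  proof
    show "orbit G x \<subseteq> {y. norm y = norm x}" using norm_orbit by blast
    show "{y. norm y = norm x} \<subseteq> orbit G x"
    proof
      fix y :: "real^'d" assume "y \<in> {y. norm y = norm x}"
      then have y: "norm y = norm x" by simp
      show "y \<in> orbit G x"
      proof (cases "x = 0")
        case True
        then show ?thesis using y self_in_orbit[of x] by simp
      next
        case False
        then have "y \<noteq> 0" using y by auto
        then have "orbit G ((1 / norm x) *\<^sub>R x) = orbit G ((1 / norm x) *\<^sub>R y)"
          using False y by (intro unit) auto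
        then have "(1 / norm x) *\<^sub>R y \<in> orbit G ((1 / norm x) *\<^sub>R x)" using self_in_orbit by blast
        from orbit_scaleR[OF this, of "norm x"] show ?thesis using False by simp
      qed
    qed
  qed
  then show False using assms(1) by blast
qed

text \<open>The number \<open>m\<close> is the largest cosine between the two orbits; completing the
  square in \<open>s\<close> bounds the distance below by the sine. As \<open>c\<close> does not
  depend on \<open>p\<close>, \<open>q\<close> and \<open>s\<close>, a tolerance can be fixed before
  these are chosen.\<close>

lemma unit_cone_distance:
  assumes "norm x = 1" "norm y = 1" "x \<bullet> y > 0" "orbit G x \<noteq> orbit G y"
  obtains c where "c > 0" "\<And>p q s. p \<in> orbit G x \<Longrightarrow> q \<in> orbit G y \<Longrightarrow> s \<ge> 0 \<Longrightarrow> c \<le> norm (p - s *\<^sub>R q)"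
proof -
  define m where "m = max_filter G x y"
  obtain q where q: "q \<in> orbit G y" "m = x \<bullet> q" unfolding m_def by (rule max_filter_attained)
  have nq: "norm q = 1" using norm_orbit[OF q(1)] assms by simp
  have "m \<le> 1" using norm_cauchy_schwarz[of x q] assms nq q(2) by simp
  \<comment> \<open>Equality in Cauchy-Schwarz would give a common point of the two orbits.\<close>
  moreover have "m \<noteq> 1"
  proof
    assume "m = 1"
    moreover have "(norm (x - q))\<^sup>2 = (norm x)\<^sup>2 - 2 * (x \<bullet> q) + (norm q)\<^sup>2"
      by (simp add: power2_norm_eq_inner inner_diff inner_commute)
    ultimately have "x = q" using q(2) assms(1) nq by simp
    then show False using orbit_eq_if_meets[OF self_in_orbit] q(1) assms(4) by blast
  qed
  moreover have "m > 0" using assms(3) max_filter_inner_ge[OF self_in_orbit, of x y] by (simp add: m_def)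
  ultimately have m: "0 < m" "m < 1" by auto
  have bound: "sqrt (1 - m\<^sup>2) \<le> norm (p - s *\<^sub>R q)" if pq: "p \<in> orbit G x" "q \<in> orbit G y" "s \<ge> 0" for p q s
  proof -
    have n: "p \<bullet> p = 1" "q \<bullet> q = 1" using norm_orbit[OF pq(1)] norm_orbit[OF pq(2)] assms by (simp_all add: dot_square_norm)
    have "p \<bullet> q \<le> m" unfolding m_def by (rule max_filter_ge[OF pq(1,2)])
    then have "s * (p \<bullet> q) \<le> s * m" using pq(3) by (rule mult_left_mono)
    moreover have "(norm (p - s *\<^sub>R q))\<^sup>2 = 1 - 2 * (s * (p \<bullet> q)) + s\<^sup>2"
      unfolding power2_norm_eq_inner using n by (simp add: inner_diff inner_commute power2_eq_square)
    moreover have "(s - m)\<^sup>2 = s\<^sup>2 - 2 * (s * m) + m\<^sup>2" by (simp add: power2_diff)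
    moreover have "(s - m)\<^sup>2 \<ge> 0" by simp
    ultimately have "1 - m\<^sup>2 \<le> (norm (p - s *\<^sub>R q))\<^sup>2" by linarith
    then show ?thesis by (rule real_le_lsqrt[rotated]) simp
  qed
  have "m\<^sup>2 < 1" using m by (simp add: abs_square_less_1)
  then show ?thesis using bound by (intro that[of "sqrt (1 - m\<^sup>2)"]) auto
qed

text \<open>A sharp point \<open>w1\<close> for \<open>x\<close> is fixed first, then a nearby sharp
  point \<open>w\<close> for \<open>y\<close>, and only then the factor \<open>s\<close>. Near
  \<open>w\<close> the maximisers for both orbits stay close to \<open>p\<close> and
  \<open>q\<close>, so the difference of the filters increases along
  \<open>p - s *\<^sub>R q\<close>.\<close>

lemma not_strongly_separating_2:
  assumes "\<not> (\<forall>x. orbit G x = {y. norm y = norm x})"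
  shows "\<not> strongly_separating G 2"
proof (cases "CARD('d) \<ge> 2")
  case False
  \<comment> \<open>In dimension one the bound is \<open>-1\<close>, which only the empty set
    satisfies, whereas \<open>0\<close> always belongs to the set.\<close>
  then have card: "CARD('d) = 1" using zero_less_card_finite[where 'a='d] by linarith
  obtain x y where y: "norm y = norm x" "y \<notin> orbit G x" using assms norm_orbit by blast
  then have ne: "orbit G x \<noteq> orbit G y" using self_in_orbit by blast
  have "max_filter G 0 x = max_filter G 0 y"
    using max_filter_attained[of x 0] max_filter_attained[of y 0] by (metis inner_zero_left)
  then have "0 \<in> {z. max_filter G z x = max_filter G z y}" by simp
  then have "\<not> sa_dim_le {z. max_filter G z x = max_filter G z y} (int CARD('d) - int 2)"
    unfolding sa_dim_le_def using card by fastforce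
  then show ?thesis using ne unfolding strongly_separating_def by blast
next
  case True
  obtain x y where x: "norm x = 1" and y: "norm y = 1" and xy: "x \<bullet> y > 0" and ne: "orbit G x \<noteq> orbit G y"
    using unit_vectors_with_distinct_orbits[OF assms True] by blast
  obtain c where c: "c > 0" "\<And>p q s. p \<in> orbit G x \<Longrightarrow> q \<in> orbit G y \<Longrightarrow> s \<ge> 0 \<Longrightarrow> c \<le> norm (p - s *\<^sub>R q)"
    using unit_cone_distance[OF x y xy ne] by blast
  \<comment> \<open>Two deviations of at most \<open>\<delta>\<close> leave
    \<open>norm v - 2 * \<delta>\<close> positive, because \<open>norm v \<ge> c\<close>.\<close>
  define \<delta> where "\<delta> = c / 4"
  \<comment> \<open>Half of a lower bound for the filter of \<open>y\<close> at \<open>x\<close>: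
    both filters stay at least \<open>e\<close> on the ball, and their quotient is positive
    there.\<close>
  define e where "e = x \<bullet> y / 2"
  have "x \<bullet> y \<le> 1" using norm_cauchy_schwarz[of x y] x y by simp
  then have e: "e > 0" "e \<le> 1 / 2" using xy by (auto simp: e_def)
  have pos: "e \<le> max_filter G z x" "e \<le> max_filter G z y" "max_filter G z x \<le> 2" if z: "z \<in> ball x e" for z
  proof -
    have "norm (x - z) < e" using z by (simp add: dist_norm)
    moreover have "max_filter G x x \<ge> 1" "max_filter G x y \<ge> 2 * e"
      using max_filter_inner_ge[OF self_in_orbit, of x x] max_filter_inner_ge[OF self_in_orbit, of x y] x
      by (simp_all add: dot_square_norm e_def)
    moreover have "max_filter G x x \<le> 1"
    proof -
      obtain q where "q \<in> orbit G x" "max_filter G x x = x \<bullet> q" by (rule max_filter_attained)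
      then show ?thesis using norm_cauchy_schwarz[of x q] norm_orbit[of q x] x by simp
    qed
    ultimately show "e \<le> max_filter G z x" "e \<le> max_filter G z y" "max_filter G z x \<le> 2"
      using max_filter_diff_le[of x x z] max_filter_diff_le[of x y z] max_filter_diff_le[of z x x] x y e
      by (simp_all add: norm_minus_commute)
  qed
  obtain w1 t1 p where w1: "w1 \<in> ball x (e / 2)" "sharp x w1 t1 p" using sharp_exists e(1) half_gt_zero by blast
  have t1: "t1 > 0" and p: "p \<in> orbit G x" using w1(2) by (auto simp: sharp_def)
  \<comment> \<open>Within distance \<open>r1\<close> of \<open>w1\<close>, all maximisers in the
    orbit of \<open>x\<close> are within \<open>\<delta>\<close> of \<open>p\<close> by
    \<open>sharp_Lipschitz\<close>.\<close>
  define r1 where "r1 = min (e / 2) (\<delta> * t1 / 2)"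
  have \<delta>: "\<delta> > 0" using c by (simp add: \<delta>_def)
  have r1: "r1 > 0" "r1 \<le> e / 2" "2 / t1 * r1 \<le> \<delta>"
    using e t1 \<delta> by (auto simp: r1_def min_def field_simps)
  obtain w t2 q where w: "w \<in> ball w1 (r1 / 2)" "sharp y w t2 q" using sharp_exists r1(1) half_gt_zero by blast
  have t2: "t2 > 0" and q: "q \<in> orbit G y" using w(2) by (auto simp: sharp_def)
  have ball1: "ball w1 r1 \<subseteq> ball x e"
  proof
    fix z assume "z \<in> ball w1 r1"
    then show "z \<in> ball x e" using w1(1) r1(2) dist_triangle[of x z w1] by simp
  qed
  have "w \<in> ball w1 r1" using w(1) r1(1) by simp
  then have wx: "w \<in> ball x e" using ball1 by blast
  \<comment> \<open>By homogeneity this factor makes the filters of \<open>x\<close> and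
    \<open>s *\<^sub>R y\<close> equal at \<open>w\<close>.\<close>
  define s where "s = max_filter G w x / max_filter G w y"
  have s: "s > 0" "s \<le> 2 / e"
    using pos[OF wx] e by (auto simp: s_def intro!: frac_le divide_pos_pos)
  define v where "v = p - s *\<^sub>R q"
  have v: "norm v \<ge> c" unfolding v_def using c(2)[OF p q] s by simp
  \<comment> \<open>The factor \<open>s\<close> enters because the deviation of
    \<open>s *\<^sub>R q'\<close> from \<open>s *\<^sub>R q\<close> is what has to stay within
    \<open>\<delta>\<close>.\<close>
  define r where "r = min (r1 / 2) (\<delta> * t2 / (2 * s))"
  have r: "r > 0" "r \<le> r1 / 2" "s * (2 / t2 * r) \<le> \<delta>"
    using r1 t2 s(1) \<delta> by (auto simp: r_def min_def field_simps)
  have ball: "ball w r \<subseteq> ball w1 r1"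
  proof
    fix z assume "z \<in> ball w r"
    then show "z \<in> ball w1 r1" using w(1) r(2) dist_triangle[of w1 z w] by simp
  qed
  let ?f = "\<lambda>z. max_filter G z x - s * max_filter G z y"
  have inc: "?f z < ?f (z + t *\<^sub>R v)" if t: "t > 0" and z: "z \<in> ball w r" "z + t *\<^sub>R v \<in> ball w r" for z t
  proof -
    \<comment> \<open>The maximisers are taken at opposite ends, \<open>p'\<close> at
      \<open>z\<close> and \<open>q'\<close> at \<open>z + t *\<^sub>R v\<close>. Testing each at
      the other end bounds the increase below by
      \<open>t * (v \<bullet> (p' - s *\<^sub>R q'))\<close>.\<close>
    obtain p' where p': "p' \<in> orbit G x" "max_filter G z x = z \<bullet> p'" by (rule max_filter_attained)
    obtain q' where q': "q' \<in> orbit G y" "max_filter G (z + t *\<^sub>R v) y = (z + t *\<^sub>R v) \<bullet> q'" by (rule max_filter_attained)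
    have "norm (p - p') \<le> 2 / t1 * norm (w1 - z)" by (rule sharp_Lipschitz[OF w1(2) p'])
    also have "\<dots> \<le> 2 / t1 * r1" using ball z(1) t1 by (intro mult_left_mono) (auto simp: dist_norm less_imp_le)
    finally have 1: "norm (p - p') \<le> \<delta>" using r1(3) by simp
    have "norm (q - q') \<le> 2 / t2 * norm (w - (z + t *\<^sub>R v))" by (rule sharp_Lipschitz[OF w(2) q'])
    also have "\<dots> \<le> 2 / t2 * r" using z(2) t2 by (intro mult_left_mono) (auto simp: dist_norm less_imp_le)
    finally have "s * norm (q - q') \<le> s * (2 / t2 * r)" using s(1) by (intro mult_left_mono) auto
    then have 2: "s * norm (q - q') \<le> \<delta>" using r(3) by simp
    have "v \<bullet> (p - p') \<le> norm v * \<delta>"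
      using norm_cauchy_schwarz[of v "p - p'"] mult_left_mono[OF 1, of "norm v"] by simp
    moreover have "- s * (v \<bullet> (q - q')) \<le> norm v * \<delta>"
    proof -
      have "- s * (v \<bullet> (q - q')) = v \<bullet> (s *\<^sub>R (q' - q))" by (simp add: inner_diff algebra_simps)
      also have "\<dots> \<le> norm v * norm (s *\<^sub>R (q' - q))" by (rule norm_cauchy_schwarz)
      also have "\<dots> = norm v * (s * norm (q - q'))" using s(1) by (simp add: norm_minus_commute)
      also have "\<dots> \<le> norm v * \<delta>" using 2 by (intro mult_left_mono) auto
      finally show ?thesis .
    qed
    moreover have "v \<bullet> (p' - s *\<^sub>R q') = v \<bullet> v - v \<bullet> (p - p') + s * (v \<bullet> (q - q'))"
      by (simp add: v_def inner_diff algebra_simps)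
    moreover have "v \<bullet> v = norm v * norm v" by (simp add: dot_square_norm power2_eq_square)
    ultimately have "v \<bullet> (p' - s *\<^sub>R q') \<ge> norm v * (norm v - 2 * \<delta>)" by (simp add: algebra_simps)
    moreover have "norm v * (norm v - 2 * \<delta>) > 0" using v c(1) by (intro mult_pos_pos) (auto simp: \<delta>_def)
    ultimately have "v \<bullet> (p' - s *\<^sub>R q') > 0" by linarith
    then have "t * (v \<bullet> (p' - s *\<^sub>R q')) > 0" using t by simp
    moreover have "max_filter G (z + t *\<^sub>R v) x \<ge> (z + t *\<^sub>R v) \<bullet> p'" by (rule max_filter_inner_ge[OF p'(1)])
    moreover have "s * max_filter G z y \<ge> s * (z \<bullet> q')"
      using s(1) max_filter_inner_ge[OF q'(1), of z] by simp
    ultimately show ?thesis using p'(2) q'(2) by (simp add: inner_diff inner_add_left algebra_simps)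
  qed
  have "?f w = 0" using pos[OF wx] e by (simp add: s_def)
  moreover have "continuous_on (ball w r) ?f" by (intro continuous_intros continuous_max_filter)
  moreover have "v \<noteq> 0" using v c(1) by auto
  ultimately have "\<not> sa_dim_le {z. max_filter G z x = max_filter G z (s *\<^sub>R y)} (int CARD('d) - 2)"
    using r(1) inc s(1)
    by (intro monotone_zero_set_not_sa_dim_le[of r w ?f v]) (simp_all add: max_filter_scaleR)
  \<comment> \<open>Rescaling cannot merge the orbits: equal norms force \<open>s = 1\<close>, where
    they were distinct from the start.\<close>
  moreover have "orbit G x \<noteq> orbit G (s *\<^sub>R y)"
  proof
    assume eq: "orbit G x = orbit G (s *\<^sub>R y)"
    have "x \<in> orbit G (s *\<^sub>R y)" using eq self_in_orbit by blast
    then have "norm x = norm (s *\<^sub>R y)" by (rule norm_orbit)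
    then have "s = 1" using x y s(1) by simp
    then show False using eq ne by simp
  qed
  ultimately show ?thesis unfolding strongly_separating_def by auto
qed

end

theorem theorem11:
  fixes G :: "(real^'d^'d::finite) set"
  assumes "semialg_orth_subgroup G"
  shows "((\<forall>x. orbit G x = {y. norm y = norm x}) \<longrightarrow> strongly_separating G CARD('d))
       \<and> (\<not> (\<forall>x. orbit G x = {y. norm y = norm x}) \<longrightarrow>
            strongly_separating G 1 \<and> \<not> strongly_separating G 2)"
proof -
  interpret semialgebraic_group G using assms by unfold_locales
  show ?thesis
    using strongly_separating_transitive strongly_separating_1 not_strongly_separating_2 by blast
qed

end
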